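(* Let $\ell\ge 0$, $m_0\in\mathcal P_\ell(\mathbb R^d)$ and, for $N\ge1$, $m^N=\frac1N\sum_{i=1}^N\delta_{\zeta_i}$, where $\zeta_1,\zeta_2,\ldots$ are i.i.d. $\mathbb R^d$-valued random variables with law $m_0$. Let $U:\mathcal P_\ell(\mathbb R^d)\to\mathbb R$. Let $D(\mu_2,\mu_1)$ denote the metric on $\mathcal P_\ell(\mathbb R^d)$ equal to $\int_{\mathbb R^d}(1+|y|^\ell)\,|\mu_2-\mu_1|(dy)$ if $m_0$ is discrete, and equal to $1_{\{\ell>0\}}W_\ell(\mu_2,\mu_1)+1_{\{\ell=0\}}\underline W(\mu_2,\mu_1)$ otherwise. Suppose that there exists $r>0$ such that, denoting by $B(m_0,r)$ the ball centered at $m_0$ with radius $r$ for the metric $D$: (1) $U$ admits a linear functional derivative $\frac{\delta U}{\delta m}$ on $B(m_0,r)$; (2) there exists $C<\infty$ such that for all $(\mu,x)\in B(m_0,r)\times\mathbb R^d$, $\left|\frac{\delta U}{\delta m}(\mu,x)\right|\le C(1+|x|^{\ell/2})$; (3) there exist $\alpha\in(1/2,1]$ and $C<\infty$ such that for all $\mu_1,\mu_2\in B(m_0,r)$ and all $x\in\mathbb R^d$, $$\left|\frac{\delta U}{\delta m}(\mu_2,x)-\frac{\delta U}{\delta m}(\mu_1,x)\right|\le C\left((1+|x|^\ell)\,W_0^\alpha(\mu_2,\mu_1)+(1+|x|^{\ell(1-\alpha)})\left(\int_{\mathbb R^d}|y|^\ell|\mu_2-\mu_1|(dy)\right)^\alpha\right);$$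 (4) $\displaystyle\sup_{x\in\mathbb R^d}\frac{\left|\frac{\delta U}{\delta m}(\mu,x)-\frac{\delta U}{\delta m}(m_0,x)\right|}{1+|x|^{\ell/2}}$ converges to $0$ when $D(\mu,m_0)$ goes to $0$. Then, as $N\to\infty$, the following convergence in distribution holds: $$\sqrt N\left(U(m^N)-U(m_0)\right)\Longrightarrow\mathcal N\left(0,\ \mathrm{Var}\left(\frac{\delta U}{\delta m}(m_0,\zeta_1)\right)\right).$$
   Context: For $\ell\ge0$, $\mathcal P_\ell(\mathbb R^d)$ is the set of Borel probability measures $m$ on $\mathbb R^d$ with $\int|x|^\ell m(dx)<\infty$ ($\mathcal P_0$ is the set of all probability measures). For $\ell>0$, $W_\ell(\mu_1,\mu_2)=\inf_\rho\left(\int|x-y|^\ell\rho(dx,dy)\right)^{1/(\ell\vee1)}$, the infimum being over couplings $\rho\in\mathcal P_\ell(\mathbb R^{2d})$ with marginals $\mu_1,\mu_2\in\mathcal P_\ell(\mathbb R^d)$. $W_0(\mu_1,\mu_2)=\inf_\rho\int1_{\{x\ne y\}}\rho(dx,dy)=\sup_{A}|\mu_1(A)-\mu_2(A)|=\frac12|\mu_1-\mu_2|(\mathbb R^d)$, and $\underline W(\mu_1,\mu_2)=\inf_\rho\int(|x-y|\wedge1)\rho(dx,dy)$, the infima being over couplings of $\mu_1,\mu_2\in\mathcal P_0(\mathbb R^d)$. $|\mu_2-\mu_1|$ denotes the total variation measure (absolute value) of the signed measure $\mu_2-\mu_1$. $m_0$ is discrete if it is concentrated on a countable set. A function $U:\mathcal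 P_\ell(\mathbb R^d)\to\mathbb R$ admits a linear functional derivative at $\mu\in\mathcal P_\ell(\mathbb R^d)$ if there is a measurable function $\mathbb R^d\ni y\mapsto\frac{\delta U}{\delta m}(\mu,y)\in\mathbb R$ such that $\sup_{y}\left|\frac{\delta U}{\delta m}(\mu,y)\right|/(1+|y|^\ell)<\infty$ and, for all $\nu\in\mathcal P_\ell(\mathbb R^d)$, the right-hand derivative at $0$ satisfies $\frac{d}{d\varepsilon}\big|_{\varepsilon=0^+}U(\mu+\varepsilon(\nu-\mu))=\int_{\mathbb R^d}\frac{\delta U}{\delta m}(\mu,y)(\nu-\mu)(dy)$. It is defined up to an additive constant, fixed by the normalisation $\frac{\delta U}{\delta m}(\mu,0)=0$.
   Formalization: It is additionally assumed that, for each N ≥ 1, U(m^N) is a Borel function of the sample (ζ_1,…,ζ_N); for arbitrary U, U(m^N) need not be a random variable and the convergence can fail. *)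

theory Defs
  imports "HOL-Probability.Probability"
begin

(* The power |x|^p with the convention |x|^0 = 1 also at x = 0, where 0 powr 0 = 0. *)
definition norm_pow :: "'a::real_normed_vector \<Rightarrow> real \<Rightarrow> real" where
  "norm_pow x p = (if p = 0 then 1 else norm x powr p)"

(* The space P_l of Borel probability measures with finite l-th moment. *)
definition prob_moment :: "real \<Rightarrow> 'a::euclidean_space measure set" where
  "prob_moment l = {m. sets m = sets borel \<and> prob_space m \<and> integrable m (\<lambda>x. norm_pow x l)}"

definition couplings ::
  "real \<Rightarrow> 'a::euclidean_space measure \<Rightarrow> 'a measure \<Rightarrow> ('a \<times> 'a) measure set" where
  "couplings l \<mu>1 \<mu>2 =
     {\<rho>. \<rho> \<in> prob_moment l \<and> distr \<rho> borel fst = \<mu>1 \<and> distr \<rho> borel snd = \<mu>2}"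

(* W_l for l > 0; the case l = 0 is W0 below. *)
definition W :: "real \<Rightarrow> 'a::euclidean_space measure \<Rightarrow> 'a measure \<Rightarrow> real" where
  "W l \<mu>1 \<mu>2 =
     (INF \<rho>\<in>couplings l \<mu>1 \<mu>2. (LINT z|\<rho>. norm_pow (fst z - snd z) l) powr (1 / max l 1))"

definition W0 :: "'a::euclidean_space measure \<Rightarrow> 'a measure \<Rightarrow> real" where
  "W0 \<mu>1 \<mu>2 = (INF \<rho>\<in>couplings 0 \<mu>1 \<mu>2. LINT z|\<rho>. indicator {z. fst z \<noteq> snd z} z)"

definition W_under :: "'a::euclidean_space measure \<Rightarrow> 'a measure \<Rightarrow> real" where
  "W_under \<mu>1 \<mu>2 = (INF \<rho>\<in>couplings 0 \<mu>1 \<mu>2. LINT z|\<rho>. min (norm (fst z - snd z)) 1)"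

(* The total variation measure of the signed measure \<mu>2 - \<mu>1 (for finite Borel measures),
   as the supremum over finite Borel partitions. *)
definition tv_measure :: "'a::euclidean_space measure \<Rightarrow> 'a measure \<Rightarrow> 'a measure" where
  "tv_measure \<mu>2 \<mu>1 = measure_of UNIV (sets borel)
     (\<lambda>A. SUP P\<in>{P. finite P \<and> disjoint P \<and> P \<subseteq> sets borel \<and> \<Union>P = A}.
        \<Sum>B\<in>P. ennreal \<bar>measure \<mu>2 B - measure \<mu>1 B\<bar>)"

definition discrete_measure :: "'a::euclidean_space measure \<Rightarrow> bool" where
  "discrete_measure m \<longleftrightarrow> (\<exists>S. countable S \<and> (AE x in m. x \<in> S))"

(* The metric D on P_l; the second argument m0 only decides which case applies. *)
definition D ::
  "real \<Rightarrow> 'a::euclidean_space measure \<Rightarrow> 'a measure \<Rightarrow> 'a measure \<Rightarrow> real" where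
  "D l m0 \<mu>2 \<mu>1 =
     (if discrete_measure m0 then LINT y|tv_measure \<mu>2 \<mu>1. 1 + norm_pow y l
      else if l > 0 then W l \<mu>2 \<mu>1
      else W_under \<mu>2 \<mu>1)"

definition D_ball :: "real \<Rightarrow> 'a::euclidean_space measure \<Rightarrow> real \<Rightarrow> 'a measure set" where
  "D_ball l m0 r = {\<mu> \<in> prob_moment l. D l m0 \<mu> m0 < r}"

(* \<mu> + \<epsilon>(\<nu> - \<mu>) for 0 \<le> \<epsilon> \<le> 1; values for other \<epsilon> are irrelevant. *)
definition mixture ::
  "real \<Rightarrow> 'a::euclidean_space measure \<Rightarrow> 'a measure \<Rightarrow> 'a measure" where
  "mixture \<epsilon> \<mu> \<nu> = measure_of UNIV (sets borel)
     (\<lambda>A. ennreal (1 - \<epsilon>) * emeasure \<mu> A + ennreal \<epsilon> * emeasure \<nu> A)"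

(* \<phi> is the linear functional derivative of U at \<mu>, normalised by \<phi> 0 = 0, which makes it
   unique. Only the values of U on prob_moment l matter. *)
definition has_lin_fun_deriv ::
  "real \<Rightarrow> ('a::euclidean_space measure \<Rightarrow> real) \<Rightarrow> 'a measure \<Rightarrow> ('a \<Rightarrow> real) \<Rightarrow> bool" where
  "has_lin_fun_deriv l U \<mu> \<phi> \<longleftrightarrow>
     \<phi> \<in> borel_measurable borel \<and>
     bdd_above (range (\<lambda>y. \<bar>\<phi> y\<bar> / (1 + norm_pow y l))) \<and>
     (\<forall>\<nu>\<in>prob_moment l.
        ((\<lambda>\<epsilon>. U (mixture \<epsilon> \<mu> \<nu>)) has_real_derivative
           ((LINT y|\<nu>. \<phi> y) - (LINT y|\<mu>. \<phi> y))) (at_right 0)) \<and>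
     \<phi> 0 = 0"

(* The empirical measure of x 0, ..., x (N - 1), for N \<ge> 1. *)
definition emp :: "nat \<Rightarrow> (nat \<Rightarrow> 'a::euclidean_space) \<Rightarrow> 'a measure" where
  "emp N x = measure_of UNIV (sets borel)
     (\<lambda>A. (\<Sum>i<N. emeasure (return borel (x i)) A) / of_nat N)"

(* N(0, v), with N(0, 0) the Dirac mass at 0; normal_density takes the standard deviation. *)
definition centered_normal :: "real \<Rightarrow> real measure" where
  "centered_normal v =
     (if v = 0 then return borel 0 else density lborel (normal_density 0 (sqrt v)))"

end

theory Submission
  imports Defs
begin

text \<open>
  Let \<open>V \<mu> = U \<mu> - U m0 - \<integral> dU m0 d(\<mu> - m0)\<close>. The classical central limit theorem handles the linear part,
  so it remains to see that \<open>\<surd>N V(m\<^sup>N)\<close> tends to 0 in probability. Replace the \<open>m0\<close>-components of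
  \<open>\<mu>\<^sub>k = (\<delta>\<^sub>\<zeta>\<^sub>1 + \<dots> + \<delta>\<^sub>\<zeta>\<^sub>k + (N - k) m0) / N\<close> by samples one at a time. By the mean value theorem along the
  segment from \<open>\<mu>\<^sub>k\<close> to \<open>\<mu>\<^sub>k\<^sub>+\<^sub>1\<close>, the increment of \<open>V\<close> is \<open>1/N\<close> times the centred value of
  \<open>dU \<mu>\<^sub>k - dU m0\<close> at the new sample, up to a Hoelder error of order \<open>N\<^sup>-\<^sup>1\<^sup>-\<^sup>\<alpha>\<close>. The centred terms are
  uncorrelated and uniformly small while \<open>\<mu>\<^sub>k\<close> stays close to \<open>m0\<close>, and \<open>N \<cdot> \<surd>N \<cdot> N\<^sup>-\<^sup>1\<^sup>-\<^sup>\<alpha>\<close> tends to 0 because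
  \<open>\<alpha> > 1/2\<close>. All \<open>\<mu>\<^sub>k\<close> are close to \<open>m0\<close> with high probability: for either choice of \<open>D\<close>, closeness follows from
  agreement on finitely many cells, controlled by Hoeffding's inequality, and from small moments
  outside of them, which are monotone in \<open>k\<close>.

  The functions \<open>U \<mu>\<^sub>k\<close> and \<open>dU \<mu>\<^sub>k\<close> are not assumed to be measurable in the samples for \<open>k < N\<close>. Integrating out
  one sample at a time by lower integrals avoids this: with the past fixed, every bound is a
  measurable function of the new sample.
\<close>

subsection \<open>Finite weighted sums of Borel measures\<close>

text \<open>The mean value theorem needs the whole segment between consecutive measures to stay near
  \<open>m0\<close>, and balls of \<open>D\<close> are not visibly convex. The process is therefore
  confined to a set cut out by inequalities affine in the measure: frequencies of finitely many
  cells, and a moment outside of them. Such a set is convex, lies in a ball of \<open>D\<close>, and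
  membership is a measurable condition on the samples. Once the process leaves it, the bounding
  function is set to 0.

  A step moves mass 1/N, so both distances in the Hoelder hypothesis are of order 1/N. This gives a
  factor N to the power -\<alpha> for the derivative and one more factor 1/N for \<open>U\<close>.
  At the new sample x the exponents l (1 - \<alpha>) and \<alpha> recombine, so that the error grows
  at most like |x| to the power l: integrable under \<open>m0\<close>, and in general no better.

  Both choices of \<open>D\<close> are served by one coupling that matches mass inside cells. In the
  discrete case the cells are single points, because total variation sees every move inside a larger
  cell.\<close>

definition wsum ::
  "'i set \<Rightarrow> ('i \<Rightarrow> real) \<Rightarrow> ('i \<Rightarrow> 'a::topological_space measure) \<Rightarrow> 'a measure" where
  "wsum I w ms = measure_of UNIV (sets borel) (\<lambda>A. \<Sum>i\<in>I. ennreal (w i) * emeasure (ms i) A)"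

lemma sigma_sets_borel: "sigma_sets UNIV (sets borel) = (sets borel :: 'a::topological_space set set)"
  using sets.sigma_sets_eq[of "borel :: 'a measure"] by simp

lemma sets_wsum [simp, measurable_cong]: "sets (wsum I w ms) = sets borel"
  by (simp add: wsum_def sigma_sets_borel)

lemma space_wsum [simp]: "space (wsum I w ms) = UNIV"
  by (simp add: wsum_def)

text \<open>Mixtures, partially sampled empirical measures and the couplings between them are all
  weighted sums, so countable additivity is checked for them only here.\<close>

lemma emeasure_wsum:
  assumes "\<And>i. i \<in> I \<Longrightarrow> sets (ms i) = sets borel" and "A \<in> sets borel"
  shows "emeasure (wsum I w ms) A = (\<Sum>i\<in>I. ennreal (w i) * emeasure (ms i) A)"
proof (rule emeasure_measure_of[OF wsum_def])
  show "positive (sets (wsum I w ms)) (\<lambda>A. \<Sum>i\<in>I. ennreal (w i) * emeasure (ms i) A)"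
    by (simp add: positive_def)
  show "countably_additive (sets (wsum I w ms)) (\<lambda>A. \<Sum>i\<in>I. ennreal (w i) * emeasure (ms i) A)"
    unfolding countably_additive_def
  proof safe
    fix B :: "nat \<Rightarrow> 'b set"
    assume B: "range B \<subseteq> sets (wsum I w ms)" "disjoint_family B"
    have "(\<Sum>n. \<Sum>i\<in>I. ennreal (w i) * emeasure (ms i) (B n))
        = (\<Sum>i\<in>I. \<Sum>n. ennreal (w i) * emeasure (ms i) (B n))"
      by (rule suminf_sum) simp
    also have "\<dots> = (\<Sum>i\<in>I. ennreal (w i) * emeasure (ms i) (\<Union>n. B n))"
      using B assms(1) by (intro sum.cong refl) (simp add: suminf_emeasure)
    finally show "(\<Sum>n. \<Sum>i\<in>I. ennreal (w i) * emeasure (ms i) (B n))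
        = (\<Sum>i\<in>I. ennreal (w i) * emeasure (ms i) (\<Union>n. B n))" .
  qed
qed (use assms in auto)

lemma nn_integral_wsum:
  assumes ms: "\<And>i. i \<in> I \<Longrightarrow> sets (ms i) = sets borel" and f: "f \<in> borel_measurable borel"
  shows "(\<integral>\<^sup>+x. f x \<partial>wsum I w ms) = (\<Sum>i\<in>I. ennreal (w i) * (\<integral>\<^sup>+x. f x \<partial>ms i))"
  using f
proof (induction rule: borel_measurable_induct)
  case (cong f g)
  then show ?case by (simp cong: nn_integral_cong)
next
  case (set A)
  then show ?case
    by (simp add: emeasure_wsum ms)
next
  case (mult u c)
  have "(\<integral>\<^sup>+x. c * u x \<partial>wsum I w ms) = c * (\<integral>\<^sup>+x. u x \<partial>wsum I w ms)"
    using mult.hyps by (intro nn_integral_cmult) simp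
  moreover have "(\<integral>\<^sup>+x. c * u x \<partial>ms i) = c * (\<integral>\<^sup>+x. u x \<partial>ms i)" if "i \<in> I" for i
    using mult.hyps ms[OF that] by (intro nn_integral_cmult) (simp cong: measurable_cong_sets)
  ultimately show ?case
    using mult.IH by (simp add: sum_distrib_left mult.left_commute)
next
  case (add u v)
  have "(\<integral>\<^sup>+x. v x + u x \<partial>wsum I w ms) = (\<integral>\<^sup>+x. v x \<partial>wsum I w ms) + (\<integral>\<^sup>+x. u x \<partial>wsum I w ms)"
    using add.hyps by (intro nn_integral_add) simp_all
  moreover have "(\<integral>\<^sup>+x. v x + u x \<partial>ms i) = (\<integral>\<^sup>+x. v x \<partial>ms i) + (\<integral>\<^sup>+x. u x \<partial>ms i)" if "i \<in> I" for i
    using add.hyps ms[OF that] by (intro nn_integral_add) (simp_all cong: measurable_cong_sets)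
  ultimately show ?case
    using add.IH by (simp add: sum.distrib distrib_left)
next
  case (seq U)
  have SUPapp: "(SUP i. U i) x = (SUP i. U i x)" for x
    by (simp add: image_image)
  have 1: "(\<integral>\<^sup>+x. (SUP n. U n x) \<partial>wsum I w ms) = (SUP n. \<integral>\<^sup>+x. U n x \<partial>wsum I w ms)"
    using seq.hyps by (intro nn_integral_monotone_convergence_SUP) simp_all
  have 2: "(\<integral>\<^sup>+x. (SUP n. U n x) \<partial>ms i) = (SUP n. \<integral>\<^sup>+x. U n x \<partial>ms i)" if "i \<in> I" for i
    using seq.hyps ms[OF that]
    by (intro nn_integral_monotone_convergence_SUP) (simp_all cong: measurable_cong_sets)
  have "(SUP n. \<Sum>i\<in>I. ennreal (w i) * (\<integral>\<^sup>+x. U n x \<partial>ms i))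
      = (\<Sum>i\<in>I. SUP n. ennreal (w i) * (\<integral>\<^sup>+x. U n x \<partial>ms i))"
    using seq.hyps
    by (intro ennreal_SUP_sum) (auto simp: incseq_def le_fun_def intro!: mult_left_mono nn_integral_mono)
  then show ?case
    using 1 2 seq.IH unfolding SUPapp by (simp add: SUP_mult_left_ennreal)
qed

lemma prob_space_wsum:
  assumes "\<And>i. i \<in> I \<Longrightarrow> sets (ms i) = sets borel" "\<And>i. i \<in> I \<Longrightarrow> prob_space (ms i)"
    and "\<And>i. i \<in> I \<Longrightarrow> 0 \<le> w i" "sum w I = 1"
  shows "prob_space (wsum I w ms)"
proof
  have "emeasure (ms i) UNIV = 1" if "i \<in> I" for i
    using prob_space.emeasure_space_1[OF assms(2)[OF that]] sets_eq_imp_space_eq[OF assms(1)[OF that]]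
    by simp
  then show "emeasure (wsum I w ms) (space (wsum I w ms)) = 1"
    using assms by (simp add: emeasure_wsum sum_ennreal)
qed

lemma integral_wsum_nonneg:
  fixes f :: "'a::topological_space \<Rightarrow> real"
  assumes "finite I" "\<And>i. i \<in> I \<Longrightarrow> sets (ms i) = sets borel" "\<And>i. i \<in> I \<Longrightarrow> 0 \<le> w i"
    and f: "f \<in> borel_measurable borel" "\<And>x. 0 \<le> f x" "\<And>i. i \<in> I \<Longrightarrow> integrable (ms i) f"
  shows "integrable (wsum I w ms) f"
    and "(LINT x|wsum I w ms. f x) = (\<Sum>i\<in>I. w i * (LINT x|ms i. f x))"
proof -
  have "(\<integral>\<^sup>+x. ennreal (f x) \<partial>wsum I w ms) = (\<Sum>i\<in>I. ennreal (w i) * (\<integral>\<^sup>+x. ennreal (f x) \<partial>ms i))"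
    using assms by (intro nn_integral_wsum) auto
  also have "\<dots> = (\<Sum>i\<in>I. ennreal (w i) * ennreal (LINT x|ms i. f x))"
    using assms by (intro sum.cong refl) (simp add: nn_integral_eq_integral)
  also have "\<dots> = ennreal (\<Sum>i\<in>I. w i * (LINT x|ms i. f x))"
    using assms by (simp add: ennreal_mult[symmetric] sum_ennreal)
  finally have *: "(\<integral>\<^sup>+x. ennreal (f x) \<partial>wsum I w ms) = ennreal (\<Sum>i\<in>I. w i * (LINT x|ms i. f x))" .
  show "integrable (wsum I w ms) f"
    by (rule integrableI_nn_integral_finite[OF _ _ *]) (use assms in \<open>auto intro!: sum_nonneg\<close>)
  show "(LINT x|wsum I w ms. f x) = (\<Sum>i\<in>I. w i * (LINT x|ms i. f x))"
    using assms * by (simp add: integral_eq_nn_integral sum_nonneg)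
qed

lemma integral_wsum:
  fixes f :: "'a::topological_space \<Rightarrow> real"
  assumes "finite I" "\<And>i. i \<in> I \<Longrightarrow> sets (ms i) = sets borel" "\<And>i. i \<in> I \<Longrightarrow> 0 \<le> w i"
    and f: "f \<in> borel_measurable borel" "\<And>i. i \<in> I \<Longrightarrow> integrable (ms i) f"
  shows "integrable (wsum I w ms) f"
    and "(LINT x|wsum I w ms. f x) = (\<Sum>i\<in>I. w i * (LINT x|ms i. f x))"
proof -
  have f_eq: "f x = max 0 (f x) - max 0 (- f x)" for x by (simp add: max_def)
  have p: "integrable (wsum I w ms) (\<lambda>x. max 0 (f x))"
      "(LINT x|wsum I w ms. max 0 (f x)) = (\<Sum>i\<in>I. w i * (LINT x|ms i. max 0 (f x)))"
    using assms by (intro integral_wsum_nonneg; simp)+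
  have n: "integrable (wsum I w ms) (\<lambda>x. max 0 (- f x))"
      "(LINT x|wsum I w ms. max 0 (- f x)) = (\<Sum>i\<in>I. w i * (LINT x|ms i. max 0 (- f x)))"
    using assms by (intro integral_wsum_nonneg; simp)+
  show "integrable (wsum I w ms) f"
    using p(1) n(1) by (subst f_eq[abs_def]) simp
  have "(LINT x|ms i. f x) = (LINT x|ms i. max 0 (f x)) - (LINT x|ms i. max 0 (- f x))" if "i \<in> I" for i
    using assms(5)[OF that] by (subst f_eq) simp
  moreover have "(LINT x|wsum I w ms. f x)
      = (LINT x|wsum I w ms. max 0 (f x)) - (LINT x|wsum I w ms. max 0 (- f x))"
    using p(1) n(1) by (subst f_eq) simp
  ultimately show "(LINT x|wsum I w ms. f x) = (\<Sum>i\<in>I. w i * (LINT x|ms i. f x))"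
    using p(2) n(2) by (simp add: right_diff_distrib sum_subtractf)
qed

lemma measure_wsum:
  assumes "finite I" "\<And>i. i \<in> I \<Longrightarrow> sets (ms i) = sets borel" "\<And>i. i \<in> I \<Longrightarrow> 0 \<le> w i"
    and "\<And>i. i \<in> I \<Longrightarrow> finite_measure (ms i)" "A \<in> sets borel"
  shows "measure (wsum I w ms) A = (\<Sum>i\<in>I. w i * measure (ms i) A)"
proof -
  have "emeasure (wsum I w ms) A = ennreal (\<Sum>i\<in>I. w i * measure (ms i) A)"
    using assms by (simp add: emeasure_wsum finite_measure.emeasure_eq_measure
        ennreal_mult[symmetric] sum_ennreal)
  then show ?thesis
    using assms by (intro measure_eq_emeasure_eq_ennreal) (auto intro!: sum_nonneg)
qed

subsection \<open>Moments\<close>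

lemma norm_pow_nonneg [simp]: "0 \<le> norm_pow x p"
  by (simp add: norm_pow_def)

lemma norm_pow_measurable [measurable]: "(\<lambda>x::'a::euclidean_space. norm_pow x p) \<in> borel_measurable borel"
  by (cases "p = 0") (simp_all add: norm_pow_def)

text \<open>Applied with b = 1 - \<alpha>, the exponent in the Hoelder hypothesis. The power stays
  on the right-hand side so that it can later combine with a power \<alpha> of the same weight. The
  case \<open>l * b = 0\<close> is separate because \<open>norm_pow\<close> is 1 at the origin
  there.\<close>

lemma norm_pow_le_powr:
  assumes "0 \<le> l" "0 \<le> b" "b \<le> 1"
  shows "norm_pow x (l * b) \<le> (1 + norm_pow x l) powr b"
proof (cases "l * b = 0")
  case True
  then show ?thesis
    using assms by (auto simp: norm_pow_def intro!: ge_one_powr_ge_zero)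
next
  case False
  then have "norm_pow x (l * b) = (norm x powr l) powr b"
    by (simp add: norm_pow_def powr_powr)
  also have "\<dots> \<le> (1 + norm_pow x l) powr b"
    using assms False by (intro powr_mono2) (auto simp: norm_pow_def)
  finally show ?thesis .
qed

lemma norm_pow_le:
  assumes "0 \<le> l" "0 \<le> b" "b \<le> 1"
  shows "norm_pow x (l * b) \<le> 1 + norm_pow x l"
proof -
  have "(1 + norm_pow x l) powr b \<le> (1 + norm_pow x l) powr 1"
    using assms by (intro powr_mono) auto
  then show ?thesis
    using norm_pow_le_powr[OF assms, of x] by simp
qed

text \<open>This turns growth of order l / 2, assumed for the derivative, into square integrability
  under measures with finite l-th moment.\<close>

lemma weight_half_sq_le:
  assumes "0 \<le> l"
  shows "(1 + norm_pow x (l / 2))\<^sup>2 \<le> 4 * (1 + norm_pow x l)"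
proof -
  have sq: "(norm_pow x (l / 2))\<^sup>2 = norm_pow x l"
    by (auto simp: norm_pow_def power2_eq_square powr_add[symmetric])
  have "(1 + norm_pow x (l / 2))\<^sup>2 \<le> 2 * (1 + norm_pow x l)"
    using sq zero_le_power2[of "1 - norm_pow x (l / 2)"]
    by (simp add: power2_eq_square algebra_simps)
  also have "\<dots> \<le> 4 * (1 + norm_pow x l)"
    by simp
  finally show "(1 + norm_pow x (l / 2))\<^sup>2 \<le> 4 * (1 + norm_pow x l)" .
qed

lemma prob_momentD:
  assumes "\<mu> \<in> prob_moment l"
  shows "sets \<mu> = sets borel" "prob_space \<mu>" "integrable \<mu> (\<lambda>x. norm_pow x l)" "space \<mu> = UNIV"
    "finite_measure \<mu>"
proof -
  show "sets \<mu> = sets borel" "prob_space \<mu>" "integrable \<mu> (\<lambda>x. norm_pow x l)"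
    using assms by (auto simp: prob_moment_def)
  show "space \<mu> = UNIV"
    using assms sets_eq_imp_space_eq[of \<mu> borel] by (auto simp: prob_moment_def)
  show "finite_measure \<mu>"
    using assms by (auto simp: prob_moment_def prob_space_def)
qed

lemma prob_moment_integrable_weight:
  assumes "\<mu> \<in> prob_moment l"
  shows "integrable \<mu> (\<lambda>x. 1 + norm_pow x l)"
proof -
  interpret prob_space \<mu> using prob_momentD[OF assms] by simp
  show ?thesis using prob_momentD[OF assms] by simp
qed

lemma prob_moment_integrable:
  fixes f :: "'a::euclidean_space \<Rightarrow> real"
  assumes "\<mu> \<in> prob_moment l" "f \<in> borel_measurable borel" "\<And>x. \<bar>f x\<bar> \<le> C * (1 + norm_pow x l)"
  shows "integrable \<mu> f"
proof (rule Bochner_Integration.integrable_bound)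
  show "integrable \<mu> (\<lambda>x. C * (1 + norm_pow x l))"
    using prob_moment_integrable_weight[OF assms(1)] by simp
  show "f \<in> borel_measurable \<mu>"
    using assms(2) prob_momentD(1)[OF assms(1)] by (simp cong: measurable_cong_sets)
  show "AE x in \<mu>. norm (f x) \<le> norm (C * (1 + norm_pow x l))"
    using assms(3) by (intro AE_I2) (fastforce intro: order_trans[OF _ abs_ge_self])
qed

lemma prob_moment_0:
  assumes "\<mu> \<in> prob_moment l"
  shows "\<mu> \<in> prob_moment 0"
proof -
  interpret prob_space \<mu> using prob_momentD(2)[OF assms] .
  show ?thesis using prob_momentD[OF assms] by (simp add: prob_moment_def norm_pow_def)
qed

lemma prob_moment_wsum:
  assumes "finite I" "\<And>i. i \<in> I \<Longrightarrow> ms i \<in> prob_moment l" "\<And>i. i \<in> I \<Longrightarrow> 0 \<le> w i" "sum w I = 1"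
  shows "wsum I w ms \<in> prob_moment l"
  unfolding prob_moment_def
  using assms
  by (auto intro!: prob_space_wsum integral_wsum dest: prob_momentD)

lemma prob_moment_return: "return borel x \<in> prob_moment l"
  unfolding prob_moment_def by (auto intro!: prob_space_return integrableI_bounded
      simp: nn_integral_return)

subsection \<open>Mixtures\<close>

lemma mixture_eq_wsum:
  "mixture e \<mu> \<nu> = wsum UNIV (\<lambda>b. if b then e else 1 - e) (\<lambda>b. if b then \<nu> else \<mu>)"
  by (simp add: mixture_def wsum_def UNIV_bool add.commute)

lemma sets_mixture [simp, measurable_cong]: "sets (mixture e \<mu> \<nu>) = sets borel"
  by (simp add: mixture_eq_wsum)

lemma emeasure_mixture:
  assumes "sets \<mu> = sets borel" "sets \<nu> = sets borel" "A \<in> sets borel"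
  shows "emeasure (mixture e \<mu> \<nu>) A = ennreal (1 - e) * emeasure \<mu> A + ennreal e * emeasure \<nu> A"
  unfolding mixture_eq_wsum using assms by (subst emeasure_wsum) (auto simp: UNIV_bool add.commute)

lemma prob_moment_mixture:
  assumes "0 \<le> e" "e \<le> 1" "\<mu> \<in> prob_moment l" "\<nu> \<in> prob_moment l"
  shows "mixture e \<mu> \<nu> \<in> prob_moment l"
  unfolding mixture_eq_wsum using assms by (intro prob_moment_wsum) (auto simp: UNIV_bool)

lemma integral_mixture:
  fixes f :: "'a::euclidean_space \<Rightarrow> real"
  assumes "0 \<le> e" "e \<le> 1" "sets \<mu> = sets borel" "sets \<nu> = sets borel"
    "f \<in> borel_measurable borel" "integrable \<mu> f" "integrable \<nu> f"
  shows "(LINT x|mixture e \<mu> \<nu>. f x) = (1 - e) * (LINT x|\<mu>. f x) + e * (LINT x|\<nu>. f x)"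
  unfolding mixture_eq_wsum using assms
  by (subst integral_wsum) (auto simp: UNIV_bool add.commute split: if_splits)

lemma measure_mixture:
  assumes "0 \<le> e" "e \<le> 1" "sets \<mu> = sets borel" "sets \<nu> = sets borel"
    "finite_measure \<mu>" "finite_measure \<nu>" "A \<in> sets borel"
  shows "measure (mixture e \<mu> \<nu>) A = (1 - e) * measure \<mu> A + e * measure \<nu> A"
  unfolding mixture_eq_wsum using assms
  by (subst measure_wsum) (auto simp: UNIV_bool add.commute split: if_splits)

text \<open>Moving from a point of a segment towards its end stays on the segment. Hence the
  one-sided derivative in the direction of \<nu>, taken at an intermediate point, becomes a right
  derivative in the parameter of the segment; \<open>mixture_mixture_left\<close> does the same for
  left derivatives.\<close>

lemma mixture_mixture_right:
  assumes "0 \<le> s" "s \<le> 1" "0 \<le> e" "e \<le> 1" "sets \<mu> = sets borel" "sets \<nu> = sets borel"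
  shows "mixture e (mixture s \<mu> \<nu>) \<nu> = mixture (s + e * (1 - s)) \<mu> \<nu>"
proof (rule measure_eqI)
  fix A assume A: "A \<in> sets (mixture e (mixture s \<mu> \<nu>) \<nu>)"
  have "ennreal (1 - e) * (ennreal (1 - s) * a + ennreal s * b) + ennreal e * b
      = ennreal (1 - (s + e * (1 - s))) * a + ennreal (s + e * (1 - s)) * b" for a b
  proof -
    have "1 - (s + e * (1 - s)) = (1 - e) * (1 - s)" "s + e * (1 - s) = (1 - e) * s + e"
      by (simp_all add: algebra_simps)
    then show ?thesis
      using assms by (simp add: ennreal_mult ennreal_plus distrib_left distrib_right mult.assoc add.assoc)
  qed
  then show "emeasure (mixture e (mixture s \<mu> \<nu>) \<nu>) A = emeasure (mixture (s + e * (1 - s)) \<mu> \<nu>) A"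
    using A assms by (simp add: emeasure_mixture)
qed simp

lemma mixture_commute: "mixture e \<mu> \<nu> = mixture (1 - e) \<nu> \<mu>"
  by (simp add: mixture_def add.commute)

lemma mixture_mixture_left:
  assumes "0 \<le> s" "s \<le> 1" "0 \<le> e" "e \<le> 1" "sets \<mu> = sets borel" "sets \<nu> = sets borel"
  shows "mixture e (mixture s \<mu> \<nu>) \<mu> = mixture (s - e * s) \<mu> \<nu>"
proof -
  have "mixture e (mixture s \<mu> \<nu>) \<mu> = mixture (1 - s + e * s) \<nu> \<mu>"
    using mixture_mixture_right[of "1 - s" e \<nu> \<mu>] assms by (simp add: mixture_commute[of s \<mu> \<nu>])
  also have "\<dots> = mixture (s - e * s) \<mu> \<nu>"
    by (subst mixture_commute) simp
  finally show ?thesis .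
qed

lemma mixture_0:
  assumes "sets \<mu> = sets borel" "sets \<nu> = sets borel"
  shows "mixture 0 \<mu> \<nu> = \<mu>"
  by (rule measure_eqI) (use assms in \<open>auto simp: emeasure_mixture\<close>)

lemma mixture_1:
  assumes "sets \<mu> = sets borel" "sets \<nu> = sets borel"
  shows "mixture 1 \<mu> \<nu> = \<nu>"
  by (rule measure_eqI) (use assms in \<open>auto simp: emeasure_mixture\<close>)

subsection \<open>Couplings\<close>

text \<open>The three vectors may live in different spaces: the lemma serves both the norm of a pair
  against its components and the norm of a difference.\<close>

lemma norm_pow_triangle:
  fixes z :: "'a::real_normed_vector" and x :: "'b::real_normed_vector" and y :: "'c::real_normed_vector"
  assumes "0 \<le> l" "norm z \<le> norm x + norm y"
  shows "norm_pow z l \<le> 2 powr l * (norm_pow x l + norm_pow y l)"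
proof (cases "l = 0")
  case True
  then show ?thesis by (simp add: norm_pow_def)
next
  case False
  have "norm z powr l \<le> (2 * max (norm x) (norm y)) powr l"
    using assms by (intro powr_mono2) auto
  also have "\<dots> = 2 powr l * max (norm x) (norm y) powr l"
    by (simp add: powr_mult)
  also have "max (norm x) (norm y) powr l \<le> norm x powr l + norm y powr l"
    by (simp add: max_def)
  finally show ?thesis
    using False by (simp add: norm_pow_def)
qed

lemma borel_measurable_projections:
  fixes \<rho> :: "('a::topological_space \<times> 'b::topological_space) measure"
  assumes "sets \<rho> = sets borel"
  shows "fst \<in> borel_measurable \<rho>" "snd \<in> borel_measurable \<rho>"
  unfolding measurable_cong_sets[OF assms refl]
  by (intro borel_measurable_continuous_onI continuous_intros)+

text \<open>The moment that \<open>couplings\<close> demands of \<rho> itself comes from the moments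
  of its marginals, since the norm of a pair is at most the sum of the norms.\<close>

lemma couplingsI:
  assumes "0 \<le> l" "sets \<rho> = sets borel" "prob_space \<rho>"
    "distr \<rho> borel fst = \<mu>1" "distr \<rho> borel snd = \<mu>2" "\<mu>1 \<in> prob_moment l" "\<mu>2 \<in> prob_moment l"
  shows "\<rho> \<in> couplings l \<mu>1 \<mu>2"
proof -
  note [measurable_cong] = assms(2)
  note [measurable] = borel_measurable_projections[OF assms(2)]
  have "integrable (distr \<rho> borel fst) (\<lambda>x. norm_pow x l)" "integrable (distr \<rho> borel snd) (\<lambda>x. norm_pow x l)"
    using prob_momentD(3)[OF assms(6)] prob_momentD(3)[OF assms(7)] by (simp_all only: assms(4,5))
  then have "integrable \<rho> (\<lambda>z. norm_pow (fst z) l)" "integrable \<rho> (\<lambda>z. norm_pow (snd z) l)"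
    using integrable_distr_eq[of fst \<rho> borel "\<lambda>x. norm_pow x l"]
      integrable_distr_eq[of snd \<rho> borel "\<lambda>x. norm_pow x l"] by simp_all
  then have "integrable \<rho> (\<lambda>z. 2 powr l * (norm_pow (fst z) l + norm_pow (snd z) l))"
    by simp
  then have "integrable \<rho> (\<lambda>z. norm_pow z l)"
  proof (rule Bochner_Integration.integrable_bound)
    have "norm_pow z l \<le> 2 powr l * (norm_pow (fst z) l + norm_pow (snd z) l)" for z :: "'a \<times> 'a"
      using norm_Pair_le[of "fst z" "snd z"] by (intro norm_pow_triangle assms(1)) simp
    then show "AE z in \<rho>. norm (norm_pow z l) \<le> norm (2 powr l * (norm_pow (fst z) l + norm_pow (snd z) l))"
      by (intro AE_I2) (auto intro: order_trans[OF _ abs_ge_self])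
  qed measurable
  then show ?thesis
    using assms by (simp add: couplings_def prob_moment_def)
qed

lemma W_le_coupling:
  assumes "\<rho> \<in> couplings l \<mu>1 \<mu>2"
  shows "W l \<mu>1 \<mu>2 \<le> (LINT z|\<rho>. norm_pow (fst z - snd z) l) powr (1 / max l 1)"
  unfolding W_def by (rule cINF_lower[OF _ assms]) (auto intro!: bdd_belowI2[where m=0])

lemma W_under_le_coupling:
  assumes "\<rho> \<in> couplings 0 \<mu>1 \<mu>2"
  shows "W_under \<mu>1 \<mu>2 \<le> (LINT z|\<rho>. min (norm (fst z - snd z)) 1)"
  unfolding W_under_def by (rule cINF_lower[OF _ assms]) (auto intro!: bdd_belowI2[where m=0])

lemma W0_le_coupling:
  assumes "\<rho> \<in> couplings 0 \<mu>1 \<mu>2"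
  shows "W0 \<mu>1 \<mu>2 \<le> (LINT z|\<rho>. indicator {z. fst z \<noteq> snd z} z)"
  unfolding W0_def by (rule cINF_lower[OF _ assms]) (auto intro!: bdd_belowI2[where m=0])

text \<open>Nonemptiness is assumed because an infimum over the empty set of reals has no useful
  value.\<close>

lemma W0_nonneg:
  assumes "couplings 0 \<mu>1 \<mu>2 \<noteq> {}"
  shows "0 \<le> W0 \<mu>1 \<mu>2"
  unfolding W0_def using assms by (intro cINF_greatest) auto

lemma off_diagonal_borel [measurable]:
  "{z::'a::euclidean_space \<times> 'a. fst z \<noteq> snd z} \<in> sets borel"
proof -
  have "closed {z::'a \<times> 'a. fst z = snd z}"
    by (intro closed_Collect_eq continuous_intros)
  then have "- {z::'a \<times> 'a. fst z = snd z} \<in> sets borel"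
    by auto
  then show ?thesis
    by (simp add: Collect_neg_eq)
qed

subsection \<open>Total variation\<close>

text \<open>\<open>tv_measure\<close> need not be known to be a measure: otherwise \<open>measure_of\<close> makes it zero, and
  upper bounds hold all the same.\<close>

lemma nn_integral_tv_measure_le:
  assumes \<sigma>: "sets \<sigma> = sets borel"
    and dom: "\<And>B. B \<in> sets borel \<Longrightarrow> ennreal \<bar>measure \<mu>2 B - measure \<mu>1 B\<bar> \<le> emeasure \<sigma> B"
  shows "(\<integral>\<^sup>+y. f y \<partial>tv_measure \<mu>2 \<mu>1) \<le> (\<integral>\<^sup>+y. f y \<partial>\<sigma>)"
proof -
  have sets_tv: "sets (tv_measure \<mu>2 \<mu>1) = sets borel"
    by (simp add: tv_measure_def sigma_sets_borel)
  have partition_le: "(\<Sum>B\<in>P. ennreal \<bar>measure \<mu>2 B - measure \<mu>1 B\<bar>) \<le> emeasure \<sigma> A"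
    if P: "finite P" "disjoint P" "P \<subseteq> sets borel" "\<Union>P = A" for P A
  proof -
    have "(\<Sum>B\<in>P. ennreal \<bar>measure \<mu>2 B - measure \<mu>1 B\<bar>) \<le> (\<Sum>B\<in>P. emeasure \<sigma> B)"
      using P dom by (intro sum_mono) auto
    also have "\<dots> = emeasure \<sigma> (\<Union>B\<in>P. B)"
      using P \<sigma> by (intro sum_emeasure) (auto simp: disjoint_def disjoint_family_on_def)
    finally show ?thesis using P(4) by simp
  qed
  have "emeasure (tv_measure \<mu>2 \<mu>1) A \<le> emeasure \<sigma> A" for A
  proof -
    have "(SUP P\<in>{P. finite P \<and> disjoint P \<and> P \<subseteq> sets borel \<and> \<Union>P = A}.
        \<Sum>B\<in>P. ennreal \<bar>measure \<mu>2 B - measure \<mu>1 B\<bar>) \<le> emeasure \<sigma> A"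
      using partition_le by (intro SUP_least) blast
    then show ?thesis
      unfolding tv_measure_def emeasure_measure_of_conv by auto
  qed
  then have "tv_measure \<mu>2 \<mu>1 \<le> \<sigma>"
    using sets_tv \<sigma> by (simp add: le_measure)
  then show ?thesis
    using sets_tv \<sigma> by (intro nn_integral_mono_measure) simp_all
qed

text \<open>On the diagonal both marginals count the same mass. They can therefore differ on B by at
  most the off-diagonal mass of \<rho> with one of its coordinates in B. The sum \<sigma> of the two
  projections of the off-diagonal part of \<rho> thus dominates the total variation.\<close>

lemma tv_integral_le_coupling:
  fixes \<mu>1 \<mu>2 :: "'a::euclidean_space measure" and g :: "'a \<Rightarrow> real"
  assumes \<rho>: "sets \<rho> = sets borel" "prob_space \<rho>" "distr \<rho> borel fst = \<mu>2" "distr \<rho> borel snd = \<mu>1"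
    and g: "g \<in> borel_measurable borel" "\<And>x. 0 \<le> g x" and "0 \<le> b"
    and le: "(\<integral>\<^sup>+z. indicator {z. fst z \<noteq> snd z} z * ennreal (g (fst z) + g (snd z)) \<partial>\<rho>) \<le> ennreal b"
  shows "(LINT y|tv_measure \<mu>2 \<mu>1. g y) \<le> b"
proof -
  interpret prob_space \<rho> by fact
  note [measurable_cong] = \<rho>(1) and [measurable] = g(1)
  have sp: "space \<rho> = UNIV"
    using sets_eq_imp_space_eq[OF \<rho>(1)] by simp
  have proj [measurable]: "fst \<in> borel_measurable (borel :: ('a \<times> 'a) measure)"
      "snd \<in> borel_measurable (borel :: ('a \<times> 'a) measure)"
    by (rule borel_measurable_projections[OF refl])+
  define N where "N = {z::'a \<times> 'a. fst z \<noteq> snd z}"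
  have [measurable]: "N \<in> sets borel" by (simp add: N_def)
  define \<sigma> where "\<sigma> = wsum (UNIV :: bool set) (\<lambda>_. 1)
    (\<lambda>b. distr (density \<rho> (indicator N)) borel (if b then fst else snd))"
  have emb: "emeasure (distr (density \<rho> (indicator N)) borel h) B = emeasure \<rho> {z. z \<in> N \<and> h z \<in> B}"
    if [measurable]: "B \<in> sets borel" "h \<in> borel_measurable borel" for h B
  proof -
    have "h -` B \<in> sets borel" using measurable_sets[OF that(2,1)] by simp
    then have "emeasure (distr (density \<rho> (indicator N)) borel h) B
        = (\<integral>\<^sup>+z. indicator N z * indicator (h -` B) z \<partial>\<rho>)"
      by (subst emeasure_distr) (auto simp: sp emeasure_density \<rho>(1))
    also have "\<dots> = (\<integral>\<^sup>+z. indicator {z. z \<in> N \<and> h z \<in> B} z \<partial>\<rho>)"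
      by (intro nn_integral_cong) (auto split: split_indicator)
    also have "\<dots> = emeasure \<rho> {z. z \<in> N \<and> h z \<in> B}"
      by (intro nn_integral_indicator) measurable
    finally show ?thesis .
  qed
  have \<mu>: "measure \<mu>2 B = measure \<rho> {z. fst z \<in> B}" "measure \<mu>1 B = measure \<rho> {z. snd z \<in> B}"
    if "B \<in> sets borel" for B
  proof -
    show "measure \<mu>2 B = measure \<rho> {z. fst z \<in> B}" "measure \<mu>1 B = measure \<rho> {z. snd z \<in> B}"
      using that borel_measurable_projections[OF \<rho>(1)] by (auto simp: \<rho>(3,4)[symmetric] measure_distr sp vimage_def)
  qed
  have dom: "ennreal \<bar>measure \<mu>2 B - measure \<mu>1 B\<bar> \<le> emeasure \<sigma> B" if [measurable]: "B \<in> sets borel" for B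
  proof -
    have aux: "measure \<rho> {z. h z \<in> B} \<le> measure \<rho> {z. k z \<in> B} + measure \<rho> {z. z \<in> N \<and> h z \<in> B}"
      if [measurable]: "h \<in> borel_measurable borel" "k \<in> borel_measurable borel"
        and eq: "\<And>z. z \<notin> N \<Longrightarrow> h z = k z" for h k :: "'a \<times> 'a \<Rightarrow> 'a"
    proof -
      have "measure \<rho> {z. h z \<in> B} \<le> measure \<rho> ({z. k z \<in> B} \<union> {z. z \<in> N \<and> h z \<in> B})"
      proof (rule finite_measure_mono)
        show "{z. h z \<in> B} \<subseteq> {z. k z \<in> B} \<union> {z. z \<in> N \<and> h z \<in> B}"
        proof
          fix z assume "z \<in> {z. h z \<in> B}"
          then show "z \<in> {z. k z \<in> B} \<union> {z. z \<in> N \<and> h z \<in> B}"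
            using eq[of z] by (cases "z \<in> N") simp_all
        qed
      qed measurable
      also have "\<dots> \<le> measure \<rho> {z. k z \<in> B} + measure \<rho> {z. z \<in> N \<and> h z \<in> B}"
        by (intro measure_Un_le) measurable
      finally show ?thesis .
    qed
    have le: "\<bar>measure \<mu>2 B - measure \<mu>1 B\<bar>
        \<le> measure \<rho> {z. z \<in> N \<and> snd z \<in> B} + measure \<rho> {z. z \<in> N \<and> fst z \<in> B}"
    proof -
      have "measure \<mu>2 B \<le> measure \<mu>1 B + measure \<rho> {z. z \<in> N \<and> fst z \<in> B}"
        unfolding \<mu>[OF that] by (rule aux[OF proj]) (simp add: N_def)
      moreover have "measure \<mu>1 B \<le> measure \<mu>2 B + measure \<rho> {z. z \<in> N \<and> snd z \<in> B}"
        unfolding \<mu>[OF that] by (rule aux[OF proj(2,1)]) (simp add: N_def)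
      moreover have "0 \<le> measure \<rho> {z. z \<in> N \<and> fst z \<in> B}" "0 \<le> measure \<rho> {z. z \<in> N \<and> snd z \<in> B}"
        by simp_all
      ultimately show ?thesis by linarith
    qed
    have "emeasure \<sigma> B = emeasure \<rho> {z. z \<in> N \<and> snd z \<in> B} + emeasure \<rho> {z. z \<in> N \<and> fst z \<in> B}"
      unfolding \<sigma>_def using emb[OF that proj(1)] emb[OF that proj(2)]
      by (subst emeasure_wsum[OF _ that]) (simp_all add: UNIV_bool)
    then show ?thesis
      using ennreal_leI[OF le] by (simp add: emeasure_eq_measure)
  qed
  have "(\<integral>\<^sup>+y. ennreal (g y) \<partial>tv_measure \<mu>2 \<mu>1) \<le> (\<integral>\<^sup>+y. ennreal (g y) \<partial>\<sigma>)"
    by (rule nn_integral_tv_measure_le[OF _ dom]) (simp_all add: \<sigma>_def)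
  also have "\<dots> = (\<integral>\<^sup>+z. indicator N z * ennreal (g (snd z)) \<partial>\<rho>) + (\<integral>\<^sup>+z. indicator N z * ennreal (g (fst z)) \<partial>\<rho>)"
  proof -
    have "(\<integral>\<^sup>+y. ennreal (g y) \<partial>distr (density \<rho> (indicator N)) borel h)
        = (\<integral>\<^sup>+z. indicator N z * ennreal (g (h z)) \<partial>\<rho>)" if [measurable]: "h \<in> borel_measurable borel" for h
      by (simp add: nn_integral_distr nn_integral_density)
    from this[OF proj(1)] this[OF proj(2)] show ?thesis
      unfolding \<sigma>_def by (subst nn_integral_wsum) (simp_all add: UNIV_bool)
  qed
  also have "\<dots> = (\<integral>\<^sup>+z. indicator N z * ennreal (g (fst z) + g (snd z)) \<partial>\<rho>)"
    using g(2) by (subst nn_integral_add[symmetric]) (auto simp: distrib_left add.commute)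
  also have "\<dots> \<le> ennreal b"
    using le by (simp add: N_def)
  finally have *: "(\<integral>\<^sup>+y. ennreal (g y) \<partial>tv_measure \<mu>2 \<mu>1) \<le> ennreal b" .
  have "(LINT y|tv_measure \<mu>2 \<mu>1. g y) = enn2real (\<integral>\<^sup>+y. ennreal (g y) \<partial>tv_measure \<mu>2 \<mu>1)"
    using g(2) by (intro integral_eq_nn_integral) (auto simp: tv_measure_def sigma_sets_borel cong: measurable_cong_sets)
  also have "\<dots> \<le> b"
    using enn2real_mono[OF *] \<open>0 \<le> b\<close> by simp
  finally show ?thesis .
qed

subsection \<open>Coupling two measures cell by cell\<close>

text \<open>If \<open>u k\<close> is the fraction of the mass of cell k that gets matched inside the
  cell, this is the density of the unmatched mass with respect to the original measure.\<close>

definition cell_rest :: "nat \<Rightarrow> (nat \<Rightarrow> 'a set) \<Rightarrow> (nat \<Rightarrow> real) \<Rightarrow> 'a \<Rightarrow> real" where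
  "cell_rest n A u x = 1 - (\<Sum>k<n. u k * indicat_real (A k) x)"

lemma cell_rest_eq:
  assumes "disjoint_family A"
  shows "cell_rest n A u x = (\<Sum>k<n. (1 - u k) * indicat_real (A k) x) + indicator (- (\<Union>k<n. A k)) x"
proof -
  have "(\<Sum>k<n. indicat_real (A k) x) = indicator (\<Union>k<n. A k) x"
    using assms by (subst indicator_UN_disjoint) (auto simp: disjoint_family_on_def)
  then have "(\<Sum>k<n. indicat_real (A k) x) + indicator (- (\<Union>k<n. A k)) x = (1 :: real)"
    by (simp add: indicator_def)
  then show ?thesis
    by (simp add: cell_rest_def left_diff_distrib sum_subtractf)
qed

lemma cell_rest_nonneg:
  assumes "disjoint_family A" "\<And>k. k < n \<Longrightarrow> u k \<le> 1"
  shows "0 \<le> cell_rest n A u x"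
  unfolding cell_rest_eq[OF assms(1)] using assms(2) by (intro add_nonneg_nonneg sum_nonneg) auto

lemma cell_rest_le_1:
  assumes "\<And>k. k < n \<Longrightarrow> 0 \<le> u k"
  shows "cell_rest n A u x \<le> 1"
  unfolding cell_rest_def using assms by (auto intro!: sum_nonneg)

lemma cell_rest_measurable [measurable]:
  assumes "\<And>k. A k \<in> sets M"
  shows "cell_rest n A u \<in> borel_measurable M"
proof -
  note [measurable] = assms
  show ?thesis unfolding cell_rest_def[abs_def] by measurable
qed

lemma cell_rest_integral:
  assumes "prob_space m" "\<And>k. A k \<in> sets m"
  shows "(LINT x|m. cell_rest n A u x) = 1 - (\<Sum>k<n. u k * measure m (A k))"
proof -
  interpret prob_space m by fact
  show ?thesis
    unfolding cell_rest_def using assms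
    by (subst Bochner_Integration.integral_diff)
      (auto intro!: Bochner_Integration.integrable_sum simp: prob_space emeasure_eq_measure
        Bochner_Integration.integral_sum simp del: sum_mult_indicator)
qed

text \<open>Inside each of the n cells the unmatched mass is at most \<kappa> and g is at most b.
  Outside of the cells everything is unmatched and g may be unbounded, so that part remains as a
  tail integral.\<close>

lemma cell_rest_weighted_integral:
  fixes g :: "'a \<Rightarrow> real" and n :: nat and b \<kappa> :: real
  assumes m: "prob_space m" and A: "\<And>k. A k \<in> sets m" "disjoint_family A"
    and u: "\<And>k. k < n \<Longrightarrow> 0 \<le> u k" "\<And>k. k < n \<Longrightarrow> u k \<le> 1"
    and g: "integrable m g" "\<And>x. 0 \<le> g x" "\<And>k x. k < n \<Longrightarrow> x \<in> A k \<Longrightarrow> g x \<le> b"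
    and gap: "\<And>k. k < n \<Longrightarrow> (1 - u k) * measure m (A k) \<le> \<kappa>" and "0 \<le> b"
  shows "integrable m (\<lambda>x. g x * cell_rest n A u x)"
    and "(LINT x|m. g x * cell_rest n A u x)
      \<le> n * \<kappa> * b + (LINT x|m. g x * indicator (- (\<Union>k<n. A k)) x)"
proof -
  interpret prob_space m by fact
  note [measurable] = A(1) and [measurable] = borel_measurable_integrable[OF g(1)]
  show int: "integrable m (\<lambda>x. g x * cell_rest n A u x)"
    using g(1)
  proof (rule Bochner_Integration.integrable_bound)
    show "AE x in m. norm (g x * cell_rest n A u x) \<le> norm (g x)"
      using cell_rest_nonneg[OF A(2), of n u] cell_rest_le_1[of n u A] u g(2)
      by (intro AE_I2) (simp add: mult_left_le)
  qed measurable
  have T: "(- (\<Union>k<n. A k)) \<inter> space m \<in> sets m"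
  proof -
    have "space m - (\<Union>k<n. A k) \<in> sets m" by measurable
    then show ?thesis by (simp add: Diff_eq Int_commute)
  qed
  have intT: "integrable m (\<lambda>x. g x * indicator (- (\<Union>k<n. A k)) x)"
  proof -
    have "integrable m (\<lambda>x. g x * indicator ((- (\<Union>k<n. A k)) \<inter> space m) x)"
      by (rule integrable_real_mult_indicator[OF T g(1)])
    then show ?thesis
      by (rule Bochner_Integration.integrable_cong[THEN iffD1, OF refl, rotated])
        (simp add: indicator_def)
  qed
  have "(LINT x|m. g x * cell_rest n A u x)
      \<le> (LINT x|m. (\<Sum>k<n. ((1 - u k) * b) * indicator (A k) x) + g x * indicator (- (\<Union>k<n. A k)) x)"
  proof (rule integral_mono[OF int])
    show "integrable m (\<lambda>x. (\<Sum>k<n. ((1 - u k) * b) * indicator (A k) x)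
        + g x * indicator (- (\<Union>k<n. A k)) x)"
      using intT by (intro Bochner_Integration.integrable_add Bochner_Integration.integrable_sum)
        (auto simp: emeasure_eq_measure simp del: sum_mult_indicator)
    fix x
    have "g x * (\<Sum>k<n. (1 - u k) * indicator (A k) x) \<le> (\<Sum>k<n. ((1 - u k) * b) * indicator (A k) x)"
      unfolding sum_distrib_left using u g(3)
      by (intro sum_mono) (auto simp: indicator_def mult.commute[of "g x"] intro: mult_left_mono)
    then show "g x * cell_rest n A u x \<le> (\<Sum>k<n. ((1 - u k) * b) * indicator (A k) x)
        + g x * indicator (- (\<Union>k<n. A k)) x"
      unfolding cell_rest_eq[OF A(2)] by (simp add: distrib_left del: sum_mult_indicator)
  qed
  also have "\<dots> = (\<Sum>k<n. ((1 - u k) * b) * measure m (A k)) + (LINT x|m. g x * indicator (- (\<Union>k<n. A k)) x)"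
    using intT A(1)
    by (subst Bochner_Integration.integral_add)
      (auto simp: emeasure_eq_measure Bochner_Integration.integral_sum simp del: sum_mult_indicator)
  also have "(\<Sum>k<n. ((1 - u k) * b) * measure m (A k)) \<le> (\<Sum>k<n. \<kappa> * b)"
    using gap \<open>0 \<le> b\<close>
    by (intro sum_mono) (metis lessThan_iff mult.assoc mult.commute mult_right_mono)
  finally show "(LINT x|m. g x * cell_rest n A u x)
      \<le> n * \<kappa> * b + (LINT x|m. g x * indicator (- (\<Union>k<n. A k)) x)"
    by simp
qed

text \<open>On each cell the common mass is coupled by the product measure, and the remaining masses are coupled
  independently. If nothing remains, division by zero removes the second term.\<close>

definition cell_density ::
  "nat \<Rightarrow> (nat \<Rightarrow> 'a set) \<Rightarrow> 'a measure \<Rightarrow> 'a measure \<Rightarrow> 'a \<Rightarrow> 'a \<Rightarrow> real" where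
  "cell_density n A \<mu> m x y =
     (let p = (\<lambda>k. min (measure \<mu> (A k)) (measure m (A k)))
      in (\<Sum>k<n. p k / (measure \<mu> (A k) * measure m (A k)) * indicator (A k) x * indicator (A k) y)
         + cell_rest n A (\<lambda>k. p k / measure \<mu> (A k)) x * cell_rest n A (\<lambda>k. p k / measure m (A k)) y
           / (1 - (\<Sum>k<n. p k)))"

lemma cell_density_commute: "cell_density n A \<mu> m x y = cell_density n A m \<mu> y x"
  by (simp add: cell_density_def Let_def min.commute mult.commute mult.left_commute)

text \<open>Integrating out y turns the matched part into the matched fraction at x and the product
  part into the unmatched fraction at x, because the other unmatched mass has total q. The two
  fractions add up to 1.\<close>

lemma cell_density_marginal:
  assumes \<mu>: "prob_space \<mu>" "\<And>k. A k \<in> sets \<mu>" and m: "prob_space m" "\<And>k. A k \<in> sets m"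
    and A: "disjoint_family A"
  shows "AE x in \<mu>. (\<integral>\<^sup>+y. ennreal (cell_density n A \<mu> m x y) \<partial>m) = 1"
    and "0 \<le> cell_density n A \<mu> m x y"
proof -
  interpret M: prob_space \<mu> by fact
  interpret m: prob_space m by fact
  note [measurable] = \<mu>(2) m(2)
  define p where "p k = min (measure \<mu> (A k)) (measure m (A k))" for k
  define u where "u k = p k / measure \<mu> (A k)" for k
  define v where "v k = p k / measure m (A k)" for k
  define q where "q = 1 - (\<Sum>k<n. p k)"
  have uv: "u k \<le> 1" "v k \<le> 1" "0 \<le> u k" "0 \<le> v k" for k
    unfolding u_def v_def p_def by (auto simp: divide_le_eq min_def not_less)
  have w: "cell_density n A \<mu> m x y
      = (\<Sum>k<n. p k / (measure \<mu> (A k) * measure m (A k)) * indicator (A k) x * indicator (A k) y)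
         + cell_rest n A u x * cell_rest n A v y / q" for x y
    by (simp add: cell_density_def Let_def p_def[abs_def] u_def[abs_def] v_def[abs_def] q_def)
  \<comment> \<open>This includes cells of measure 0: there \<open>p k\<close>, being a minimum, is
    0 as well.\<close>
  have pu: "u k * measure \<mu> (A k) = p k" "v k * measure m (A k) = p k" for k
    using measure_nonneg[of \<mu> "A k"] measure_nonneg[of m "A k"]
    by (auto simp: u_def v_def p_def min_def measure_le_0_iff)
  have q_u: "(LINT x|\<mu>. cell_rest n A u x) = q" and q_v: "(LINT y|m. cell_rest n A v y) = q"
    using cell_rest_integral[OF \<mu>] cell_rest_integral[OF m] by (simp_all add: pu q_def)
  have rest: "0 \<le> cell_rest n A u x" "0 \<le> cell_rest n A v x" "cell_rest n A u x \<le> 1" "cell_rest n A v x \<le> 1" for x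
    using uv by (auto intro!: cell_rest_nonneg[OF A] cell_rest_le_1)
  have q0: "0 \<le> q"
    using q_u rest Bochner_Integration.integral_nonneg[of \<mu> "cell_rest n A u"] by simp
  show nn: "0 \<le> cell_density n A \<mu> m x y" for x y
    unfolding w using q0 rest by (intro add_nonneg_nonneg sum_nonneg) (auto simp: p_def)
  have int_u: "integrable \<mu> (cell_rest n A u)" and int_v: "integrable m (cell_rest n A v)"
    using rest by (auto intro!: M.integrable_const_bound[where B=1] m.integrable_const_bound[where B=1])
  \<comment> \<open>If q = 0, division by zero drops the product part. Nothing is lost for almost
    every x, because the unmatched fraction is nonnegative with integral 0.\<close>
  have AE0: "AE x in \<mu>. q = 0 \<longrightarrow> cell_rest n A u x = 0"
  proof (cases "q = 0")
    case True
    then show ?thesis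
      using integral_nonneg_eq_0_iff_AE[OF int_u] rest q_u by auto
  qed simp
  have "(\<integral>\<^sup>+y. ennreal (cell_density n A \<mu> m x y) \<partial>m) = 1"
    if x: "q = 0 \<longrightarrow> cell_rest n A u x = 0" for x
  proof -
    have "(\<integral>\<^sup>+y. ennreal (cell_density n A \<mu> m x y) \<partial>m) = ennreal (LINT y|m. cell_density n A \<mu> m x y)"
      unfolding w using nn[unfolded w] int_v
      by (intro nn_integral_eq_integral Bochner_Integration.integrable_add Bochner_Integration.integrable_sum)
        (auto simp: m.emeasure_eq_measure simp del: sum_mult_indicator)
    also have "(LINT y|m. cell_density n A \<mu> m x y)
        = (\<Sum>k<n. p k / (measure \<mu> (A k) * measure m (A k)) * indicator (A k) x * measure m (A k))
          + cell_rest n A u x * q / q"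
      unfolding w using int_v
      by (subst Bochner_Integration.integral_add)
        (auto simp: m.emeasure_eq_measure q_v Bochner_Integration.integral_sum simp del: sum_mult_indicator)
    also have "\<dots> = (\<Sum>k<n. u k * indicator (A k) x) + cell_rest n A u x"
    proof -
      have "p k / (measure \<mu> (A k) * measure m (A k)) * indicator (A k) x * measure m (A k)
          = u k * indicator (A k) x" for k
        by (auto simp: u_def p_def min_def measure_le_0_iff)
      then show ?thesis using x by (auto simp del: sum_mult_indicator)
    qed
    finally show ?thesis by (simp add: cell_rest_def)
  qed
  then show "AE x in \<mu>. (\<integral>\<^sup>+y. ennreal (cell_density n A \<mu> m x y) \<partial>m) = 1"
    using AE0 by auto
qed


text \<open>Matched pairs share a cell and cost at most \<tau>. Unmatched points are paired
  independently, so the bound C (g x + g y) splits into two terms, each integrated against one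
  unmatched mass only.\<close>

lemma exists_cell_coupling:
  fixes \<mu> m :: "'a::euclidean_space measure" and A :: "nat \<Rightarrow> 'a set" and n :: nat
    and b C \<tau> \<kappa> :: real
    and g :: "'a \<Rightarrow> real" and c :: "'a \<times> 'a \<Rightarrow> real"
  assumes \<mu>: "prob_space \<mu>" "sets \<mu> = sets borel" and m: "prob_space m" "sets m = sets borel"
    and A: "\<And>k. A k \<in> sets borel" "disjoint_family A"
    and g: "integrable \<mu> g" "integrable m g" "\<And>x. 0 \<le> g x" "\<And>k x. k < n \<Longrightarrow> x \<in> A k \<Longrightarrow> g x \<le> b"
    and c: "c \<in> borel_measurable borel" "\<And>x y. c (x, y) \<le> C * (g x + g y)"
      "\<And>k x y. k < n \<Longrightarrow> x \<in> A k \<Longrightarrow> y \<in> A k \<Longrightarrow> c (x, y) \<le> \<tau>"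
    and gap: "\<And>k. k < n \<Longrightarrow> \<bar>measure \<mu> (A k) - measure m (A k)\<bar> \<le> \<kappa>"
    and pos: "0 \<le> b" "0 \<le> C" "0 \<le> \<tau>" "0 \<le> \<kappa>"
  obtains \<rho> where "sets \<rho> = sets borel" "prob_space \<rho>" "distr \<rho> borel fst = \<mu>" "distr \<rho> borel snd = m"
    "(\<integral>\<^sup>+z. ennreal (c z) \<partial>\<rho>) \<le> ennreal (\<tau> + C * (2 * n * \<kappa> * b
       + (LINT x|\<mu>. g x * indicator (- (\<Union>k<n. A k)) x) + (LINT x|m. g x * indicator (- (\<Union>k<n. A k)) x)))"
proof -
  interpret M: prob_space \<mu> by fact
  interpret m: prob_space m by fact
  interpret P: pair_prob_space \<mu> m ..
  note [measurable_cong] = \<mu>(2) m(2) and [measurable] = A(1) c(1)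
  have [measurable]: "g \<in> borel_measurable borel"
    using borel_measurable_integrable[OF g(1)] \<mu>(2) by (simp cong: measurable_cong_sets)
  have A\<mu>: "A k \<in> sets \<mu>" and Am: "A k \<in> sets m" for k using A(1) \<mu>(2) m(2) by auto
  define T where "T = - (\<Union>k<n. A k)"
  define p where "p k = min (measure \<mu> (A k)) (measure m (A k))" for k
  define u where "u k = p k / measure \<mu> (A k)" for k
  define v where "v k = p k / measure m (A k)" for k
  define q where "q = 1 - (\<Sum>k<n. p k)"
  define a where "a = cell_rest n A u"
  define b' where "b' = cell_rest n A v"
  define r where "r k = p k / (measure \<mu> (A k) * measure m (A k))" for k
  define w where "w = cell_density n A \<mu> m"
  have w_eq: "w x y = (\<Sum>k<n. r k * indicator (A k) x * indicator (A k) y) + a x * b' y / q" for x y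
    by (simp add: w_def cell_density_def Let_def p_def[abs_def] u_def[abs_def] v_def[abs_def] q_def
        a_def b'_def r_def)
  have [measurable]: "a \<in> borel_measurable borel" "b' \<in> borel_measurable borel"
    unfolding a_def b'_def by (auto intro!: cell_rest_measurable A)
  have w_meas: "(\<lambda>z. w (fst z) (snd z)) \<in> borel_measurable (borel \<Otimes>\<^sub>M borel)"
    unfolding w_eq by measurable
  then have [measurable]: "(\<lambda>z. w (fst z) (snd z)) \<in> borel_measurable (\<mu> \<Otimes>\<^sub>M m)"
    by (simp cong: measurable_cong_sets sets_pair_measure_cong)
  have w_nonneg: "0 \<le> w x y" for x y
    unfolding w_def by (rule cell_density_marginal(2)[OF \<mu>(1) A\<mu> m(1) Am A(2)])
  have w_1: "AE x in \<mu>. (\<integral>\<^sup>+y. ennreal (w x y) \<partial>m) = 1"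
    unfolding w_def by (rule cell_density_marginal(1)[OF \<mu>(1) A\<mu> m(1) Am A(2)])
  have w_2: "AE y in m. (\<integral>\<^sup>+x. ennreal (w x y) \<partial>\<mu>) = 1"
    unfolding w_def cell_density_commute[of n A \<mu> m]
    by (rule cell_density_marginal(1)[OF m(1) Am \<mu>(1) A\<mu> A(2)])
  define \<rho> where "\<rho> = density (\<mu> \<Otimes>\<^sub>M m) (\<lambda>z. ennreal (w (fst z) (snd z)))"
  have sets_pair: "sets (\<mu> \<Otimes>\<^sub>M m) = sets borel"
    unfolding borel_prod[symmetric] by (rule sets_pair_measure_cong[OF \<mu>(2) m(2)])
  then have sets_\<rho>: "sets \<rho> = sets borel"
    by (simp add: \<rho>_def)
  have nn_\<rho>: "(\<integral>\<^sup>+z. f z \<partial>\<rho>) = (\<integral>\<^sup>+x. \<integral>\<^sup>+y. ennreal (w x y) * f (x, y) \<partial>m \<partial>\<mu>)"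
    if "f \<in> borel_measurable borel" for f :: "'a \<times> 'a \<Rightarrow> ennreal"
  proof -
    have [measurable]: "f \<in> borel_measurable (\<mu> \<Otimes>\<^sub>M m)"
      using that sets_pair by (simp cong: measurable_cong_sets)
    show ?thesis
      unfolding \<rho>_def by (subst nn_integral_density, measurable, subst m.nn_integral_fst[symmetric]) auto
  qed
  have nn_\<rho>': "(\<integral>\<^sup>+z. f z \<partial>\<rho>) = (\<integral>\<^sup>+y. \<integral>\<^sup>+x. ennreal (w x y) * f (x, y) \<partial>\<mu> \<partial>m)"
    if "f \<in> borel_measurable borel" for f :: "'a \<times> 'a \<Rightarrow> ennreal"
  proof -
    have [measurable]: "f \<in> borel_measurable (\<mu> \<Otimes>\<^sub>M m)"
      using that sets_pair by (simp cong: measurable_cong_sets)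
    show ?thesis
      unfolding \<rho>_def by (subst nn_integral_density, measurable, subst P.nn_integral_snd[symmetric])
        (auto simp: split_beta)
  qed
  note proj = borel_measurable_projections[OF sets_\<rho>]
    and proj_b = borel_measurable_projections[OF refl, where 'a='a and 'b='a]
  have w_meas1: "(\<lambda>y. ennreal (w x y)) \<in> borel_measurable m" for x
    unfolding w_eq by measurable
  have w_meas2: "(\<lambda>x. ennreal (w x y)) \<in> borel_measurable \<mu>" for y
    unfolding w_eq by measurable
  have fst_\<rho>: "distr \<rho> borel fst = \<mu>"
  proof (rule measure_eqI)
    fix B assume "B \<in> sets (distr \<rho> borel fst)"
    then have B [measurable]: "B \<in> sets borel" by simp
    have "emeasure (distr \<rho> borel fst) B = (\<integral>\<^sup>+x. indicator B x \<partial>distr \<rho> borel fst)"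
      by simp
    also have "\<dots> = (\<integral>\<^sup>+z. indicator B (fst z) \<partial>\<rho>)"
      by (intro nn_integral_distr proj) auto
    also have "\<dots> = (\<integral>\<^sup>+x. \<integral>\<^sup>+y. ennreal (w x y) * indicator B x \<partial>m \<partial>\<mu>)"
      using proj_b(1) by (subst nn_\<rho>) auto
    also have "\<dots> = (\<integral>\<^sup>+x. indicator B x \<partial>\<mu>)"
      using w_1 w_meas1 by (intro nn_integral_cong_AE) (auto simp: nn_integral_multc)
    finally show "emeasure (distr \<rho> borel fst) B = emeasure \<mu> B"
      using \<mu>(2) by simp
  qed (simp add: \<mu>)
  have snd_\<rho>: "distr \<rho> borel snd = m"
  proof (rule measure_eqI)
    fix B assume "B \<in> sets (distr \<rho> borel snd)"
    then have B [measurable]: "B \<in> sets borel" by simp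
    have "emeasure (distr \<rho> borel snd) B = (\<integral>\<^sup>+x. indicator B x \<partial>distr \<rho> borel snd)"
      by simp
    also have "\<dots> = (\<integral>\<^sup>+z. indicator B (snd z) \<partial>\<rho>)"
      by (intro nn_integral_distr proj) auto
    also have "\<dots> = (\<integral>\<^sup>+y. \<integral>\<^sup>+x. ennreal (w x y) * indicator B y \<partial>\<mu> \<partial>m)"
      using proj_b(2) by (subst nn_\<rho>') auto
    also have "\<dots> = (\<integral>\<^sup>+x. indicator B x \<partial>m)"
      using w_2 w_meas2 by (intro nn_integral_cong_AE) (auto simp: nn_integral_multc)
    finally show "emeasure (distr \<rho> borel snd) B = emeasure m B"
      using m(2) by simp
  qed (simp add: m)
  have prob_\<rho>: "prob_space \<rho>"
    using prob_space_distrD[OF proj(1)] \<mu>(1) fst_\<rho> by simp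
  have uv: "u k \<le> 1" "v k \<le> 1" "0 \<le> u k" "0 \<le> v k" for k
    unfolding u_def v_def p_def by (auto simp: divide_le_eq min_def not_less)
  have pu: "u k * measure \<mu> (A k) = p k" "v k * measure m (A k) = p k" for k
    using measure_nonneg[of \<mu> "A k"] measure_nonneg[of m "A k"]
    by (auto simp: u_def v_def p_def min_def measure_le_0_iff)
  have gap': "(1 - u k) * measure \<mu> (A k) \<le> \<kappa>" "(1 - v k) * measure m (A k) \<le> \<kappa>" if "k < n" for k
    using gap[OF that] pu[of k] pos(4) by (auto simp: left_diff_distrib p_def min_def split: if_splits)
  have q_u: "(LINT x|\<mu>. a x) = q" and q_v: "(LINT y|m. b' y) = q"
    unfolding a_def b'_def using cell_rest_integral[OF \<mu>(1) A\<mu>] cell_rest_integral[OF m(1) Am] by (simp_all add: pu q_def)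
  have rest: "0 \<le> a x" "0 \<le> b' x" "a x \<le> 1" "b' x \<le> 1" for x
    unfolding a_def b'_def using uv by (auto intro!: cell_rest_nonneg[OF A(2)] cell_rest_le_1)
  have q0: "0 \<le> q"
    using q_u rest Bochner_Integration.integral_nonneg[of \<mu> a] by simp
  have nn_a: "(\<integral>\<^sup>+x. ennreal (a x) \<partial>\<mu>) = ennreal q" and nn_b: "(\<integral>\<^sup>+x. ennreal (b' x) \<partial>m) = ennreal q"
    using rest q_u q_v
    by (subst nn_integral_eq_integral;
        auto intro!: M.integrable_const_bound[where B=1] m.integrable_const_bound[where B=1])+
  define Ga where "Ga = (LINT x|\<mu>. g x * a x)"
  define Gb where "Gb = (LINT x|m. g x * b' x)"
  have Ga: "(\<integral>\<^sup>+x. ennreal (g x * a x) \<partial>\<mu>) = ennreal Ga" "0 \<le> Ga"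
      "Ga \<le> n * \<kappa> * b + (LINT x|\<mu>. g x * indicator T x)"
    unfolding Ga_def a_def T_def using g rest[unfolded a_def] uv gap' pos
      cell_rest_weighted_integral[OF \<mu>(1) A\<mu> A(2), of n u g b \<kappa>]
    by (auto intro!: nn_integral_eq_integral)
  have Gb: "(\<integral>\<^sup>+x. ennreal (g x * b' x) \<partial>m) = ennreal Gb" "0 \<le> Gb"
      "Gb \<le> n * \<kappa> * b + (LINT x|m. g x * indicator T x)"
    unfolding Gb_def b'_def T_def using g rest[unfolded b'_def] uv gap' pos
      cell_rest_weighted_integral[OF m(1) Am A(2), of n v g b \<kappa>]
    by (auto intro!: nn_integral_eq_integral)
  have cost: "w x y * c (x, y) \<le> \<tau> * w x y + C * (g x * a x * (b' y / q)) + C * (g y * b' y * (a x / q))"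
    for x y
  proof -
    define s where "s = (\<Sum>k<n. r k * indicator (A k) x * indicator (A k) y)"
    have r0: "0 \<le> r k" for k by (simp add: r_def p_def)
    have "s * c (x, y) \<le> \<tau> * s"
      unfolding s_def sum_distrib_right sum_distrib_left
    proof (rule sum_mono)
      fix k assume "k \<in> {..<n}"
      then show "r k * indicator (A k) x * indicator (A k) y * c (x, y)
          \<le> \<tau> * (r k * indicator (A k) x * indicator (A k) y)"
        using c(3)[of k x y] r0[of k] by (auto simp: indicator_def mult.commute[of \<tau>] intro!: mult_left_mono)
    qed
    moreover have "(a x * b' y / q) * c (x, y) \<le> (a x * b' y / q) * (C * (g x + g y))"
      using rest q0 c(2) by (intro mult_left_mono) auto
    moreover have "0 \<le> \<tau> * (a x * b' y / q)"
      using rest q0 pos by auto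
    ultimately show ?thesis
      unfolding w_eq s_def[symmetric] by (simp add: algebra_simps)
  qed
  have "(\<integral>\<^sup>+z. ennreal (c z) \<partial>\<rho>) = (\<integral>\<^sup>+x. \<integral>\<^sup>+y. ennreal (w x y * c (x, y)) \<partial>m \<partial>\<mu>)"
    by (subst nn_\<rho>) (auto simp: ennreal_mult' w_nonneg)
  also have "\<dots> \<le> (\<integral>\<^sup>+x. \<integral>\<^sup>+y. ennreal \<tau> * ennreal (w x y) + ennreal (C * (g x * a x)) * ennreal (b' y / q)
      + ennreal (C / q * a x) * ennreal (g y * b' y) \<partial>m \<partial>\<mu>)"
  proof (intro nn_integral_mono)
    fix x y
    have "ennreal (w x y * c (x, y))
        \<le> ennreal (\<tau> * w x y + (C * (g x * a x)) * (b' y / q) + (C / q * a x) * (g y * b' y))"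
      using cost[of x y] by (intro ennreal_leI) (simp add: ac_simps)
    also have "\<dots> = ennreal \<tau> * ennreal (w x y) + ennreal (C * (g x * a x)) * ennreal (b' y / q)
      + ennreal (C / q * a x) * ennreal (g y * b' y)"
      using w_nonneg rest q0 g(3) pos by (simp add: ennreal_mult[symmetric] ennreal_plus[symmetric] del: ennreal_plus)
    finally show "ennreal (w x y * c (x, y)) \<le> \<dots>" .
  qed
  \<comment> \<open>The quotient \<open>q / q\<close> is kept rather than replaced by 1, so that the
    computation also holds for q = 0, where it is 0.\<close>
  also have "\<dots> = (\<integral>\<^sup>+x. ennreal \<tau> * (\<integral>\<^sup>+y. ennreal (w x y) \<partial>m) + ennreal (C * (g x * a x)) * ennreal (q / q)
      + ennreal (C / q * a x) * ennreal Gb \<partial>\<mu>)"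
  proof (rule nn_integral_cong)
    fix x
    have "(\<integral>\<^sup>+y. ennreal (b' y / q) \<partial>m) = ennreal (q / q)"
    proof -
      have "(\<integral>\<^sup>+y. ennreal (b' y / q) \<partial>m) = (\<integral>\<^sup>+y. ennreal (1 / q) * ennreal (b' y) \<partial>m)"
        using q0 rest by (intro nn_integral_cong) (simp add: ennreal_mult[symmetric])
      also have "\<dots> = ennreal (1 / q) * ennreal q"
        by (subst nn_integral_cmult) (auto simp: nn_b)
      finally show ?thesis using q0 by (simp add: ennreal_mult[symmetric])
    qed
    then show "(\<integral>\<^sup>+y. ennreal \<tau> * ennreal (w x y) + ennreal (C * (g x * a x)) * ennreal (b' y / q)
      + ennreal (C / q * a x) * ennreal (g y * b' y) \<partial>m)
      = ennreal \<tau> * (\<integral>\<^sup>+y. ennreal (w x y) \<partial>m) + ennreal (C * (g x * a x)) * ennreal (q / q)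
      + ennreal (C / q * a x) * ennreal Gb"
      using w_meas1[of x] by (simp add: nn_integral_add nn_integral_cmult Gb)
  qed
  also have "\<dots> = (\<integral>\<^sup>+x. ennreal \<tau> + ennreal (C * (q / q)) * ennreal (g x * a x)
      + ennreal (C / q * Gb) * ennreal (a x) \<partial>\<mu>)"
    using w_1 rest q0 g(3) pos Gb(2)
    by (intro nn_integral_cong_AE) (auto simp: ennreal_mult[symmetric] ac_simps)
  also have "\<dots> = ennreal \<tau> + ennreal (C * (q / q)) * ennreal Ga + ennreal (C / q * Gb) * ennreal q"
    by (simp add: nn_integral_add nn_integral_cmult Ga nn_a M.emeasure_space_1)
  also have "\<dots> = ennreal (\<tau> + C * (q / q) * Ga + C / q * Gb * q)"
    using pos q0 Ga(2) Gb(2) by (simp add: ennreal_plus ennreal_mult[symmetric])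
  also have "\<dots> \<le> ennreal (\<tau> + C * (2 * n * \<kappa> * b
       + (LINT x|\<mu>. g x * indicator T x) + (LINT x|m. g x * indicator T x)))"
  proof (rule ennreal_leI)
    have "C * (q / q) * Ga + C / q * Gb * q \<le> C * (Ga + Gb)"
      using pos q0 Ga(2) Gb(2) by (cases "q = 0") (auto simp: distrib_left)
    also have "\<dots> \<le> C * (2 * n * \<kappa> * b + (LINT x|\<mu>. g x * indicator T x) + (LINT x|m. g x * indicator T x))"
      using Ga(3) Gb(3) pos by (intro mult_left_mono) auto
    finally show "\<tau> + C * (q / q) * Ga + C / q * Gb * q
        \<le> \<tau> + C * (2 * n * \<kappa> * b + (LINT x|\<mu>. g x * indicator T x) + (LINT x|m. g x * indicator T x))"
      by simp
  qed
  finally show thesis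
    using that[OF sets_\<rho> prob_\<rho> fst_\<rho> snd_\<rho>] by (simp add: T_def)
qed

subsection \<open>Neighbourhoods of a fixed measure\<close>

lemma small_cells_exist:
  assumes "0 < d"
  obtains B :: "nat \<Rightarrow> 'a::euclidean_space set"
  where "\<And>k. B k \<in> sets borel" "(\<Union>k. B k) = UNIV"
    "\<And>k x y. x \<in> B k \<Longrightarrow> y \<in> B k \<Longrightarrow> norm (x - y) \<le> d" "\<And>k. bounded (B k)"
proof -
  obtain S :: "'a set" where S: "countable S" "\<And>X. open X \<Longrightarrow> X \<noteq> {} \<Longrightarrow> \<exists>s\<in>S. s \<in> X"
    using countable_dense_setE by blast
  have "S \<noteq> {}" using S(2)[of UNIV] by auto
  define B where "B k = ball (from_nat_into S k) (d / 2)" for k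
  show thesis
  proof (rule that[of B])
    show "(\<Union>k. B k) = UNIV"
    proof (rule UNIV_eq_I[symmetric])
      fix x :: 'a
      obtain s where "s \<in> S" "s \<in> ball x (d / 2)"
        using S(2)[of "ball x (d / 2)"] assms by auto
      moreover from this obtain k where "s = from_nat_into S k"
        using S(1) by (metis from_nat_into_surj)
      ultimately show "x \<in> (\<Union>k. B k)"
        by (auto simp: B_def dist_commute)
    qed
    show "norm (x - y) \<le> d" if "x \<in> B k" "y \<in> B k" for k x y
      using that dist_triangle2[of x y "from_nat_into S k"]
      by (simp add: B_def dist_norm norm_minus_commute)
  qed (simp_all add: B_def)
qed

text \<open>A common interface for the three cases of \<open>D\<close>: a cost c that is small
  within each of countably many bounded cells carrying \<open>m0\<close>, and whose integral under a
  coupling controls \<open>D\<close>. The cells are points of the support set when \<open>m0\<close>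
  is discrete, where c vanishes on each cell, and pieces of small diameter otherwise. The factor 4
  leaves one \<tau> for matched mass and three for the rest.\<close>

lemma D_le_transport_cost:
  fixes m0 :: "'a::euclidean_space measure"
  assumes l: "0 \<le> l" and m0: "m0 \<in> prob_moment l" and "0 < \<delta>"
  obtains c :: "'a \<times> 'a \<Rightarrow> real" and C \<tau> :: real and B :: "nat \<Rightarrow> 'a set"
  where "0 < \<tau>" "0 \<le> C" "c \<in> borel_measurable borel"
    "\<And>x y. c (x, y) \<le> C * ((1 + norm_pow x l) + (1 + norm_pow y l))"
    "\<And>k. B k \<in> sets borel" "AE x in m0. x \<in> (\<Union>k. B k)" "\<And>k. bounded (B k)"
    "\<And>k x y. x \<in> B k \<Longrightarrow> y \<in> B k \<Longrightarrow> c (x, y) \<le> \<tau>"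
    "\<And>\<mu> \<rho>. \<mu> \<in> prob_moment l \<Longrightarrow> sets \<rho> = sets borel \<Longrightarrow> prob_space \<rho> \<Longrightarrow>
       distr \<rho> borel fst = \<mu> \<Longrightarrow> distr \<rho> borel snd = m0 \<Longrightarrow>
       (\<integral>\<^sup>+z. ennreal (c z) \<partial>\<rho>) \<le> ennreal (4 * \<tau>) \<Longrightarrow> D l m0 \<mu> m0 < \<delta>"
proof -
  note proj [measurable] = borel_measurable_projections[OF refl, where 'a='a and 'b='a]
  consider (discrete) "discrete_measure m0" | (W) "\<not> discrete_measure m0" "l > 0"
    | (W_under) "\<not> discrete_measure m0" "l = 0"
    using l by fastforce
  then show thesis
  proof cases
    case discrete
    then obtain S where S: "countable S" "AE x in m0. x \<in> S"
      by (auto simp: discrete_measure_def)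
    \<comment> \<open>Inserting 0 makes the countable set nonempty, as its enumeration by
      \<open>from_nat_into\<close> requires; one more cell does no harm.\<close>
    define B where "B k = {from_nat_into (insert 0 S) k}" for k
    have UB: "(\<Union>k. B k) = insert 0 S"
    proof -
      have "(\<Union>k. B k) = range (from_nat_into (insert 0 S))" by (auto simp: B_def)
      then show ?thesis using S(1) range_from_nat_into[of "insert 0 S"] by simp
    qed
    define c where "c z = indicator {z. fst z \<noteq> snd z} z * ((1 + norm_pow (fst z) l) + (1 + norm_pow (snd z) l))"
      for z :: "'a \<times> 'a"
    show thesis
    \<comment> \<open>Four times this \<tau> is \<delta> / 2, which leaves room for the strict
      inequality.\<close>
    proof (rule that[of "\<delta> / 8" 1 c B])
      show "c \<in> borel_measurable borel" unfolding c_def[abs_def] by measurable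
      show "c (x, y) \<le> 1 * ((1 + norm_pow x l) + (1 + norm_pow y l))" for x y
        using norm_pow_nonneg[of x l] norm_pow_nonneg[of y l] by (auto simp: c_def indicator_def)
      show "AE x in m0. x \<in> (\<Union>k. B k)" unfolding UB using S(2) by auto
      show "c (x, y) \<le> \<delta> / 8" if "x \<in> B k" "y \<in> B k" for k x y
        using that \<open>0 < \<delta>\<close> by (auto simp: B_def c_def)
      fix \<mu> \<rho> assume \<rho>: "sets \<rho> = sets borel" "prob_space \<rho>"
        "distr \<rho> borel fst = \<mu>" "distr \<rho> borel snd = m0" "(\<integral>\<^sup>+z. ennreal (c z) \<partial>\<rho>) \<le> ennreal (4 * (\<delta> / 8))"
      have "(\<integral>\<^sup>+z. indicator {z. fst z \<noteq> snd z} z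
          * ennreal ((1 + norm_pow (fst z) l) + (1 + norm_pow (snd z) l)) \<partial>\<rho>) = (\<integral>\<^sup>+z. ennreal (c z) \<partial>\<rho>)"
        by (intro nn_integral_cong) (auto simp: c_def indicator_def)
      also have "\<dots> \<le> ennreal (\<delta> / 2)"
        using \<rho>(5) by simp
      finally have "(LINT y|tv_measure \<mu> m0. 1 + norm_pow y l) \<le> \<delta> / 2"
        using \<open>0 < \<delta>\<close> by (intro tv_integral_le_coupling[OF \<rho>(1-4)]) auto
      then show "D l m0 \<mu> m0 < \<delta>"
        using discrete \<open>0 < \<delta>\<close> by (simp add: D_def)
    qed (use \<open>0 < \<delta>\<close> in \<open>auto simp: B_def\<close>)
  next
    case W
    \<comment> \<open>Chosen so that \<open>(4 * \<tau>) powr (1 / max l 1)\<close> is exactly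
      \<delta> / 2.\<close>
    define \<tau> where "\<tau> = (\<delta> / 2) powr (max l 1) / 4"
    have "0 < \<tau>" using \<open>0 < \<delta>\<close> by (simp add: \<tau>_def)
    then have "0 < \<tau> powr (1 / l)" by simp
    from small_cells_exist[OF this]
    obtain B :: "nat \<Rightarrow> 'a set" where B: "\<And>k. B k \<in> sets borel" "(\<Union>k. B k) = UNIV"
      "\<And>k x y. x \<in> B k \<Longrightarrow> y \<in> B k \<Longrightarrow> norm (x - y) \<le> \<tau> powr (1 / l)" "\<And>k. bounded (B k)"
      by metis
    define c where "c z = norm_pow (fst z - snd z) l" for z :: "'a \<times> 'a"
    have c_meas: "c \<in> borel_measurable borel" unfolding c_def[abs_def] by measurable
    show thesis
    proof (rule that[of \<tau> "2 powr l" c B])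
      show "c (x, y) \<le> 2 powr l * ((1 + norm_pow x l) + (1 + norm_pow y l))" for x y
      proof -
        have "c (x, y) \<le> 2 powr l * (norm_pow x l + norm_pow y l)"
          unfolding c_def by (intro norm_pow_triangle l) (simp add: norm_triangle_ineq4)
        also have "\<dots> \<le> 2 powr l * ((1 + norm_pow x l) + (1 + norm_pow y l))"
          by (intro mult_left_mono) auto
        finally show ?thesis .
      qed
      show "c (x, y) \<le> \<tau>" if "x \<in> B k" "y \<in> B k" for k x y
      proof -
        have "norm (x - y) powr l \<le> (\<tau> powr (1 / l)) powr l"
          using B(3)[OF that] l by (intro powr_mono2) auto
        also have "\<dots> = \<tau>" using W \<open>0 < \<tau>\<close> by (simp add: powr_powr)
        finally show ?thesis using W by (simp add: c_def norm_pow_def)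
      qed
      fix \<mu> \<rho> assume \<mu>: "\<mu> \<in> prob_moment l" and \<rho>: "sets \<rho> = sets borel" "prob_space \<rho>"
        "distr \<rho> borel fst = \<mu>" "distr \<rho> borel snd = m0" "(\<integral>\<^sup>+z. ennreal (c z) \<partial>\<rho>) \<le> ennreal (4 * \<tau>)"
      have "(LINT z|\<rho>. c z) \<le> 4 * \<tau>"
        using \<rho>(5) \<open>0 < \<tau>\<close> by (intro integral_real_bounded) auto
      then have "(LINT z|\<rho>. c z) powr (1 / max l 1) \<le> (4 * \<tau>) powr (1 / max l 1)"
        by (intro powr_mono2) (auto simp: c_def)
      also have "\<dots> = \<delta> / 2"
      proof -
        have "max l 1 \<noteq> 0" by linarith
        then show ?thesis using \<open>0 < \<delta>\<close> by (simp add: \<tau>_def powr_powr)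
      qed
      finally have "W l \<mu> m0 \<le> \<delta> / 2"
        using W_le_coupling[OF couplingsI[OF l \<rho>(1-4) \<mu> m0]] by (simp add: c_def)
      then show "D l m0 \<mu> m0 < \<delta>"
        using W \<open>0 < \<delta>\<close> by (simp add: D_def)
    qed (use \<open>0 < \<tau>\<close> B c_meas in auto)
  next
    case W_under
    define \<tau> where "\<tau> = \<delta> / 8"
    have "0 < \<tau>" using \<open>0 < \<delta>\<close> by (simp add: \<tau>_def)
    from small_cells_exist[OF this]
    obtain B :: "nat \<Rightarrow> 'a set" where B: "\<And>k. B k \<in> sets borel" "(\<Union>k. B k) = UNIV"
      "\<And>k x y. x \<in> B k \<Longrightarrow> y \<in> B k \<Longrightarrow> norm (x - y) \<le> \<tau>" "\<And>k. bounded (B k)"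
      by metis
    define c where "c z = min (norm (fst z - snd z)) 1" for z :: "'a \<times> 'a"
    have c_meas: "c \<in> borel_measurable borel" unfolding c_def[abs_def] by measurable
    show thesis
    proof (rule that[of \<tau> 1 c B])
      show "c (x, y) \<le> 1 * ((1 + norm_pow x l) + (1 + norm_pow y l))" for x y
        using norm_pow_nonneg[of x l] norm_pow_nonneg[of y l] by (simp add: c_def min.coboundedI2)
      show "c (x, y) \<le> \<tau>" if "x \<in> B k" "y \<in> B k" for k x y
        using B(3)[OF that] by (simp add: c_def)
      fix \<mu> \<rho> assume \<mu>: "\<mu> \<in> prob_moment l" and \<rho>: "sets \<rho> = sets borel" "prob_space \<rho>"
        "distr \<rho> borel fst = \<mu>" "distr \<rho> borel snd = m0" "(\<integral>\<^sup>+z. ennreal (c z) \<partial>\<rho>) \<le> ennreal (4 * \<tau>)"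
      have "(LINT z|\<rho>. c z) \<le> 4 * \<tau>"
        using \<rho>(5) \<open>0 < \<tau>\<close> by (intro integral_real_bounded) auto
      then have "W_under \<mu> m0 \<le> \<delta> / 2"
        using W_under_le_coupling[OF couplingsI[OF _ \<rho>(1-4) prob_moment_0[OF \<mu>] prob_moment_0[OF m0]]]
        by (simp add: c_def \<tau>_def)
      then show "D l m0 \<mu> m0 < \<delta>"
        using W_under \<open>0 < \<delta>\<close> by (simp add: D_def)
    qed (use \<open>0 < \<tau>\<close> B c_meas in auto)
  qed
qed

lemma bounded_norm_pow_le:
  fixes S :: "'a::real_normed_vector set"
  assumes "bounded S" "0 \<le> l"
  obtains b where "0 \<le> b" "\<And>x. x \<in> S \<Longrightarrow> 1 + norm_pow x l \<le> b"
proof -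
  obtain R where R: "\<And>x. x \<in> S \<Longrightarrow> norm x \<le> R"
    using assms(1) by (auto simp: bounded_iff)
  show thesis
  proof (rule that[of "2 + \<bar>R\<bar> powr l"])
    show "1 + norm_pow x l \<le> 2 + \<bar>R\<bar> powr l" if "x \<in> S" for x
    proof (cases "l = 0")
      case False
      have "norm x powr l \<le> \<bar>R\<bar> powr l"
        using R[OF that] assms(2) by (intro powr_mono2) auto
      then show ?thesis using False by (simp add: norm_pow_def)
    qed (simp add: norm_pow_def)
  qed simp
qed

text \<open>\<open>\<theta>\<close> is fixed before the bound \<open>\<eta>\<close> on the moments of \<open>m0\<close> outside the cells: with \<open>\<eta>\<close> much
  smaller than \<open>\<theta>\<close>, Markov's inequality makes a violation by the empirical measure unlikely.\<close>

lemma D_neighbourhood: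
  fixes m0 :: "'a::euclidean_space measure"
  assumes l: "0 \<le> l" and m0: "m0 \<in> prob_moment l" and "0 < \<delta>"
  obtains \<theta> where "0 < \<theta>" "\<And>\<eta>. 0 < \<eta> \<Longrightarrow> \<exists>(A :: nat \<Rightarrow> 'a set) n \<kappa>. 0 < \<kappa> \<and> (\<forall>k. A k \<in> sets borel) \<and>
     (LINT x|m0. (1 + norm_pow x l) * indicator (- (\<Union>k<n. A k)) x) < \<eta> \<and>
     (\<forall>\<mu>\<in>prob_moment l. (\<forall>k<n. \<bar>measure \<mu> (A k) - measure m0 (A k)\<bar> \<le> \<kappa>) \<longrightarrow>
        (LINT x|\<mu>. (1 + norm_pow x l) * indicator (- (\<Union>k<n. A k)) x) \<le> \<theta> \<longrightarrow> D l m0 \<mu> m0 < \<delta>)"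
proof -
  define g :: "'a \<Rightarrow> real" where "g x = 1 + norm_pow x l" for x
  have g_nonneg: "0 \<le> g x" for x by (simp add: g_def)
  obtain c :: "'a \<times> 'a \<Rightarrow> real" and C \<tau> :: real and B :: "nat \<Rightarrow> 'a set"
    where \<tau>: "0 < \<tau>" and C: "0 \<le> C" and c: "c \<in> borel_measurable borel"
      "\<And>x y. c (x, y) \<le> C * (g x + g y)"
    and B: "\<And>k. B k \<in> sets borel" "AE x in m0. x \<in> (\<Union>k. B k)" "\<And>k. bounded (B k)"
      "\<And>k x y. x \<in> B k \<Longrightarrow> y \<in> B k \<Longrightarrow> c (x, y) \<le> \<tau>"
    and cD: "\<And>\<mu> \<rho>. \<mu> \<in> prob_moment l \<Longrightarrow> sets \<rho> = sets borel \<Longrightarrow> prob_space \<rho> \<Longrightarrow>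
       distr \<rho> borel fst = \<mu> \<Longrightarrow> distr \<rho> borel snd = m0 \<Longrightarrow>
       (\<integral>\<^sup>+z. ennreal (c z) \<partial>\<rho>) \<le> ennreal (4 * \<tau>) \<Longrightarrow> D l m0 \<mu> m0 < \<delta>"
    by (rule D_le_transport_cost[OF assms, folded g_def], rule that, assumption+)
  note [measurable_cong] = prob_momentD(1)[OF m0] and [measurable] = B(1)
  define A where "A = disjointed B"
  have A: "A k \<in> sets borel" "disjoint_family A" "A k \<subseteq> B k" "(\<Union>k. A k) = (\<Union>k. B k)" for k
  proof -
    have "range A \<subseteq> sets borel"
      unfolding A_def using B(1) by (intro sets.range_disjointed_sets) auto
    then show "A k \<in> sets borel" by blast
    show "disjoint_family A" "A k \<subseteq> B k" "(\<Union>k. A k) = (\<Union>k. B k)"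
      unfolding A_def by (rule disjoint_family_disjointed disjointed_subset UN_disjointed_eq)+
  qed
  note [measurable] = A(1)
  \<comment> \<open>The denominator is C + 1 because C may be 0.\<close>
  define \<theta> where "\<theta> = \<tau> / (C + 1)"
  have \<theta>: "0 < \<theta>" "C * \<theta> \<le> \<tau>"
    using \<tau> C by (auto simp: \<theta>_def field_simps)
  have g_int: "integrable \<mu> g" if "\<mu> \<in> prob_moment l" for \<mu>
    using prob_moment_integrable_weight[OF that] by (simp add: g_def[abs_def])
  have tail: "(\<lambda>n. LINT x|m0. g x * indicator (- (\<Union>k<n. A k)) x) \<longlonglongrightarrow> (LINT x|m0. 0)"
  proof (rule integral_dominated_convergence[where w=g])
    show "(\<lambda>x. g x * indicator (- (\<Union>k<n. A k)) x) \<in> borel_measurable m0" for n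
      unfolding g_def by measurable
    show "AE x in m0. (\<lambda>n. g x * indicator (- (\<Union>k<n. A k)) x) \<longlonglongrightarrow> 0"
      using B(2)
    proof eventually_elim
      case (elim x)
      then obtain j where "x \<in> A j" unfolding A(4)[symmetric] by blast
      then have "\<forall>\<^sub>F n in sequentially. g x * indicator (- (\<Union>k<n. A k)) x = 0"
        by (intro eventually_sequentiallyI[of "Suc j"]) (auto simp: indicator_def)
      then show ?case by (rule tendsto_eventually)
    qed
  qed (use g_int[OF m0] g_nonneg in \<open>auto simp: indicator_def intro!: AE_I2\<close>)
  show thesis
  proof (rule that[OF \<theta>(1)], goal_cases)
    case (1 \<eta>)
    \<comment> \<open>The minimum with \<theta> ensures that the tail of \<open>m0\<close> also fits
      into the cost budget below.\<close>
    define \<eta>' where "\<eta>' = min \<eta> \<theta>"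
    have "0 < \<eta>'" using 1 \<theta> by (simp add: \<eta>'_def)
    then obtain n where n: "(LINT x|m0. g x * indicator (- (\<Union>k<n. A k)) x) < \<eta>'"
      using order_tendstoD(2)[OF tail, of \<eta>'] by (auto simp: eventually_sequentially)
    obtain b where b: "0 \<le> b" "\<And>k x. k < n \<Longrightarrow> x \<in> A k \<Longrightarrow> g x \<le> b"
    proof -
      have "bounded (\<Union>k<n. B k)" using B(3) by auto
      from bounded_norm_pow_le[OF this l] obtain b where "0 \<le> b" "\<And>x. x \<in> (\<Union>k<n. B k) \<Longrightarrow> g x \<le> b"
        unfolding g_def by metis
      then show thesis using A(3) by (intro that[of b]) blast+
    qed
    define \<kappa> where "\<kappa> = \<theta> / (2 * n * b + 1)"
    have X: "0 \<le> 2 * n * b" using b(1) by simp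
    have \<kappa>: "0 < \<kappa>" "2 * n * \<kappa> * b \<le> \<theta>"
    proof -
      show "0 < \<kappa>"
        unfolding \<kappa>_def using \<theta>(1) X by (intro divide_pos_pos) linarith+
      have "2 * n * \<kappa> * b = \<theta> * (2 * n * b / (2 * n * b + 1))"
        by (simp add: \<kappa>_def)
      also have "\<dots> \<le> \<theta>"
      proof -
        have "t / (t + 1) \<le> 1" if "0 \<le> t" for t :: real using that by simp
        from this[OF X] \<theta>(1) show ?thesis by (intro mult_left_le) simp_all
      qed
      finally show "2 * n * \<kappa> * b \<le> \<theta>" .
    qed
    have cA: "c (x, y) \<le> \<tau>" if "x \<in> A k" "y \<in> A k" for x y k
      using B(4) A(3) that by blast
    have "D l m0 \<mu> m0 < \<delta>"
      if \<mu>: "\<mu> \<in> prob_moment l" and gap: "\<And>k. k < n \<Longrightarrow> \<bar>measure \<mu> (A k) - measure m0 (A k)\<bar> \<le> \<kappa>"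
        and tail_\<mu>: "(LINT x|\<mu>. g x * indicator (- (\<Union>k<n. A k)) x) \<le> \<theta>" for \<mu>
    proof -
      obtain \<rho> where \<rho>: "sets \<rho> = sets borel" "prob_space \<rho>" "distr \<rho> borel fst = \<mu>" "distr \<rho> borel snd = m0"
        "(\<integral>\<^sup>+z. ennreal (c z) \<partial>\<rho>) \<le> ennreal (\<tau> + C * (2 * n * \<kappa> * b
           + (LINT x|\<mu>. g x * indicator (- (\<Union>k<n. A k)) x) + (LINT x|m0. g x * indicator (- (\<Union>k<n. A k)) x)))"
        by (rule exists_cell_coupling[where \<mu>=\<mu> and m=m0 and A=A and g=g and n=n and b=b and c=c
              and C=C and \<tau>=\<tau> and \<kappa>=\<kappa>])
          (use prob_momentD[OF \<mu>] prob_momentD[OF m0] A g_int \<mu> m0 g_nonneg b c gap C \<tau> \<kappa> in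
            \<open>auto intro: cA\<close>)
      \<comment> \<open>Three contributions of at most \<theta> each: mass left unmatched inside the
        cells, the tail of \<mu> and the tail of \<open>m0\<close>.\<close>
      have "C * (2 * n * \<kappa> * b + (LINT x|\<mu>. g x * indicator (- (\<Union>k<n. A k)) x)
          + (LINT x|m0. g x * indicator (- (\<Union>k<n. A k)) x)) \<le> C * (3 * \<theta>)"
        using \<kappa>(2) tail_\<mu> n C by (intro mult_left_mono) (auto simp: \<eta>'_def)
      also have "\<dots> \<le> 3 * \<tau>" using \<theta>(2) by simp
      finally have "(\<integral>\<^sup>+z. ennreal (c z) \<partial>\<rho>) \<le> ennreal (4 * \<tau>)"
        using \<rho>(5) by (intro order_trans[OF \<rho>(5)] ennreal_leI) simp
      then show ?thesis
        by (rule cD[OF \<mu> \<rho>(1-4)])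
    qed
    then show ?case
      using \<kappa>(1) A(1) n unfolding g_def \<eta>'_def
      by (intro exI[of _ A] exI[of _ n] exI[of _ \<kappa>]) auto
  qed
qed

text \<open>The measure \<open>m0\<close> meets the conditions that \<open>D_neighbourhood\<close>
  places on \<mu>: its frequencies agree with themselves, and its tail can be kept below
  \<theta>.\<close>

lemma D_self:
  fixes m0 :: "'a::euclidean_space measure"
  assumes "0 \<le> l" "m0 \<in> prob_moment l" "0 < \<delta>"
  shows "D l m0 m0 m0 < \<delta>"
proof -
  obtain \<theta> where \<theta>: "0 < \<theta>" "\<And>\<eta>. 0 < \<eta> \<Longrightarrow> \<exists>(A :: nat \<Rightarrow> 'a set) n \<kappa>. 0 < \<kappa> \<and> (\<forall>k. A k \<in> sets borel) \<and>
     (LINT x|m0. (1 + norm_pow x l) * indicator (- (\<Union>k<n. A k)) x) < \<eta> \<and>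
     (\<forall>\<mu>\<in>prob_moment l. (\<forall>k<n. \<bar>measure \<mu> (A k) - measure m0 (A k)\<bar> \<le> \<kappa>) \<longrightarrow>
        (LINT x|\<mu>. (1 + norm_pow x l) * indicator (- (\<Union>k<n. A k)) x) \<le> \<theta> \<longrightarrow> D l m0 \<mu> m0 < \<delta>)"
    by (rule D_neighbourhood[OF assms]) blast
  from \<theta>(2)[OF \<theta>(1)] show ?thesis
    using assms(2) by fastforce
qed

subsection \<open>Iterated integrals and the mean value theorem along mixtures\<close>

text \<open>For non-measurable \<open>h k\<close> the inner integral is a lower integral, so this supermartingale
  argument needs no measurability at the intermediate stages.\<close>

lemma iterated_nn_integral_le:
  fixes h :: "nat \<Rightarrow> (nat \<Rightarrow> 'a) \<Rightarrow> ennreal"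
  assumes "sigma_finite_measure m"
    and f: "f \<in> borel_measurable (Pi\<^sub>M {..<N} (\<lambda>_. m))" "\<And>x. f x \<le> h N x"
    and step: "\<And>k x. k < N \<Longrightarrow> (\<integral>\<^sup>+y. h (Suc k) (x(k := y)) \<partial>m) \<le> h k x"
  shows "(\<integral>\<^sup>+x. f x \<partial>Pi\<^sub>M {..<N} (\<lambda>_. m)) \<le> h 0 (\<lambda>_. undefined)"
  using f step
proof (induction N arbitrary: f)
  interpret product_sigma_finite "\<lambda>_::nat. m"
    using assms(1) by (simp add: product_sigma_finite_def)
  {
    case 0
    then show ?case by (simp add: nn_integral_empty)
  next
    case (Suc N)
    have f_meas: "f \<in> borel_measurable (Pi\<^sub>M (insert N {..<N}) (\<lambda>_. m))"
      using Suc.prems(1) by (simp add: lessThan_Suc)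
    have "(\<integral>\<^sup>+x. f x \<partial>Pi\<^sub>M {..<Suc N} (\<lambda>_. m))
        = (\<integral>\<^sup>+x. (\<integral>\<^sup>+y. f (x(N := y)) \<partial>m) \<partial>Pi\<^sub>M {..<N} (\<lambda>_. m))"
      unfolding lessThan_Suc by (rule product_nn_integral_insert[OF _ _ f_meas]) auto
    \<comment> \<open>The induction hypothesis is applied to the partial integral of f, which is
      again measurable. The functions h are only ever integrated over one coordinate with the others
      fixed.\<close>
    also have "\<dots> \<le> h 0 (\<lambda>_. undefined)"
    proof (rule Suc.IH)
      interpret sigma_finite_measure m by fact
      have "(\<lambda>(x, y). f (x(N := y))) \<in> borel_measurable (Pi\<^sub>M {..<N} (\<lambda>_. m) \<Otimes>\<^sub>M m)"
        using measurable_comp[OF measurable_add_dim f_meas] by (simp add: comp_def case_prod_unfold)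
      then show "(\<lambda>x. \<integral>\<^sup>+y. f (x(N := y)) \<partial>m) \<in> borel_measurable (Pi\<^sub>M {..<N} (\<lambda>_. m))"
        by (rule borel_measurable_nn_integral)
      show "(\<integral>\<^sup>+y. f (x(N := y)) \<partial>m) \<le> h N x" for x
        by (rule order_trans[OF nn_integral_mono[OF Suc.prems(2)] Suc.prems(3)]) simp
      show "(\<integral>\<^sup>+y. h (Suc k) (x(k := y)) \<partial>m) \<le> h k x" if "k < N" for k x
        using that by (intro Suc.prems(3)) simp
    qed
    finally show ?case .
  }
qed

section \<open>Linear functional derivatives along a segment of measures\<close>

lemma has_lin_fun_deriv_integrable:
  assumes "has_lin_fun_deriv l U \<mu> \<phi>" "\<nu> \<in> prob_moment l"
  shows "integrable \<nu> \<phi>"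
proof -
  obtain C where C: "\<And>y. \<bar>\<phi> y\<bar> / (1 + norm_pow y l) \<le> C"
    using assms(1) by (auto simp: has_lin_fun_deriv_def bdd_above_def)
  have "\<bar>\<phi> y\<bar> \<le> C * (1 + norm_pow y l)" for y
  proof -
    have "0 < 1 + norm_pow y l" by (simp add: add_pos_nonneg)
    then show ?thesis using C[of y] by (simp add: divide_le_eq)
  qed
  then show ?thesis
    using assms by (intro prob_moment_integrable[of \<nu> l \<phi> C]) (auto simp: has_lin_fun_deriv_def)
qed

text \<open>The definition only provides right derivatives at 0. At an inner point of the segment,
  the derivatives towards its two ends give a right and a left derivative in the parameter; both
  equal the same linear expression, so the classical mean value theorem applies.\<close>

lemma lin_fun_deriv_mvt:
  assumes \<mu>: "\<mu> \<in> prob_moment l" and \<nu>: "\<nu> \<in> prob_moment l"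
    and deriv: "\<And>s. 0 \<le> s \<Longrightarrow> s \<le> 1 \<Longrightarrow> has_lin_fun_deriv l U (mixture s \<mu> \<nu>) (\<phi> s)"
  obtains s where "0 < s" "s < 1" "U \<nu> - U \<mu> = (LINT y|\<nu>. \<phi> s y) - (LINT y|\<mu>. \<phi> s y)"
proof -
  note sets = prob_momentD(1)[OF \<mu>] prob_momentD(1)[OF \<nu>]
  define u where "u s = U (mixture s \<mu> \<nu>)" for s
  define L where "L s = (LINT y|\<nu>. \<phi> s y) - (LINT y|\<mu>. \<phi> s y)" for s
  have \<phi>_meas: "\<phi> s \<in> borel_measurable borel" if "0 \<le> s" "s \<le> 1" for s
    using deriv[OF that] by (simp add: has_lin_fun_deriv_def)
  have mix: "(LINT y|mixture s \<mu> \<nu>. \<phi> s y) = (1 - s) * (LINT y|\<mu>. \<phi> s y) + s * (LINT y|\<nu>. \<phi> s y)"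
    if "0 \<le> s" "s \<le> 1" for s
    using that sets \<phi>_meas[OF that] has_lin_fun_deriv_integrable[OF deriv[OF that]] \<mu> \<nu>
    by (intro integral_mixture) auto
  \<comment> \<open>A move by e towards the target \<kappa> changes the parameter of the segment by
    e c, with c = 1 - s for the target \<nu> and c = -s for the target \<mu>. Linearity of the
    integral produces the same factor c in the derivative, and it cancels.\<close>
  have quotient: "((\<lambda>h. (u h - u s) / (h - s)) \<longlongrightarrow> L s) F"
    if s: "0 \<le> s" "s \<le> 1" and \<kappa>: "\<kappa> \<in> prob_moment l" and "c \<noteq> 0"
      and eq: "\<And>e. 0 \<le> e \<Longrightarrow> e \<le> 1 \<Longrightarrow> mixture e (mixture s \<mu> \<nu>) \<kappa> = mixture (s + e * c) \<mu> \<nu>"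
      and L: "(LINT y|\<kappa>. \<phi> s y) - (LINT y|mixture s \<mu> \<nu>. \<phi> s y) = c * L s"
      and F: "filterlim (\<lambda>h. (h - s) / c) (at_right 0) F"
    for s \<kappa> c F
  proof -
    have "((\<lambda>e. U (mixture e (mixture s \<mu> \<nu>) \<kappa>)) has_real_derivative c * L s) (at_right 0)"
      using deriv[OF s] \<kappa> unfolding has_lin_fun_deriv_def L[symmetric] by blast
    then have "((\<lambda>e. (U (mixture e (mixture s \<mu> \<nu>) \<kappa>) - U (mixture 0 (mixture s \<mu> \<nu>) \<kappa>)) / (e - 0))
        \<longlongrightarrow> c * L s) (at_right 0)"
      by (simp add: has_field_derivative_iff)
    moreover have "\<forall>\<^sub>F e in at_right 0. (U (mixture e (mixture s \<mu> \<nu>) \<kappa>) - U (mixture 0 (mixture s \<mu> \<nu>) \<kappa>)) / (e - 0)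
        = (u (s + e * c) - u s) / e"
      unfolding eventually_at_right_field by (intro exI[of _ 1]) (simp add: eq u_def)
    ultimately have "((\<lambda>e. (u (s + e * c) - u s) / e) \<longlongrightarrow> c * L s) (at_right 0)"
      by (rule Lim_transform_eventually)
    from filterlim_compose[OF this F]
    have "((\<lambda>h. (u h - u s) / ((h - s) / c) / c) \<longlongrightarrow> c * L s / c) F"
      using \<open>c \<noteq> 0\<close> by (intro tendsto_divide tendsto_const) auto
    then show ?thesis using \<open>c \<noteq> 0\<close> by simp
  qed
  have right: "((\<lambda>h. (u h - u s) / (h - s)) \<longlongrightarrow> L s) (at_right s)" if s: "0 \<le> s" "s < 1" for s
  proof (rule quotient[OF _ _ \<nu>, of _ "1 - s"])
    show "mixture e (mixture s \<mu> \<nu>) \<nu> = mixture (s + e * (1 - s)) \<mu> \<nu>" if "0 \<le> e" "e \<le> 1" for e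
      using s that sets by (intro mixture_mixture_right) auto
    show "(LINT y|\<nu>. \<phi> s y) - (LINT y|mixture s \<mu> \<nu>. \<phi> s y) = (1 - s) * L s"
      using s by (simp add: mix L_def algebra_simps)
    have "((\<lambda>h. (h - s) / (1 - s)) \<longlongrightarrow> (s - s) / (1 - s)) (at_right s)"
      using s by (intro tendsto_intros) auto
    moreover have "\<forall>\<^sub>F h in at_right s. (h - s) / (1 - s) \<in> {0<..} \<and> (h - s) / (1 - s) \<noteq> 0"
      using s unfolding eventually_at_right_field by (intro exI[of _ 1]) auto
    ultimately show "filterlim (\<lambda>h. (h - s) / (1 - s)) (at_right 0) (at_right s)"
      by (simp add: filterlim_at)
  qed (use s in auto)
  have left: "((\<lambda>h. (u h - u s) / (h - s)) \<longlongrightarrow> L s) (at_left s)" if s: "0 < s" "s \<le> 1" for s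
  proof (rule quotient[OF _ _ \<mu>, of _ "- s"])
    show "mixture e (mixture s \<mu> \<nu>) \<mu> = mixture (s + e * - s) \<mu> \<nu>" if "0 \<le> e" "e \<le> 1" for e
      using s that sets mixture_mixture_left[of s e \<mu> \<nu>] by simp
    show "(LINT y|\<mu>. \<phi> s y) - (LINT y|mixture s \<mu> \<nu>. \<phi> s y) = - s * L s"
      using s by (simp add: mix L_def algebra_simps)
    have "((\<lambda>h. (h - s) / - s) \<longlongrightarrow> (s - s) / - s) (at_left s)"
      using s by (intro tendsto_intros) auto
    moreover have "\<forall>\<^sub>F h in at_left s. (h - s) / - s \<in> {0<..} \<and> (h - s) / - s \<noteq> 0"
      using s unfolding eventually_at_left_field
      by (intro exI[of _ 0]) (auto simp: divide_less_0_iff zero_less_divide_iff)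
    ultimately show "filterlim (\<lambda>h. (h - s) / - s) (at_right 0) (at_left s)"
      by (simp add: filterlim_at)
  qed (use s in auto)
  have der: "(u has_real_derivative L s) (at s)" if "0 < s" "s < 1" for s
    unfolding has_field_derivative_iff
    using left[of s] right[of s] that by (intro filterlim_split_at) auto
  have cont: "continuous_on {0..1} u"
    unfolding continuous_on_eq_continuous_within
  proof
    fix s :: real assume "s \<in> {0..1}"
    then consider "s = 0" | "s = 1" | "0 < s" "s < 1" by fastforce
    then show "continuous (at s within {0..1}) u"
    proof cases
      case 1
      have "(u has_real_derivative L 0) (at_right 0)"
        using right[of 0] by (simp add: has_field_derivative_iff)
      from DERIV_continuous[OF this] show ?thesis
        using 1 by (simp add: at_within_Icc_at_right)
    next
      case 2
      have "(u has_real_derivative L 1) (at_left 1)"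
        using left[of 1] by (simp add: has_field_derivative_iff)
      from DERIV_continuous[OF this] show ?thesis
        using 2 by (simp add: at_within_Icc_at_left)
    next
      case 3
      from DERIV_continuous[OF der[OF this]] show ?thesis
        by (rule continuous_at_imp_continuous_at_within)
    qed
  qed
  have "(0::real) < 1" by simp
  from MVT[OF this cont] der
  obtain a s where s: "0 < s" "s < 1" "DERIV u s :> a" "u 1 - u 0 = (1 - 0) * a"
    by (auto simp: real_differentiable_def)
  then have "u 1 - u 0 = L s" using DERIV_unique[OF s(3) der[OF s(1,2)]] by simp
  then show thesis
    using that[OF s(1,2)] sets by (simp add: u_def L_def mixture_0 mixture_1)
qed

subsection \<open>Replacing samples one at a time\<close>

lemma distr_wsum:
  fixes f :: "'a::topological_space \<Rightarrow> 'b::topological_space"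
  assumes "\<And>i. i \<in> I \<Longrightarrow> sets (ms i) = sets borel" "f \<in> borel_measurable borel"
  shows "distr (wsum I w ms) borel f = wsum I w (\<lambda>i. distr (ms i) borel f)"
proof (rule measure_eqI)
  fix A :: "'b set" assume "A \<in> sets (distr (wsum I w ms) borel f)"
  then have A: "A \<in> sets borel" by simp
  have sp: "space (ms i) = UNIV" if "i \<in> I" for i
    using sets_eq_imp_space_eq[OF assms(1)[OF that]] by simp
  have f: "f \<in> borel_measurable (ms i)" if "i \<in> I" for i
    using assms(1)[OF that] assms(2) by (simp cong: measurable_cong_sets)
  have "f -` A \<in> sets borel"
    using measurable_sets[OF assms(2) A] by simp
  moreover have "f \<in> borel_measurable (wsum I w ms)"
    using assms(2) by (simp cong: measurable_cong_sets)
  ultimately show "emeasure (distr (wsum I w ms) borel f) A = emeasure (wsum I w (\<lambda>i. distr (ms i) borel f)) A"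
    using A assms(1) sp f by (simp add: emeasure_wsum emeasure_distr)
qed simp

lemma distr_mixture:
  fixes f :: "'a::euclidean_space \<Rightarrow> 'b::euclidean_space"
  assumes "sets \<mu> = sets borel" "sets \<nu> = sets borel" "f \<in> borel_measurable borel"
  shows "distr (mixture e \<mu> \<nu>) borel f = mixture e (distr \<mu> borel f) (distr \<nu> borel f)"
proof -
  have "(\<lambda>b. distr (if b then \<nu> else \<mu>) borel f) = (\<lambda>b. if b then distr \<nu> borel f else distr \<mu> borel f)"
    by auto
  then show ?thesis
    unfolding mixture_eq_wsum using assms by (subst distr_wsum) auto
qed

lemma mixture_self:
  assumes "0 \<le> e" "e \<le> 1" "sets \<mu> = sets borel"
  shows "mixture e \<mu> \<mu> = \<mu>"
proof (rule measure_eqI)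
  fix A assume "A \<in> sets (mixture e \<mu> \<mu>)"
  then show "emeasure (mixture e \<mu> \<mu>) A = emeasure \<mu> A"
    using assms by (simp add: emeasure_mixture flip: distrib_right ennreal_plus)
qed (simp add: assms)

lemma mixture_wsum:
  fixes ms :: "'i \<Rightarrow> 'a::euclidean_space measure"
  assumes "\<And>i. i \<in> I \<Longrightarrow> sets (ms i) = sets borel" "\<And>i. i \<in> I \<Longrightarrow> sets (ms' i) = sets borel"
  shows "mixture e (wsum I w ms) (wsum I w ms') = wsum I w (\<lambda>i. mixture e (ms i) (ms' i))"
proof (rule measure_eqI)
  fix A assume "A \<in> sets (mixture e (wsum I w ms) (wsum I w ms'))"
  then show "emeasure (mixture e (wsum I w ms) (wsum I w ms')) A
      = emeasure (wsum I w (\<lambda>i. mixture e (ms i) (ms' i))) A"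
    using assms by (simp add: emeasure_mixture emeasure_wsum sum_distrib_left sum.distrib distrib_left ac_simps)
qed simp

text \<open>This is \<open>\<mu>\<^sub>k\<close> of the overview, with samples counted from 0. Only
  coordinates below k are read, so the sample with index k is the one that enters when passing to
  \<open>Suc k\<close>.\<close>

definition mixed_emp :: "'a::euclidean_space measure \<Rightarrow> nat \<Rightarrow> nat \<Rightarrow> (nat \<Rightarrow> 'a) \<Rightarrow> 'a measure" where
  "mixed_emp m0 N k x = wsum {..<N} (\<lambda>_. 1 / N) (\<lambda>i. if i < k then return borel (x i) else m0)"

lemma emp_eq_mixed_emp:
  assumes "1 \<le> N"
  shows "emp N x = mixed_emp m0 N N x"
proof -
  have "(\<Sum>i<N. emeasure (return borel (x i)) A) / of_nat N
      = (\<Sum>i<N. ennreal (1 / real N) * emeasure (if i < N then return borel (x i) else m0) A)" for A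
  proof -
    have "ennreal (1 / real N) = inverse (of_nat N)"
      using assms by (simp add: inverse_ennreal ennreal_of_nat_eq_real_of_nat inverse_eq_divide)
    then show ?thesis
      by (simp add: divide_ennreal_def sum_distrib_left mult.commute)
  qed
  then show ?thesis
    unfolding emp_def mixed_emp_def wsum_def by simp
qed

text \<open>Points of a finite product space are \<open>undefined\<close> outside of the index set.
  This passes between them and the infinite sequence of samples.\<close>

lemma emp_restrict: "emp N (\<lambda>i\<in>{..<N}. x i) = emp N x"
  unfolding emp_def
  by (rule arg_cong[of _ _ "measure_of _ _"]) (auto intro!: ext arg_cong2[of _ _ _ _ "(/)"] sum.cong)

lemma mixed_emp_0:
  assumes "m0 \<in> prob_moment l" "1 \<le> N"
  shows "mixed_emp m0 N 0 x = m0"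
proof (rule measure_eqI)
  fix A assume "A \<in> sets (mixed_emp m0 N 0 x)"
  then have "emeasure (mixed_emp m0 N 0 x) A = of_nat N * (ennreal (1 / N) * emeasure m0 A)"
    using prob_momentD[OF assms(1)] by (simp add: mixed_emp_def emeasure_wsum)
  also have "\<dots> = emeasure m0 A"
    using assms(2) by (simp add: mult.assoc[symmetric] ennreal_of_nat_eq_real_of_nat ennreal_mult[symmetric])
  finally show "emeasure (mixed_emp m0 N 0 x) A = emeasure m0 A" .
qed (use prob_momentD[OF assms(1)] in \<open>simp add: mixed_emp_def\<close>)

lemma mixed_emp_upd: "j \<le> k \<Longrightarrow> mixed_emp m0 N j (x(k := y)) = mixed_emp m0 N j x"
  unfolding mixed_emp_def by (rule arg_cong[of _ _ "wsum _ _"]) auto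

lemma prob_moment_mixed_emp:
  assumes "m0 \<in> prob_moment l" "1 \<le> N"
  shows "mixed_emp m0 N k x \<in> prob_moment l"
  unfolding mixed_emp_def using assms by (intro prob_moment_wsum) (auto intro: prob_moment_return)

lemma sum_if_less:
  fixes a :: "nat \<Rightarrow> real"
  assumes "k \<le> N"
  shows "(\<Sum>i<N. if i < k then a i else b) = (\<Sum>i<k. a i) + (real N - real k) * b"
proof -
  have "{..<N} = {..<k} \<union> {k..<N}" using assms by auto
  then have "(\<Sum>i<N. if i < k then a i else b) = (\<Sum>i<k. a i) + (\<Sum>i\<in>{k..<N}. b)"
    by (simp add: sum.union_disjoint ivl_disj_int)
  then show ?thesis using assms by (simp add: of_nat_diff)
qed

lemma integral_mixed_emp:
  fixes f :: "'a::euclidean_space \<Rightarrow> real"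
  assumes "m0 \<in> prob_moment l" "k \<le> N" "f \<in> borel_measurable borel" "integrable m0 f"
  shows "(LINT y|mixed_emp m0 N k x. f y) = ((\<Sum>i<k. f (x i)) + (real N - real k) * (LINT y|m0. f y)) / N"
proof -
  have int_return: "integrable (return borel z) f" for z
    using assms(3) by (intro integrableI_bounded) (auto simp: nn_integral_return)
  have "(LINT y|mixed_emp m0 N k x. f y)
      = (\<Sum>i<N. 1 / N * (LINT y|(if i < k then return borel (x i) else m0). f y))"
    unfolding mixed_emp_def using assms prob_momentD[OF assms(1)] int_return
    by (intro integral_wsum(2)) auto
  also have "\<dots> = (\<Sum>i<N. (if i < k then f (x i) else (LINT y|m0. f y))) / N"
    unfolding sum_divide_distrib using assms(3) by (intro sum.cong refl) (simp add: integral_return)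
  finally show ?thesis
    using sum_if_less[OF assms(2)] by simp
qed

text \<open>The two measures differ only in component k, where a share s of the mass 1/N is moved
  from \<open>m0\<close> to the point \<open>x k\<close>. The other components are coupled along the
  diagonal. In component k, a share 1 - s stays on the diagonal and a share s is the product of the
  Dirac mass at \<open>x k\<close> with \<open>m0\<close>.\<close>

lemma mixed_emp_step_coupling:
  assumes m0: "m0 \<in> prob_moment l" and k: "k < N" and s: "0 \<le> s" "s \<le> 1"
  obtains \<rho> where "sets \<rho> = sets borel" "prob_space \<rho>"
    "distr \<rho> borel fst = mixture s (mixed_emp m0 N k x) (mixed_emp m0 N (Suc k) x)"
    "distr \<rho> borel snd = mixed_emp m0 N k x"
    "\<And>G. G \<in> borel_measurable borel \<Longrightarrow>
       (\<integral>\<^sup>+z. indicator {z. fst z \<noteq> snd z} z * G z \<partial>\<rho>) \<le> ennreal (s / N) * (\<integral>\<^sup>+y. G (x k, y) \<partial>m0)"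
proof -
  note m0D = prob_momentD[OF m0]
  interpret prob_space m0 by fact
  note [measurable_cong] = m0D(1)
  have [measurable]: "(\<lambda>x::'a. (x, x)) \<in> borel \<rightarrow>\<^sub>M borel" "(\<lambda>y::'a. (x k, y)) \<in> borel \<rightarrow>\<^sub>M borel"
    by (intro borel_measurable_continuous_onI continuous_intros)+
  note proj = borel_measurable_projections[OF refl, where 'a='a and 'b='a]
  define ms where "ms i = (if i < k then return borel (x i) else m0)" for i
  define ms' where "ms' i = (if i < Suc k then return borel (x i) else m0)" for i
  have ms: "ms i \<in> prob_moment l" "ms' i \<in> prob_moment l" for i
    using m0 prob_moment_return by (auto simp: ms_def ms'_def)
  note msD = prob_momentD[OF ms(1)] prob_momentD[OF ms(2)]
  define diag :: "'a measure \<Rightarrow> ('a \<times> 'a) measure" where "diag \<mu> = distr \<mu> borel (\<lambda>x. (x, x))" for \<mu>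
  define jump :: "('a \<times> 'a) measure" where "jump = distr m0 borel (\<lambda>y. (x k, y))"
  have prob_diag: "prob_space (diag \<mu>)" if "\<mu> \<in> prob_moment l" for \<mu>
    unfolding diag_def using prob_momentD[OF that]
    by (intro prob_space.prob_space_distr) (simp_all cong: measurable_cong_sets)
  have prob_jump: "prob_space jump"
    unfolding jump_def by (intro prob_space_distr) simp
  define r where "r i = (if i = k then mixture s (diag m0) jump else diag (ms i))" for i
  have mom0: "\<mu> \<in> prob_moment 0" if "sets \<mu> = sets borel" "prob_space \<mu>" for \<mu> :: "('a \<times> 'a) measure"
    using that by (simp add: prob_moment_def norm_pow_def prob_space.finite_measure
        finite_measure.integrable_const)
  have diag: "diag \<mu> \<in> prob_moment 0" if "\<mu> \<in> prob_moment l" for \<mu>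
    by (rule mom0[OF _ prob_diag[OF that]]) (simp add: diag_def)
  have "jump \<in> prob_moment 0"
    by (rule mom0[OF _ prob_jump]) (simp add: jump_def)
  then have r: "r i \<in> prob_moment 0" for i
    unfolding r_def using prob_moment_mixture[OF s diag[OF m0]] diag[OF ms(1)] by simp
  note rD = prob_momentD[OF r]
  have dd: "distr (diag \<mu>) borel h = \<mu>" if "\<mu> \<in> prob_moment l" "h = fst \<or> h = snd" for \<mu> h
    unfolding diag_def using prob_momentD[OF that(1)] that(2) proj
    by (subst distr_distr) (auto simp: comp_def cong: measurable_cong_sets intro!: distr_id2)
  have dj: "distr jump borel fst = return borel (x k)" "distr jump borel snd = m0"
    unfolding jump_def using proj m0D
    by (subst distr_distr; auto simp: comp_def cong: measurable_cong_sets intro!: distr_id2 distr_const)+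
  have r_fst: "distr (r i) borel fst = mixture s (ms i) (ms' i)" for i
  proof (cases "i = k")
    case True
    then show ?thesis
      using proj dd[OF m0] dj by (simp add: r_def distr_mixture diag_def jump_def ms_def ms'_def)
  next
    case False
    then have "ms' i = ms i" by (auto simp: ms_def ms'_def)
    then show ?thesis
      using False dd[OF ms(1)] s msD by (simp add: r_def mixture_self)
  qed
  have r_snd: "distr (r i) borel snd = ms i" for i
  proof (cases "i = k")
    case True
    then have "ms i = m0" by (simp add: ms_def)
    then show ?thesis
      using True proj dd[OF m0] dj s m0D by (simp add: r_def distr_mixture diag_def jump_def mixture_self)
  next
    case False
    then show ?thesis using dd[OF ms(1)] by (simp add: r_def)
  qed
  define \<rho> where "\<rho> = wsum {..<N} (\<lambda>_. 1 / N) r"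
  show thesis
  proof (rule that[of \<rho>])
    show "sets \<rho> = sets borel" by (simp add: \<rho>_def)
    show "prob_space \<rho>"
      unfolding \<rho>_def using k rD by (intro prob_space_wsum) auto
    show "distr \<rho> borel fst = mixture s (mixed_emp m0 N k x) (mixed_emp m0 N (Suc k) x)"
      unfolding \<rho>_def mixed_emp_def using rD msD proj
      by (simp add: distr_wsum r_fst flip: ms_def ms'_def) (simp add: mixture_wsum)
    show "distr \<rho> borel snd = mixed_emp m0 N k x"
      unfolding \<rho>_def mixed_emp_def using rD proj
      by (simp add: distr_wsum r_snd flip: ms_def)
    fix G :: "'a \<times> 'a \<Rightarrow> ennreal" assume [measurable]: "G \<in> borel_measurable borel"
    define off_diag where "off_diag = {z :: 'a \<times> 'a. fst z \<noteq> snd z}"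
    have [measurable]: "off_diag \<in> sets borel" unfolding off_diag_def by (rule off_diagonal_borel)
    have off_diag: "(x, x) \<notin> off_diag" for x by (simp add: off_diag_def)
    let ?H = "\<lambda>z. indicator off_diag z * G z"
    have H [measurable]: "?H \<in> borel_measurable borel" by measurable
    have diag0: "(\<integral>\<^sup>+z. ?H z \<partial>diag \<mu>) = 0" if "\<mu> \<in> prob_moment l" for \<mu>
      unfolding diag_def using prob_momentD[OF that] H
      by (subst nn_integral_distr) (auto cong: measurable_cong_sets simp: off_diag)
    have "(\<integral>\<^sup>+z. ?H z \<partial>r k) = ennreal s * (\<integral>\<^sup>+z. ?H z \<partial>jump)"
      unfolding r_def using diag0[OF m0]
      by (simp add: mixture_eq_wsum, subst nn_integral_wsum) (auto simp: UNIV_bool diag_def jump_def)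
    also have "(\<integral>\<^sup>+z. ?H z \<partial>jump) \<le> (\<integral>\<^sup>+y. G (x k, y) \<partial>m0)"
      unfolding jump_def by (subst nn_integral_distr) (auto intro!: nn_integral_mono simp: indicator_def)
    finally have rk: "(\<integral>\<^sup>+z. ?H z \<partial>r k) \<le> ennreal s * (\<integral>\<^sup>+y. G (x k, y) \<partial>m0)"
      by (simp add: mult_left_mono)
    have "(\<integral>\<^sup>+z. ?H z \<partial>\<rho>) = (\<Sum>i<N. ennreal (1 / N) * (\<integral>\<^sup>+z. ?H z \<partial>r i))"
      unfolding \<rho>_def using rD by (intro nn_integral_wsum) auto
    also have "\<dots> = ennreal (1 / N) * (\<integral>\<^sup>+z. ?H z \<partial>r k)"
      using k diag0[OF ms(1)] by (subst sum.remove[of _ k]) (auto simp: r_def)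
    also have "\<dots> \<le> ennreal (1 / N) * (ennreal s * (\<integral>\<^sup>+y. G (x k, y) \<partial>m0))"
      by (intro mult_left_mono rk) simp
    also have "\<dots> = ennreal (s / N) * (\<integral>\<^sup>+y. G (x k, y) \<partial>m0)"
      using s by (simp add: mult.assoc[symmetric] ennreal_mult[symmetric])
    finally show "(\<integral>\<^sup>+z. indicator {z. fst z \<noteq> snd z} z * G z \<partial>\<rho>)
        \<le> ennreal (s / N) * (\<integral>\<^sup>+y. G (x k, y) \<partial>m0)"
      unfolding off_diag_def .
  qed
qed

subsection \<open>The nonlinear remainder\<close>

text \<open>The Hoelder error of a step is integrable but not square integrable, so that second moments are
  not available. A function with bounded first and second derivatives replaces the square.\<close>

definition soft_abs :: "real \<Rightarrow> real" where
  "soft_abs t = sqrt (1 + t\<^sup>2) - 1"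

lemma soft_abs_nonneg: "0 \<le> soft_abs t"
  by (simp add: soft_abs_def)

lemma soft_abs_0 [simp]: "soft_abs 0 = 0"
  by (simp add: soft_abs_def)

lemma soft_abs_pos: "t \<noteq> 0 \<Longrightarrow> 0 < soft_abs t"
  by (simp add: soft_abs_def)

lemma soft_abs_mono: "\<bar>s\<bar> \<le> \<bar>t\<bar> \<Longrightarrow> soft_abs s \<le> soft_abs t"
  by (simp add: soft_abs_def abs_le_square_iff)

lemma soft_abs_lipschitz: "soft_abs (t + d) \<le> soft_abs t + \<bar>d\<bar>"
proof -
  have "sqrt (1\<^sup>2 + (t + d)\<^sup>2) \<le> sqrt (1\<^sup>2 + t\<^sup>2) + sqrt (0\<^sup>2 + d\<^sup>2)"
    using real_sqrt_sum_squares_triangle_ineq[of 1 0 t d] by simp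
  then show ?thesis by (simp add: soft_abs_def)
qed

text \<open>This is Taylor's bound with second derivative at most 1, obtained from the inequality
  between geometric and arithmetic mean for \<open>q\<^sup>2\<close> and
  \<open>1 + (t + d)\<^sup>2\<close>. The slope depends on t only, so a centred increment d
  contributes nothing to first order.\<close>

lemma soft_abs_quadratic: "soft_abs (t + d) \<le> soft_abs t + t / sqrt (1 + t\<^sup>2) * d + d\<^sup>2 / 2"
proof -
  define q where "q = sqrt (1 + t\<^sup>2)"
  have q: "1 \<le> q" "q\<^sup>2 = 1 + t\<^sup>2" by (simp_all add: q_def)
  have "t * d / q + d\<^sup>2 / (2 * q) + q = (q\<^sup>2 + (1 + (t + d)\<^sup>2)) / (2 * q)"
    using q by (simp add: field_simps power2_eq_square)
  moreover have "sqrt (q\<^sup>2 * (1 + (t + d)\<^sup>2)) \<le> (q\<^sup>2 + (1 + (t + d)\<^sup>2)) / 2"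
    by (intro arith_geo_mean_sqrt) simp_all
  then have "q * sqrt (1 + (t + d)\<^sup>2) \<le> (q\<^sup>2 + (1 + (t + d)\<^sup>2)) / 2"
    unfolding real_sqrt_mult using q(1) by simp
  then have "sqrt (1 + (t + d)\<^sup>2) \<le> (q\<^sup>2 + (1 + (t + d)\<^sup>2)) / (2 * q)"
    using q(1) by (simp add: pos_le_divide_eq mult.commute mult.left_commute)
  moreover have "d\<^sup>2 / (2 * q) \<le> d\<^sup>2 / 2"
    using q(1) by (intro divide_left_mono) auto
  ultimately show ?thesis
    by (simp add: soft_abs_def q_def)
qed

section \<open>One-step estimates from the growth and Hoelder hypotheses\<close>

locale lin_fun_deriv_near =
  fixes l :: real and m0 :: "'a::euclidean_space measure"
    and U :: "'a measure \<Rightarrow> real" and dU :: "'a measure \<Rightarrow> 'a \<Rightarrow> real" and r Cg \<alpha> Ch :: real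
  assumes l_nonneg: "0 \<le> l" and m0: "m0 \<in> prob_moment l" and r_pos: "0 < r"
    and deriv: "\<And>\<mu>. \<mu> \<in> D_ball l m0 r \<Longrightarrow> has_lin_fun_deriv l U \<mu> (dU \<mu>)"
    and growth: "\<And>\<mu> x. \<mu> \<in> D_ball l m0 r \<Longrightarrow> \<bar>dU \<mu> x\<bar> \<le> Cg * (1 + norm_pow x (l / 2))"
    and \<alpha>: "1 / 2 < \<alpha>" "\<alpha> \<le> 1" and Ch: "0 \<le> Ch"
    and hoelder: "\<And>\<mu>1 \<mu>2 x. \<mu>1 \<in> D_ball l m0 r \<Longrightarrow> \<mu>2 \<in> D_ball l m0 r \<Longrightarrow>
       \<bar>dU \<mu>2 x - dU \<mu>1 x\<bar> \<le> Ch * ((1 + norm_pow x l) * W0 \<mu>2 \<mu>1 powr \<alpha>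
          + (1 + norm_pow x (l * (1 - \<alpha>))) * (LINT y|tv_measure \<mu>2 \<mu>1. norm_pow y l) powr \<alpha>)"
begin

definition weight :: "'a \<Rightarrow> real" where
  "weight x = 1 + norm_pow x l"

definition K0 :: real where
  "K0 = (LINT x|m0. weight x)"

text \<open>The constant of \<open>U_increment\<close>. One factor 1 + K0 arises from adding the
  average under \<open>m0\<close> to the value at the sample, the other from
  \<open>weight x + K0 \<le> (1 + K0) * weight x\<close>.\<close>

definition K :: real where
  "K = 3 * Ch * (1 + K0)\<^sup>2"

text \<open>This is the function V of the overview.\<close>

definition remainder :: "'a measure \<Rightarrow> real" where
  "remainder \<mu> = U \<mu> - U m0 - ((LINT y|\<mu>. dU m0 y) - (LINT y|m0. dU m0 y))"

lemma weight_ge_1: "1 \<le> weight x"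
  by (simp add: weight_def)

lemma weight_nonneg: "0 \<le> weight x"
  by (simp add: weight_def)

lemma weight_measurable [measurable]: "weight \<in> borel_measurable borel"
  unfolding weight_def[abs_def] by measurable

lemma weight_integrable: "\<mu> \<in> prob_moment l \<Longrightarrow> integrable \<mu> weight"
  using prob_moment_integrable_weight[of \<mu> l] by (simp add: weight_def[abs_def])

lemma K0_ge_1: "1 \<le> K0"
proof -
  interpret prob_space m0 using prob_momentD[OF m0] by simp
  have "(LINT x|m0. 1) \<le> K0"
    unfolding K0_def using weight_ge_1 weight_integrable[OF m0] by (intro integral_mono) auto
  then show ?thesis by (simp add: prob_space)
qed

lemma K_nonneg: "0 \<le> K"
  using Ch by (simp add: K_def)

lemma m0_in_ball: "m0 \<in> D_ball l m0 r"
  using D_self[OF l_nonneg m0 r_pos] m0 by (simp add: D_ball_def)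

lemma dU_measurable: "\<mu> \<in> D_ball l m0 r \<Longrightarrow> dU \<mu> \<in> borel_measurable borel"
  using deriv[of \<mu>] by (simp add: has_lin_fun_deriv_def)

lemma dU_integrable: "\<mu> \<in> D_ball l m0 r \<Longrightarrow> \<nu> \<in> prob_moment l \<Longrightarrow> integrable \<nu> (dU \<mu>)"
  using has_lin_fun_deriv_integrable[OF deriv] by simp

lemma integral_mixed_emp_Suc:
  fixes f :: "'a \<Rightarrow> real"
  assumes "k < N" "f \<in> borel_measurable borel" "integrable m0 f"
  shows "(LINT y|mixed_emp m0 N (Suc k) x. f y) - (LINT y|mixed_emp m0 N k x. f y)
      = (f (x k) - (LINT y|m0. f y)) / N"
  using assms by (simp add: integral_mixed_emp[OF m0] diff_divide_distrib[symmetric] algebra_simps)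

text \<open>The coupling of the step bounds \<open>W0\<close> by 1 / N and the l-th moment of the
  total variation by \<open>(weight (x k) + K0) / N\<close>; both are then inserted into the Hoelder
  hypothesis.\<close>

lemma dU_increment:
  assumes k: "k < N" and s: "0 \<le> s" "s \<le> 1"
    and ball: "mixed_emp m0 N k x \<in> D_ball l m0 r"
      "mixture s (mixed_emp m0 N k x) (mixed_emp m0 N (Suc k) x) \<in> D_ball l m0 r"
  shows "\<bar>dU (mixture s (mixed_emp m0 N k x) (mixed_emp m0 N (Suc k) x)) y - dU (mixed_emp m0 N k x) y\<bar>
    \<le> Ch * (1 / N) powr \<alpha> * (weight y + (1 + norm_pow y (l * (1 - \<alpha>))) * (weight (x k) + K0) powr \<alpha>)"
proof -
  let ?\<mu> = "mixed_emp m0 N k x" and ?\<nu> = "mixture s (mixed_emp m0 N k x) (mixed_emp m0 N (Suc k) x)"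
  have N: "1 \<le> N" using k by simp
  interpret prob_space m0 using prob_momentD[OF m0] by simp
  note [measurable_cong] = prob_momentD(1)[OF m0]
  note proj [measurable] = borel_measurable_projections[OF refl, where 'a='a and 'b='a]
  obtain \<rho> where \<rho>: "sets \<rho> = sets borel" "prob_space \<rho>" "distr \<rho> borel fst = ?\<nu>" "distr \<rho> borel snd = ?\<mu>"
    and cost: "\<And>G. G \<in> borel_measurable borel \<Longrightarrow>
       (\<integral>\<^sup>+z. indicator {z. fst z \<noteq> snd z} z * G z \<partial>\<rho>) \<le> ennreal (s / N) * (\<integral>\<^sup>+y. G (x k, y) \<partial>m0)"
    by (rule mixed_emp_step_coupling[OF m0 k s, where x=x]) (rule that)
  have mom: "?\<mu> \<in> prob_moment l" "?\<nu> \<in> prob_moment l"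
    using ball by (auto simp: D_ball_def)
  have cpl: "\<rho> \<in> couplings 0 ?\<nu> ?\<mu>"
    using couplingsI[OF _ \<rho>] prob_moment_0[OF mom(1)] prob_moment_0[OF mom(2)] by simp
  have sN: "s / N \<le> 1 / N" using s(2) by (intro divide_right_mono) auto
  have "(\<integral>\<^sup>+z. ennreal (indicator {z. fst z \<noteq> snd z} z) \<partial>\<rho>) \<le> ennreal (s / N)"
    using cost[of "\<lambda>_. 1"] by (simp add: emeasure_space_1 ennreal_indicator)
  then have "(LINT z|\<rho>. indicator {z. fst z \<noteq> snd z} z) \<le> s / N"
    using s by (intro integral_real_bounded) auto
  then have W0: "W0 ?\<nu> ?\<mu> \<le> 1 / N" "0 \<le> W0 ?\<nu> ?\<mu>"
    using W0_le_coupling[OF cpl] W0_nonneg[of ?\<nu> ?\<mu>] cpl sN by auto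
  have "(LINT y|tv_measure ?\<nu> ?\<mu>. norm_pow y l) \<le> 1 / N * (weight (x k) + K0)"
  proof (rule tv_integral_le_coupling[OF \<rho>])
    let ?G = "\<lambda>z :: 'a \<times> 'a. ennreal (norm_pow (fst z) l + norm_pow (snd z) l)"
    have "?G \<in> borel_measurable borel" by measurable
    from cost[OF this]
    have "(\<integral>\<^sup>+z. indicator {z. fst z \<noteq> snd z} z * ?G z \<partial>\<rho>)
        \<le> ennreal (s / N) * (\<integral>\<^sup>+y. ennreal (norm_pow (x k) l + norm_pow y l) \<partial>m0)"
      by simp
    also have "\<dots> \<le> ennreal (1 / N) * (\<integral>\<^sup>+y. ennreal (weight (x k) + weight y) \<partial>m0)"
      using sN by (intro mult_mono nn_integral_mono ennreal_leI) (auto simp: weight_def)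
    also have "(\<integral>\<^sup>+y. ennreal (weight (x k) + weight y) \<partial>m0) = ennreal (weight (x k) + K0)"
      using weight_integrable[OF m0] weight_nonneg
      by (subst nn_integral_eq_integral) (auto simp: K0_def prob_space)
    also have "ennreal (1 / N) * ennreal (weight (x k) + K0) = ennreal (1 / N * (weight (x k) + K0))"
      using weight_ge_1[of "x k"] K0_ge_1 by (intro ennreal_mult[symmetric]) auto
    finally show "(\<integral>\<^sup>+z. indicator {z. fst z \<noteq> snd z} z * ?G z \<partial>\<rho>) \<le> ennreal (1 / N * (weight (x k) + K0))" .
    show "0 \<le> 1 / N * (weight (x k) + K0)"
      using weight_ge_1[of "x k"] K0_ge_1 by simp
  qed simp_all
  then have "(LINT y|tv_measure ?\<nu> ?\<mu>. norm_pow y l) powr \<alpha> \<le> (1 / N * (weight (x k) + K0)) powr \<alpha>"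
    using \<alpha> by (intro powr_mono2) (auto intro!: Bochner_Integration.integral_nonneg)
  also have "\<dots> = (1 / N) powr \<alpha> * (weight (x k) + K0) powr \<alpha>"
    by (rule powr_mult)
  finally have tv: "(LINT y|tv_measure ?\<nu> ?\<mu>. norm_pow y l) powr \<alpha>
      \<le> (1 / N) powr \<alpha> * (weight (x k) + K0) powr \<alpha>" .
  have W0': "W0 ?\<nu> ?\<mu> powr \<alpha> \<le> (1 / N) powr \<alpha>"
    using W0 \<alpha> by (intro powr_mono2) auto
  have "\<bar>dU ?\<nu> y - dU ?\<mu> y\<bar> \<le> Ch * (weight y * W0 ?\<nu> ?\<mu> powr \<alpha>
      + (1 + norm_pow y (l * (1 - \<alpha>))) * (LINT y|tv_measure ?\<nu> ?\<mu>. norm_pow y l) powr \<alpha>)"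
    unfolding weight_def by (rule hoelder[OF ball])
  also have "\<dots> \<le> Ch * (weight y * (1 / N) powr \<alpha>
      + (1 + norm_pow y (l * (1 - \<alpha>))) * ((1 / N) powr \<alpha> * (weight (x k) + K0) powr \<alpha>))"
    using Ch W0' tv weight_ge_1[of y] by (intro mult_left_mono add_mono) (auto intro: order_trans[OF zero_le_one])
  finally show ?thesis
    by (simp add: algebra_simps)
qed

text \<open>The mean value theorem evaluates the derivative at an unknown point of the segment,
  which depends on the new sample. Replacing it by the derivative at the start of the step, known
  before that sample is drawn, makes the main term centred; the Hoelder hypothesis pays for the
  exchange.\<close>

lemma U_increment:
  assumes k: "k < N"
    and path: "\<And>s. 0 \<le> s \<Longrightarrow> s \<le> 1 \<Longrightarrow>
      mixture s (mixed_emp m0 N k x) (mixed_emp m0 N (Suc k) x) \<in> D_ball l m0 r"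
  shows "\<bar>U (mixed_emp m0 N (Suc k) x) - U (mixed_emp m0 N k x)
      - (dU (mixed_emp m0 N k x) (x k) - (LINT y|m0. dU (mixed_emp m0 N k x) y)) / N\<bar>
    \<le> K / N * (1 / N) powr \<alpha> * weight (x k)"
proof -
  have N: "1 \<le> N" using k by simp
  let ?\<mu> = "mixed_emp m0 N k x" and ?\<nu> = "mixed_emp m0 N (Suc k) x"
  have \<mu>: "?\<mu> \<in> prob_moment l" and \<nu>: "?\<nu> \<in> prob_moment l"
    using m0 N by (simp_all add: prob_moment_mixed_emp)
  have \<mu>_ball: "?\<mu> \<in> D_ball l m0 r"
    using path[of 0] prob_momentD(1)[OF \<mu>] prob_momentD(1)[OF \<nu>] by (simp add: mixture_0)
  obtain s where s: "0 < s" "s < 1"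
    and mvt: "U ?\<nu> - U ?\<mu> = (LINT y|?\<nu>. dU (mixture s ?\<mu> ?\<nu>) y) - (LINT y|?\<mu>. dU (mixture s ?\<mu> ?\<nu>) y)"
    by (rule lin_fun_deriv_mvt[OF \<mu> \<nu>, of U "\<lambda>s. dU (mixture s ?\<mu> ?\<nu>)"]) (use deriv path in auto)
  define \<phi> where "\<phi> = dU (mixture s ?\<mu> ?\<nu>)"
  have ball: "mixture s ?\<mu> ?\<nu> \<in> D_ball l m0 r" using s by (intro path) auto
  have int: "integrable m0 \<phi>" "integrable m0 (dU ?\<mu>)"
    unfolding \<phi>_def using dU_integrable ball \<mu>_ball m0 by auto
  define G where "G = weight (x k) + K0"
  have G1: "1 \<le> G" using weight_ge_1[of "x k"] K0_ge_1 by (simp add: G_def)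
  define c where "c = Ch * (1 / N) powr \<alpha>"
  have c: "0 \<le> c" using Ch by (simp add: c_def)
  have inc: "\<bar>\<phi> y - dU ?\<mu> y\<bar> \<le> c * (weight y + (1 + norm_pow y (l * (1 - \<alpha>))) * G powr \<alpha>)" for y
    unfolding \<phi>_def c_def G_def using s by (intro dU_increment k \<mu>_ball ball) auto
  \<comment> \<open>At the sample itself, the powers 1 - \<alpha> and \<alpha> of G combine to G. A
    cruder estimate would leave a product of two weights at \<open>x k\<close>, which need not be
    integrable.\<close>
  have at_x: "\<bar>\<phi> (x k) - dU ?\<mu> (x k)\<bar> \<le> c * (3 * G)"
  proof -
    have "norm_pow (x k) (l * (1 - \<alpha>)) \<le> weight (x k) powr (1 - \<alpha>)"
      unfolding weight_def using \<alpha> l_nonneg by (intro norm_pow_le_powr) auto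
    also have "\<dots> \<le> G powr (1 - \<alpha>)"
      using \<alpha> weight_ge_1[of "x k"] K0_ge_1 by (intro powr_mono2) (auto simp: G_def)
    finally have "norm_pow (x k) (l * (1 - \<alpha>)) \<le> G powr (1 - \<alpha>)" .
    moreover have "1 \<le> G powr (1 - \<alpha>)"
      using G1 \<alpha> by (intro ge_one_powr_ge_zero) auto
    ultimately have "(1 + norm_pow (x k) (l * (1 - \<alpha>))) * G powr \<alpha> \<le> (2 * G powr (1 - \<alpha>)) * G powr \<alpha>"
      by (intro mult_right_mono) auto
    also have "\<dots> = 2 * G"
      using G1 by (simp add: powr_add[symmetric])
    finally have "weight (x k) + (1 + norm_pow (x k) (l * (1 - \<alpha>))) * G powr \<alpha> \<le> 3 * G"
      using K0_ge_1 by (simp add: G_def)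
    then show ?thesis
      by (rule order_trans[OF inc mult_left_mono[OF _ c]])
  qed
  \<comment> \<open>Here y is integrated against \<open>m0\<close> independently of
    \<open>x k\<close>, so a product of the two weights is harmless and the simpler estimates
    suffice.\<close>
  have at_y: "\<bar>\<phi> y - dU ?\<mu> y\<bar> \<le> c * (3 * G) * weight y" for y
  proof -
    have "G powr \<alpha> \<le> G powr 1"
      using G1 \<alpha> by (intro powr_mono) auto
    then have "(1 + norm_pow y (l * (1 - \<alpha>))) * G powr \<alpha> \<le> (2 * weight y) * G"
    proof (intro mult_mono)
      have "norm_pow y (l * (1 - \<alpha>)) \<le> 1 + norm_pow y l"
        using \<alpha> l_nonneg by (intro norm_pow_le) auto
      moreover have "1 + p \<le> 2 * (1 + p')" if "p \<le> 1 + p'" "0 \<le> p'" for p p' :: real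
        using that by simp
      ultimately show "1 + norm_pow y (l * (1 - \<alpha>)) \<le> 2 * weight y"
        unfolding weight_def using norm_pow_nonneg by blast
      show "0 \<le> 2 * weight y"
        using weight_ge_1[of y] by linarith
    qed (use \<open>G powr \<alpha> \<le> G powr 1\<close> G1 in auto)
    moreover have "weight y \<le> weight y * G"
      using G1 weight_ge_1[of y] by simp
    ultimately have "weight y + (1 + norm_pow y (l * (1 - \<alpha>))) * G powr \<alpha> \<le> 3 * G * weight y"
      by (simp add: algebra_simps)
    then show ?thesis
      using order_trans[OF inc mult_left_mono[OF _ c], of y "3 * G * weight y"] by (simp add: mult.assoc)
  qed
  have "\<bar>LINT y|m0. \<phi> y - dU ?\<mu> y\<bar> \<le> (LINT y|m0. c * (3 * G) * weight y)"
    using at_y int weight_integrable[OF m0]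
    by (intro order_trans[OF integral_abs_bound] integral_mono) auto
  then have avg: "\<bar>(LINT y|m0. \<phi> y) - (LINT y|m0. dU ?\<mu> y)\<bar> \<le> c * (3 * G) * K0"
    using int by (simp add: K0_def)
  have eq: "U ?\<nu> - U ?\<mu> = (\<phi> (x k) - (LINT y|m0. \<phi> y)) / N"
    unfolding mvt \<phi>_def[symmetric]
    using int(1) dU_measurable[OF ball] by (intro integral_mixed_emp_Suc k) (simp_all add: \<phi>_def)
  have "\<bar>U ?\<nu> - U ?\<mu> - (dU ?\<mu> (x k) - (LINT y|m0. dU ?\<mu> y)) / N\<bar>
      = \<bar>(\<phi> (x k) - dU ?\<mu> (x k)) - ((LINT y|m0. \<phi> y) - (LINT y|m0. dU ?\<mu> y))\<bar> / N"
    unfolding eq diff_divide_distrib[symmetric] by (simp add: abs_divide algebra_simps)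
  also have "\<dots> \<le> (c * (3 * G) + c * (3 * G) * K0) / N"
    using at_x avg by (intro divide_right_mono) linarith+
  also have "\<dots> = c * 3 * (1 + K0) * G / N"
    by (simp add: algebra_simps)
  also have "\<dots> \<le> c * 3 * (1 + K0) * ((1 + K0) * weight (x k)) / N"
  proof -
    have "G \<le> (1 + K0) * weight (x k)"
      using weight_ge_1[of "x k"] K0_ge_1 by (simp add: G_def distrib_right)
    then show ?thesis
      using c K0_ge_1 by (intro divide_right_mono mult_left_mono) auto
  qed
  also have "\<dots> = K / N * (1 / N) powr \<alpha> * weight (x k)"
    by (simp add: K_def c_def power2_eq_square)
  finally show ?thesis .
qed

text \<open>The number a is the allowance for later steps. Where the new measure lies in Q,
  convexity keeps the segment in the ball, and the tangent bound of \<open>soft_abs\<close> applies.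
  Its linear term averages to 0, its quadratic term is a variance of order
  \<open>e\<^sup>2 / N\<close>, and the Hoelder error enters through the Lipschitz bound.\<close>

lemma step_bound:
  assumes k: "k < N" and \<delta>: "\<delta> \<le> r" and e: "0 \<le> e"
    and close: "\<And>\<mu> x. \<mu> \<in> D_ball l m0 \<delta> \<Longrightarrow> \<bar>dU \<mu> x - dU m0 x\<bar> \<le> e * (1 + norm_pow x (l / 2))"
    and convex: "\<And>\<mu> \<nu> s. \<mu> \<in> Q \<Longrightarrow> \<nu> \<in> Q \<Longrightarrow> 0 \<le> s \<Longrightarrow> s \<le> 1 \<Longrightarrow> mixture s \<mu> \<nu> \<in> Q"
    and Q: "Q \<subseteq> D_ball l m0 \<delta>" and \<mu>Q: "mixed_emp m0 N k x \<in> Q" and a: "0 \<le> a"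
  shows "(\<integral>\<^sup>+y. (if mixed_emp m0 N (Suc k) (x(k := y)) \<in> Q
        then ennreal (soft_abs (sqrt N * remainder (mixed_emp m0 N (Suc k) (x(k := y)))) + a) else 0) \<partial>m0)
      \<le> ennreal (soft_abs (sqrt N * remainder (mixed_emp m0 N k x)) + a
         + (2 * e\<^sup>2 * K0 + K * K0 * sqrt N * (1 / N) powr \<alpha>) / N)"
proof -
  let ?\<mu> = "mixed_emp m0 N k x"
  interpret prob_space m0 using prob_momentD[OF m0] by simp
  note [measurable_cong] = prob_momentD(1)[OF m0]
  have N: "0 < real N" using k by simp
  have Qr: "\<mu> \<in> D_ball l m0 r" if "\<mu> \<in> Q" for \<mu>
    using Q \<delta> that by (auto simp: D_ball_def)
  note \<mu>r = Qr[OF \<mu>Q]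
  note [measurable] = dU_measurable[OF \<mu>r] dU_measurable[OF m0_in_ball]
  define \<phi> where "\<phi> y = dU ?\<mu> y - dU m0 y" for y
  have [measurable]: "\<phi> \<in> borel_measurable borel" unfolding \<phi>_def[abs_def] by measurable
  have \<phi>_int: "integrable m0 \<phi>"
    unfolding \<phi>_def[abs_def] using dU_integrable[OF \<mu>r m0] dU_integrable[OF m0_in_ball m0] by simp
  define \<psi> where "\<psi> y = \<phi> y - (LINT y|m0. \<phi> y)" for y
  have \<phi>_sq: "(\<phi> y)\<^sup>2 \<le> 4 * e\<^sup>2 * weight y" for y
  proof -
    have "(\<phi> y)\<^sup>2 \<le> (e * (1 + norm_pow y (l / 2)))\<^sup>2"
      using close[of ?\<mu> y] Q \<mu>Q by (intro abs_le_square_iff[THEN iffD1]) (force simp: \<phi>_def)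
    also have "\<dots> \<le> e\<^sup>2 * (4 * weight y)"
      unfolding power_mult_distrib weight_def using weight_half_sq_le[OF l_nonneg, of y] by (intro mult_left_mono) auto
    finally show ?thesis by simp
  qed
  have \<phi>_sq_int: "integrable m0 (\<lambda>y. (\<phi> y)\<^sup>2)"
    by (rule Bochner_Integration.integrable_bound[of _ "\<lambda>y. 4 * e\<^sup>2 * weight y"])
      (use \<phi>_sq weight_integrable[OF m0] in \<open>auto intro!: AE_I2 intro: order_trans[OF _ abs_ge_self]\<close>)
  have \<psi>_int: "integrable m0 \<psi>" "(LINT y|m0. \<psi> y) = 0"
    unfolding \<psi>_def[abs_def] using \<phi>_int by (simp_all add: prob_space)
  have \<psi>_sq_int: "integrable m0 (\<lambda>y. (\<psi> y)\<^sup>2)"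
    unfolding \<psi>_def power2_diff using \<phi>_int \<phi>_sq_int by simp
  have "(LINT y|m0. (\<psi> y)\<^sup>2) = variance \<phi>"
    by (simp add: \<psi>_def)
  also have "\<dots> \<le> (LINT y|m0. (\<phi> y)\<^sup>2)"
    using variance_eq[OF \<phi>_int \<phi>_sq_int] by simp
  also have "\<dots> \<le> (LINT y|m0. 4 * e\<^sup>2 * weight y)"
    using \<phi>_sq \<phi>_sq_int weight_integrable[OF m0] by (intro integral_mono) auto
  finally have \<psi>_sq: "(LINT y|m0. (\<psi> y)\<^sup>2) \<le> 4 * e\<^sup>2 * K0"
    by (simp add: K0_def)
  define t where "t = sqrt N * remainder ?\<mu>"
  define b where "b = t / sqrt (1 + t\<^sup>2)"
  define d where "d = sqrt N * (K / N * (1 / N) powr \<alpha>)"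
  have d0: "0 \<le> d" using K_nonneg by (simp add: d_def)
  define q where "q y = soft_abs t + b * (\<psi> y / sqrt N) + (\<psi> y / sqrt N)\<^sup>2 / 2 + d * weight y + a" for y
  \<comment> \<open>The integrand to be bounded is 0 when the new measure leaves Q, so q has to be
    nonnegative there too, although its linear term has no sign. The tangent bound for the
    nonnegative function \<open>soft_abs\<close> provides this.\<close>
  have q_nonneg: "0 \<le> q y" for y
  proof -
    have "0 \<le> soft_abs t + b * (\<psi> y / sqrt N) + (\<psi> y / sqrt N)\<^sup>2 / 2"
      using soft_abs_quadratic[of t "\<psi> y / sqrt N"] soft_abs_nonneg[of "t + \<psi> y / sqrt N"]
      by (simp add: b_def)
    then show ?thesis
      using d0 weight_ge_1[of y] a by (simp add: q_def)
  qed
  have bound: "soft_abs (sqrt N * remainder (mixed_emp m0 N (Suc k) (x(k := y)))) + a \<le> q y"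
    if \<nu>Q: "mixed_emp m0 N (Suc k) (x(k := y)) \<in> Q" for y
  proof -
    let ?x = "x(k := y)"
    let ?\<nu> = "mixed_emp m0 N (Suc k) ?x"
    have \<mu>x: "mixed_emp m0 N k ?x = ?\<mu>" by (rule mixed_emp_upd) simp
    have path: "mixture s (mixed_emp m0 N k ?x) ?\<nu> \<in> D_ball l m0 r" if "0 \<le> s" "s \<le> 1" for s
      unfolding \<mu>x using convex[OF \<mu>Q \<nu>Q that] by (rule Qr)
    define R where "R = U ?\<nu> - U ?\<mu> - (dU ?\<mu> y - (LINT y|m0. dU ?\<mu> y)) / N"
    have R: "\<bar>R\<bar> \<le> K / N * (1 / N) powr \<alpha> * weight y"
      using U_increment[OF k path] by (simp add: \<mu>x R_def)
    have lin: "(LINT y|?\<nu>. dU m0 y) - (LINT y|?\<mu>. dU m0 y) = (dU m0 y - (LINT y|m0. dU m0 y)) / N"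
      using integral_mixed_emp_Suc[OF k dU_measurable[OF m0_in_ball] dU_integrable[OF m0_in_ball m0], of ?x]
      by (simp add: \<mu>x)
    have "remainder ?\<nu> = remainder ?\<mu> + \<psi> y / N + R"
      using lin dU_integrable[OF \<mu>r m0] dU_integrable[OF m0_in_ball m0]
      by (simp add: remainder_def R_def \<psi>_def \<phi>_def diff_divide_distrib)
    then have "sqrt N * remainder ?\<nu> = (t + \<psi> y / sqrt N) + sqrt N * R"
    proof -
      have "a * (p / (a * a)) = p / a" if "0 < a" for a p :: real
        using that by simp
      from this[of "sqrt N" "\<psi> y"] N have "sqrt N * (\<psi> y / N) = \<psi> y / sqrt N"
        by simp
      then show ?thesis
        by (simp only: \<open>remainder ?\<nu> = remainder ?\<mu> + \<psi> y / N + R\<close> t_def distrib_left)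
    qed
    then have "soft_abs (sqrt N * remainder ?\<nu>) \<le> soft_abs (t + \<psi> y / sqrt N) + \<bar>sqrt N * R\<bar>"
      by (simp only: soft_abs_lipschitz)
    also have "\<bar>sqrt N * R\<bar> \<le> d * weight y"
    proof -
      have "sqrt N * \<bar>R\<bar> \<le> sqrt N * (K / N * (1 / N) powr \<alpha> * weight y)"
        by (intro mult_left_mono R) simp
      then show ?thesis by (simp add: abs_mult d_def mult.assoc)
    qed
    finally show ?thesis
      using soft_abs_quadratic[of t "\<psi> y / sqrt N"] by (simp add: q_def b_def)
  qed
  have q_int: "integrable m0 q"
    unfolding q_def[abs_def] power_divide using \<psi>_int(1) \<psi>_sq_int weight_integrable[OF m0] by simp
  have "(LINT y|m0. q y) = soft_abs t + (LINT y|m0. (\<psi> y)\<^sup>2) / (2 * N) + d * K0 + a"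
    unfolding q_def[abs_def] power_divide using \<psi>_int \<psi>_sq_int weight_integrable[OF m0]
    by (simp add: prob_space K0_def)
  also have "\<dots> \<le> soft_abs t + (4 * e\<^sup>2 * K0) / (2 * N) + d * K0 + a"
    using \<psi>_sq N by (intro add_mono divide_right_mono order_refl) auto
  also have "\<dots> = soft_abs t + a + (2 * e\<^sup>2 * K0 + K * K0 * sqrt N * (1 / N) powr \<alpha>) / N"
    by (simp add: d_def add_divide_distrib algebra_simps)
  finally have q_le: "(LINT y|m0. q y) \<le> soft_abs t + a + (2 * e\<^sup>2 * K0 + K * K0 * sqrt N * (1 / N) powr \<alpha>) / N" .
  have "(\<integral>\<^sup>+y. (if mixed_emp m0 N (Suc k) (x(k := y)) \<in> Q
        then ennreal (soft_abs (sqrt N * remainder (mixed_emp m0 N (Suc k) (x(k := y)))) + a) else 0) \<partial>m0)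
      \<le> (\<integral>\<^sup>+y. ennreal (q y) \<partial>m0)"
    using bound by (intro nn_integral_mono) (auto intro: ennreal_leI)
  also have "\<dots> = ennreal (LINT y|m0. q y)"
    using q_int q_nonneg by (intro nn_integral_eq_integral) auto
  also have "\<dots> \<le> ennreal (soft_abs t + a + (2 * e\<^sup>2 * K0 + K * K0 * sqrt N * (1 / N) powr \<alpha>) / N)"
    by (intro ennreal_leI q_le)
  finally show ?thesis
    by (simp add: t_def)
qed

lemma remainder_m0: "remainder m0 = 0"
  by (simp add: remainder_def)

text \<open>Each of the N steps raises the bound by at most c, and the process starts from remainder
  0, so N c bounds the final value.\<close>

lemma remainder_bound:
  assumes N: "1 \<le> N" and \<delta>: "\<delta> \<le> r" and e: "0 \<le> e"
    and close: "\<And>\<mu> x. \<mu> \<in> D_ball l m0 \<delta> \<Longrightarrow> \<bar>dU \<mu> x - dU m0 x\<bar> \<le> e * (1 + norm_pow x (l / 2))"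
    and convex: "\<And>\<mu> \<nu> s. \<mu> \<in> Q \<Longrightarrow> \<nu> \<in> Q \<Longrightarrow> 0 \<le> s \<Longrightarrow> s \<le> 1 \<Longrightarrow> mixture s \<mu> \<nu> \<in> Q"
    and Q: "Q \<subseteq> D_ball l m0 \<delta>"
    and f: "f \<in> borel_measurable (Pi\<^sub>M {..<N} (\<lambda>_. m0))"
      "\<And>x. f x \<le> (if \<forall>j\<le>N. mixed_emp m0 N j x \<in> Q
         then ennreal (soft_abs (sqrt N * remainder (mixed_emp m0 N N x))) else 0)"
  shows "(\<integral>\<^sup>+x. f x \<partial>Pi\<^sub>M {..<N} (\<lambda>_. m0)) \<le> ennreal (2 * e\<^sup>2 * K0 + K * K0 * sqrt N * (1 / N) powr \<alpha>)"
proof -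
  define c where "c = (2 * e\<^sup>2 * K0 + K * K0 * sqrt N * (1 / N) powr \<alpha>) / N"
  have c: "0 \<le> c" using K_nonneg K0_ge_1 by (simp add: c_def)
  \<comment> \<open>The term (N - k) c reserves the cost of the steps to come, which makes
    \<open>h\<close> decrease on average. Requiring all earlier measures to lie in Q kills the
    process for good at its first exit.\<close>
  define h where "h k x = (if \<forall>j\<le>k. mixed_emp m0 N j x \<in> Q
      then ennreal (soft_abs (sqrt N * remainder (mixed_emp m0 N k x)) + (real N - real k) * c) else 0)" for k x
  interpret prob_space m0 using prob_momentD[OF m0] by simp
  have "(\<integral>\<^sup>+x. f x \<partial>Pi\<^sub>M {..<N} (\<lambda>_. m0)) \<le> h 0 (\<lambda>_. undefined)"
  proof (rule iterated_nn_integral_le)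
    show "sigma_finite_measure m0" ..
    show "f x \<le> h N x" for x
      unfolding h_def using f(2)[of x] by (simp only: diff_self mult_zero_left add_0_right)
    fix k x assume k: "k < N"
    show "(\<integral>\<^sup>+y. h (Suc k) (x(k := y)) \<partial>m0) \<le> h k x"
    proof (cases "\<forall>j\<le>k. mixed_emp m0 N j x \<in> Q")
      case False
      then have "\<not> (\<forall>j\<le>Suc k. mixed_emp m0 N j (x(k := y)) \<in> Q)" for y
        by (metis le_SucI mixed_emp_upd)
      then have "h (Suc k) (x(k := y)) = 0" for y
        by (simp only: h_def if_False)
      then show ?thesis by simp
    next
      case True
      define a where "a = (real N - real (Suc k)) * c"
      have a: "0 \<le> a" using k c by (simp add: a_def)
      have "(\<integral>\<^sup>+y. h (Suc k) (x(k := y)) \<partial>m0) \<le> (\<integral>\<^sup>+y. (if mixed_emp m0 N (Suc k) (x(k := y)) \<in> Q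
        then ennreal (soft_abs (sqrt N * remainder (mixed_emp m0 N (Suc k) (x(k := y)))) + a) else 0) \<partial>m0)"
        by (intro nn_integral_mono) (auto simp: h_def a_def)
      also have "\<dots> \<le> ennreal (soft_abs (sqrt N * remainder (mixed_emp m0 N k x)) + a + c)"
        unfolding c_def using True by (intro step_bound[OF k \<delta> e close convex Q _ a]) auto
      also have "\<dots> = h k x"
        using True by (simp add: h_def a_def algebra_simps)
      finally show ?thesis .
    qed
  qed (rule f(1))
  also have "\<dots> \<le> ennreal (N * c)"
    using mixed_emp_0[OF m0 N] by (simp add: h_def remainder_m0)
  finally show ?thesis
    using N by (simp add: c_def)
qed

end

subsection \<open>Deviations of frequencies and convergence in distribution\<close>

text \<open>The threshold is \<kappa> N rather than \<kappa> k because samples carry weight 1/N in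
  the k-th intermediate measure. As k is at most N, Hoeffding's bound becomes uniform in k.\<close>

lemma (in prob_space) iid_frequency_deviation:
  fixes X :: "nat \<Rightarrow> 'a \<Rightarrow> 'b::topological_space" and \<kappa> :: real
  assumes indep: "indep_vars (\<lambda>_. borel) X UNIV" and distr: "\<And>i. distr M borel (X i) = m"
    and A: "A \<in> sets borel" and \<kappa>: "0 < \<kappa>" and N: "1 \<le> N" "k \<le> N"
  shows "prob {\<omega> \<in> space M. \<bar>\<Sum>i<k. indicator A (X i \<omega>) - measure m A\<bar> \<ge> \<kappa> * N} \<le> 2 * exp (- (2 * \<kappa>\<^sup>2) * N)"
proof (cases "k = 0")
  case True
  have "0 < \<kappa> * N" using \<kappa> N by simp
  then have "{\<omega> \<in> space M. \<bar>\<Sum>i<k. indicator A (X i \<omega>) - measure m A\<bar> \<ge> \<kappa> * N} = {}"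
    using True by auto
  then show ?thesis by (simp only: measure_empty) simp
next
  case False
  have X [measurable]: "random_variable borel (X i)" for i
    using indep by (simp add: indep_vars_def2)
  have "indep_vars (\<lambda>_. borel) (\<lambda>i \<omega>. indicat_real A (X i \<omega>)) UNIV"
    by (rule indep_vars_compose2[OF indep]) (use A in auto)
  then have "indep_vars (\<lambda>_. borel) (\<lambda>i \<omega>. indicat_real A (X i \<omega>)) {..<k}"
    by (rule indep_vars_subset) auto
  then interpret Hoeffding_ineq M "{..<k}" "\<lambda>i \<omega>. indicat_real A (X i \<omega>)" "\<lambda>_. 0" "\<lambda>_. 1"
    "\<Sum>i<k. expectation (\<lambda>\<omega>. indicat_real A (X i \<omega>))"
    by unfold_locales (auto simp: indicator_def)
  have E: "expectation (\<lambda>\<omega>. indicat_real A (X i \<omega>)) = measure m A" for i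
  proof -
    have "expectation (\<lambda>\<omega>. indicat_real A (X i \<omega>)) = (LINT x|distr M borel (X i). indicat_real A x)"
      using A by (intro integral_distr[symmetric]) auto
    moreover have "space m = UNIV"
      using arg_cong[OF distr[of 0], of space] by simp
    ultimately show ?thesis using A by (simp add: distr)
  qed
  have "prob {\<omega> \<in> space M. \<bar>(\<Sum>i<k. indicat_real A (X i \<omega>)) - (\<Sum>i<k. measure m A)\<bar> \<ge> \<kappa> * N}
      \<le> 2 * exp (- 2 * (\<kappa> * N)\<^sup>2 / k)"
    using Hoeffding_ineq_abs_ge[of "\<kappa> * N"] \<kappa> False by (simp add: E)
  also have "\<dots> \<le> 2 * exp (- (2 * \<kappa>\<^sup>2) * N)"
  proof -
    have "real k * real N \<le> real N * real N"
      using N by (intro mult_right_mono) auto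
    then have "2 * \<kappa>\<^sup>2 * (real k * real N) \<le> 2 * \<kappa>\<^sup>2 * (real N * real N)"
      by (intro mult_left_mono) auto
    then have "- 2 * (\<kappa> * N)\<^sup>2 / k \<le> - (2 * \<kappa>\<^sup>2) * N"
      using False by (simp add: field_simps power2_eq_square)
    then show ?thesis by simp
  qed
  finally show ?thesis by (simp add: sum_subtractf)
qed

text \<open>The union bound runs over n (N + 1) events, and an exponential estimate absorbs this
  factor. Chebyshev's inequality, with order 1 / N for each event, would not.\<close>

lemma (in prob_space) iid_frequency_deviation_tendsto_0:
  fixes X :: "nat \<Rightarrow> 'a \<Rightarrow> 'b::topological_space" and A :: "nat \<Rightarrow> 'b set" and \<kappa> :: real
  assumes indep: "indep_vars (\<lambda>_. borel) X UNIV" and distr: "\<And>i. distr M borel (X i) = m"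
    and A: "\<And>i. A i \<in> sets borel" and \<kappa>: "0 < \<kappa>"
  shows "(\<lambda>N. prob {\<omega> \<in> space M. \<exists>i<n. \<exists>k\<le>N. \<bar>\<Sum>j<k. indicator (A i) (X j \<omega>) - measure m (A i)\<bar> \<ge> \<kappa> * N})
    \<longlonglongrightarrow> 0"
proof (rule tendsto_sandwich[where f = "\<lambda>_. 0"])
  have X [measurable]: "random_variable borel (X i)" for i
    using indep by (simp add: indep_vars_def2)
  note [measurable] = A
  let ?D = "\<lambda>N i k. {\<omega> \<in> space M. \<bar>\<Sum>j<k. indicator (A i) (X j \<omega>) - measure m (A i)\<bar> \<ge> \<kappa> * real N}"
  let ?q = "exp (- (2 * \<kappa>\<^sup>2))"
  show "\<forall>\<^sub>F N in sequentially. prob {\<omega> \<in> space M. \<exists>i<n. \<exists>k\<le>N.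
      \<bar>\<Sum>j<k. indicator (A i) (X j \<omega>) - measure m (A i)\<bar> \<ge> \<kappa> * N} \<le> 2 * n * (N * ?q ^ N + ?q ^ N)"
  proof (rule eventually_sequentiallyI[of 1])
    fix N :: nat assume N: "1 \<le> N"
    have "{\<omega> \<in> space M. \<exists>i<n. \<exists>k\<le>N. \<bar>\<Sum>j<k. indicator (A i) (X j \<omega>) - measure m (A i)\<bar> \<ge> \<kappa> * N}
        = (\<Union>p\<in>{..<n} \<times> {..N}. ?D N (fst p) (snd p))"
      by (auto; blast)
    then have "prob {\<omega> \<in> space M. \<exists>i<n. \<exists>k\<le>N. \<bar>\<Sum>j<k. indicator (A i) (X j \<omega>) - measure m (A i)\<bar> \<ge> \<kappa> * N}
        = prob (\<Union>p\<in>{..<n} \<times> {..N}. ?D N (fst p) (snd p))"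
      by simp
    also have "\<dots> \<le> (\<Sum>p\<in>{..<n} \<times> {..N}. prob (?D N (fst p) (snd p)))"
      by (intro finite_measure_subadditive_finite) (auto simp: image_subset_iff)
    also have "\<dots> \<le> (\<Sum>p\<in>{..<n} \<times> {..N}. 2 * exp (- (2 * \<kappa>\<^sup>2) * N))"
      using N by (intro sum_mono iid_frequency_deviation[OF indep distr A \<kappa>]) auto
    also have "\<dots> = 2 * n * (N * ?q ^ N + ?q ^ N)"
      by (simp add: exp_of_nat_mult[symmetric] card_cartesian_product algebra_simps)
    finally show "prob {\<omega> \<in> space M. \<exists>i<n. \<exists>k\<le>N.
      \<bar>\<Sum>j<k. indicator (A i) (X j \<omega>) - measure m (A i)\<bar> \<ge> \<kappa> * N} \<le> 2 * n * (N * ?q ^ N + ?q ^ N)" .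
  qed
  have "norm ?q < 1" using \<kappa> by simp
  then have "(\<lambda>N. 2 * real n * (real N * ?q ^ N + ?q ^ N)) \<longlonglongrightarrow> 2 * real n * (0 + 0)"
    by (intro tendsto_mult tendsto_add tendsto_const powser_times_n_limit_0 LIMSEQ_power_zero)
  then show "(\<lambda>N. 2 * n * (N * ?q ^ N + ?q ^ N)) \<longlonglongrightarrow> 0" by simp
qed (auto intro!: always_eventually)

section \<open>Characteristic functions under a vanishing perturbation\<close>

lemma norm_iexp_diff_le: "norm (iexp (a + b) - iexp a) \<le> \<bar>b\<bar>" "norm (iexp (a + b) - iexp a) \<le> 2"
proof -
  have "iexp (a + b) - iexp a = iexp a * (iexp b - 1)"
    by (simp add: distrib_left exp_add right_diff_distrib)
  then have "norm (iexp (a + b) - iexp a) = norm (iexp b - 1)"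
    by (simp add: norm_mult)
  also have "\<dots> \<le> \<bar>b\<bar>"
    using iexp_approx1[of b 0] by simp
  finally show "norm (iexp (a + b) - iexp a) \<le> \<bar>b\<bar>" .
  show "norm (iexp (a + b) - iexp a) \<le> 2"
    using norm_triangle_ineq4[of "iexp (a + b)" "iexp a"] by simp
qed

lemma (in prob_space) char_perturbation:
  assumes [measurable]: "random_variable borel X" "random_variable borel Y" and "0 \<le> \<eta>"
  shows "norm (char (distr M borel (\<lambda>\<omega>. X \<omega> + Y \<omega>)) t - char (distr M borel X) t)
    \<le> \<bar>t\<bar> * \<eta> + 2 * prob {\<omega> \<in> space M. \<bar>Y \<omega>\<bar> > \<eta>}"
proof -
  let ?B = "{\<omega> \<in> space M. \<bar>Y \<omega>\<bar> > \<eta>}"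
  have char: "char (distr M borel Z) t = (CLINT \<omega>|M. iexp (t * Z \<omega>))"
    if [measurable]: "random_variable borel Z" for Z
    unfolding char_def by (subst integral_distr) auto
  have int: "integrable M (\<lambda>\<omega>. iexp (t * Z \<omega>))" if [measurable]: "random_variable borel Z" for Z
    by (rule integrable_const_bound[of _ 1]) auto
  have "char (distr M borel (\<lambda>\<omega>. X \<omega> + Y \<omega>)) t - char (distr M borel X) t
      = (CLINT \<omega>|M. iexp (t * (X \<omega> + Y \<omega>)) - iexp (t * X \<omega>))"
    using int[of X] int[of "\<lambda>\<omega>. X \<omega> + Y \<omega>"] by (simp add: char)
  also have "norm \<dots> \<le> (LINT \<omega>|M. norm (iexp (t * (X \<omega> + Y \<omega>)) - iexp (t * X \<omega>)))"
    by (rule integral_norm_bound)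
  also have "\<dots> \<le> (LINT \<omega>|M. \<bar>t\<bar> * \<eta> + 2 * indicator ?B \<omega>)"
  proof (rule integral_mono)
    show "integrable M (\<lambda>\<omega>. norm (iexp (t * (X \<omega> + Y \<omega>)) - iexp (t * X \<omega>)))"
      using int[of X] int[of "\<lambda>\<omega>. X \<omega> + Y \<omega>"] by (intro integrable_norm Bochner_Integration.integrable_diff) auto
    show "integrable M (\<lambda>\<omega>. \<bar>t\<bar> * \<eta> + 2 * indicator ?B \<omega>)"
      by (auto simp: emeasure_eq_measure)
    fix \<omega> assume \<omega>: "\<omega> \<in> space M"
    have "norm (iexp (t * (X \<omega> + Y \<omega>)) - iexp (t * X \<omega>)) \<le> min \<bar>t * Y \<omega>\<bar> 2"
      using norm_iexp_diff_le[of "t * X \<omega>" "t * Y \<omega>"] by (simp add: distrib_left)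
    also have "\<dots> \<le> \<bar>t\<bar> * \<eta> + 2 * indicator ?B \<omega>"
    proof (cases "\<bar>Y \<omega>\<bar> > \<eta>")
      case True
      then show ?thesis using \<omega> \<open>0 \<le> \<eta>\<close> by (simp add: min.coboundedI2)
    next
      case False
      then have "\<bar>t * Y \<omega>\<bar> \<le> \<bar>t\<bar> * \<eta>"
        unfolding abs_mult by (intro mult_left_mono) auto
      then show ?thesis using False by (simp add: min.coboundedI1)
    qed
    finally show "norm (iexp (t * (X \<omega> + Y \<omega>)) - iexp (t * X \<omega>)) \<le> \<bar>t\<bar> * \<eta> + 2 * indicator ?B \<omega>" .
  qed
  also have "\<dots> = \<bar>t\<bar> * \<eta> + 2 * prob ?B"
    by (simp add: emeasure_eq_measure prob_space)
  finally show ?thesis .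
qed

text \<open>The case of Slutsky's theorem needed here, by way of Levy's continuity theorem.\<close>

lemma (in prob_space) weak_conv_m_add_null:
  fixes X Y :: "nat \<Rightarrow> 'a \<Rightarrow> real"
  assumes X [measurable]: "\<And>n. random_variable borel (X n)" and Y [measurable]: "\<And>n. random_variable borel (Y n)"
    and \<mu>: "real_distribution \<mu>" and char: "\<And>t. (\<lambda>n. char (distr M borel (X n)) t) \<longlonglongrightarrow> char \<mu> t"
    and null: "\<And>\<eta>. 0 < \<eta> \<Longrightarrow> (\<lambda>n. prob {\<omega> \<in> space M. \<bar>Y n \<omega>\<bar> > \<eta>}) \<longlonglongrightarrow> 0"
  shows "weak_conv_m (\<lambda>n. distr M borel (\<lambda>\<omega>. X n \<omega> + Y n \<omega>)) \<mu>"
proof (rule levy_continuity[OF _ \<mu>])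
  show "real_distribution (distr M borel (\<lambda>\<omega>. X n \<omega> + Y n \<omega>))" for n
    by (rule real_distribution_distr) simp
  fix t
  have "(\<lambda>n. char (distr M borel (\<lambda>\<omega>. X n \<omega> + Y n \<omega>)) t - char (distr M borel (X n)) t) \<longlonglongrightarrow> 0"
  proof (rule LIMSEQ_I)
    fix e :: real assume e: "0 < e"
    \<comment> \<open>One half of e is for the term \<open>\<bar>t\<bar> * \<eta>\<close>, the other
      for twice a probability below e / 4; adding 1 in the denominator covers t = 0.\<close>
    define \<eta> where "\<eta> = e / (2 * (\<bar>t\<bar> + 1))"
    have \<eta>: "0 < \<eta>" using e by (auto simp: \<eta>_def intro!: divide_pos_pos)
    have "\<bar>t\<bar> * \<eta> = e / 2 * (\<bar>t\<bar> / (\<bar>t\<bar> + 1))"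
      by (simp add: \<eta>_def)
    also have "\<dots> \<le> e / 2"
      using e by (intro mult_left_le) auto
    finally have t\<eta>: "\<bar>t\<bar> * \<eta> \<le> e / 2" .
    have "0 < e / 4" using e by simp
    from LIMSEQ_D[OF null[OF \<eta>] this] obtain n0 where
      n0: "\<And>n. n \<ge> n0 \<Longrightarrow> prob {\<omega> \<in> space M. \<bar>Y n \<omega>\<bar> > \<eta>} < e / 4" by auto
    have "norm (char (distr M borel (\<lambda>\<omega>. X n \<omega> + Y n \<omega>)) t - char (distr M borel (X n)) t) < e" if "n \<ge> n0" for n
      using char_perturbation[OF X Y, of \<eta> n n t] \<eta> t\<eta> n0[OF that] by linarith
    then show "\<exists>n0. \<forall>n\<ge>n0. norm (char (distr M borel (\<lambda>\<omega>. X n \<omega> + Y n \<omega>)) t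
        - char (distr M borel (X n)) t - 0) < e"
      by auto
  qed
  from tendsto_add[OF this char[of t]]
  show "(\<lambda>n. char (distr M borel (\<lambda>\<omega>. X n \<omega> + Y n \<omega>)) t) \<longlonglongrightarrow> char \<mu> t" by simp
qed

section \<open>The Gaussian limit of the linear part\<close>

lemma real_distribution_centered_normal: "0 \<le> v \<Longrightarrow> real_distribution (centered_normal v)"
  by (auto simp: centered_normal_def real_distribution_def real_distribution_axioms_def
      intro!: prob_space_return prob_space_normal_density)

lemma char_centered_normal:
  assumes "0 \<le> v"
  shows "char (centered_normal v) t = char std_normal_distribution (sqrt v * t)"
proof (cases "v = 0")
  case True
  then show ?thesis
    by (simp add: centered_normal_def char_def integral_return char_std_normal_distribution)
next
  case False
  then have \<sigma>: "0 < sqrt v" using assms by simp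
  interpret prob_space std_normal_distribution
    by (rule prob_space_normal_density) simp
  have "distributed std_normal_distribution lborel (\<lambda>x. x) std_normal_density"
    by (auto simp: distributed_def intro!: distr_id2)
  from normal_density_affine[OF this, of "sqrt v" 0]
  have "distributed std_normal_distribution lborel (\<lambda>x. sqrt v * x) (normal_density 0 (sqrt v))"
    using \<sigma> by simp
  then have "density lborel (normal_density 0 (sqrt v)) = distr std_normal_distribution lborel (\<lambda>x. sqrt v * x)"
    by (simp add: distributed_def)
  also have "\<dots> = distr std_normal_distribution borel (\<lambda>x. sqrt v * x)"
    by (rule distr_cong) simp_all
  finally have "centered_normal v = distr std_normal_distribution borel (\<lambda>x. sqrt v * x)"
    using False by (simp add: centered_normal_def)
  then show ?thesis
    unfolding char_def by (simp only:) (subst integral_distr, auto simp: ac_simps)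
qed

text \<open>For variance 0 the variables are almost surely constant and the centred sums vanish.
  Otherwise the sums are standardised, and the factor \<open>sqrt v\<close> is restored by
  evaluating the characteristic function at \<open>sqrt v * t\<close>.\<close>

lemma (in prob_space) iid_char_tendsto_centered_normal:
  fixes X :: "nat \<Rightarrow> 'a \<Rightarrow> real"
  assumes indep: "indep_vars (\<lambda>_. borel) X UNIV" and distr: "\<And>i. distr M borel (X i) = \<mu>"
    and sq: "\<And>i. integrable M (\<lambda>\<omega>. (X i \<omega>)\<^sup>2)"
  shows "(\<lambda>n. char (distr M borel (\<lambda>\<omega>. (\<Sum>i<n. X i \<omega> - expectation (X 0)) / sqrt n)) t)
    \<longlonglongrightarrow> char (centered_normal (variance (X 0))) t"
proof -
  have X [measurable]: "random_variable borel (X i)" for i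
    using indep by (simp add: indep_vars_def2)
  have E: "expectation (\<lambda>\<omega>. g (X i \<omega>)) = expectation (\<lambda>\<omega>. g (X 0 \<omega>))"
    if [measurable]: "g \<in> borel_measurable borel" for g :: "real \<Rightarrow> real" and i
  proof -
    have "expectation (\<lambda>\<omega>. g (X j \<omega>)) = (LINT x|\<mu>. g x)" for j
      unfolding distr[of j, symmetric] by (intro integral_distr[symmetric]) auto
    then show ?thesis by simp
  qed
  define v where "v = variance (X 0)"
  have mean: "expectation (X i) = expectation (X 0)" for i
    using E[of "\<lambda>x. x" i] by simp
  have var: "variance (X i) = v" for i
    using E[of "\<lambda>x. (x - expectation (X 0))\<^sup>2" i] unfolding v_def mean[of i] by simp
  have v0: "0 \<le> v" by (simp add: v_def)
  show ?thesis
  proof (cases "v = 0")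
    case True
    have "AE \<omega> in M. X i \<omega> - expectation (X 0) = 0" for i
    proof -
      have int: "integrable M (X i)"
        by (rule square_integrable_imp_integrable[OF _ sq]) simp
      have "integrable M (\<lambda>\<omega>. (X i \<omega> - expectation (X 0))\<^sup>2)"
        unfolding power2_diff using int sq[of i] by simp
      moreover have "(LINT \<omega>|M. (X i \<omega> - expectation (X 0))\<^sup>2) = 0"
        using var[of i] True unfolding mean[of i] by simp
      ultimately have "AE \<omega> in M. (X i \<omega> - expectation (X 0))\<^sup>2 = 0"
        by (subst (asm) integral_nonneg_eq_0_iff_AE) auto
      then show ?thesis by simp
    qed
    then have AE0: "AE \<omega> in M. \<forall>i. X i \<omega> - expectation (X 0) = 0"
      by (simp add: AE_all_countable)
    have "char (distr M borel (\<lambda>\<omega>. (\<Sum>i<n. X i \<omega> - expectation (X 0)) / sqrt n)) t = 1" for n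
    proof -
      have "char (distr M borel (\<lambda>\<omega>. (\<Sum>i<n. X i \<omega> - expectation (X 0)) / sqrt n)) t
          = (CLINT \<omega>|M. iexp (t * ((\<Sum>i<n. X i \<omega> - expectation (X 0)) / sqrt n)))"
        unfolding char_def by (subst integral_distr) auto
      also have "\<dots> = (CLINT \<omega>|M. 1)"
        by (rule integral_cong_AE) (use AE0 in \<open>auto simp del: sum_subtractf elim!: eventually_mono\<close>)
      finally show ?thesis by (simp add: prob_space)
    qed
    moreover have "char (centered_normal v) t = 1"
      using True by (simp add: centered_normal_def char_def integral_return)
    ultimately show ?thesis by (simp add: v_def)
  next
    case False
    then have \<sigma>: "0 < sqrt v" using v0 by simp
    define S where "S n \<omega> = (\<Sum>i<n. X i \<omega> - expectation (X 0)) / sqrt (n * (sqrt v)\<^sup>2)" for n \<omega>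
    have "weak_conv_m (\<lambda>n. distr M borel (S n)) std_normal_distribution"
      unfolding S_def[abs_def]
      by (rule central_limit_theorem[OF indep mean \<sigma> sq _ distr]) (use var v0 in auto)
    then have "(\<lambda>n. char (distr M borel (S n)) (sqrt v * t)) \<longlonglongrightarrow> char std_normal_distribution (sqrt v * t)"
      by (intro levy_continuity1 real_dist_normal_dist real_distribution_distr) (auto simp: S_def[abs_def])
    moreover have "char (distr M borel (S n)) (sqrt v * t)
        = char (distr M borel (\<lambda>\<omega>. (\<Sum>i<n. X i \<omega> - expectation (X 0)) / sqrt n)) t" for n
    proof -
      have "sqrt v * t * S n \<omega> = t * ((\<Sum>i<n. X i \<omega> - expectation (X 0)) / sqrt n)" for \<omega>
        using \<sigma> v0 by (simp add: S_def real_sqrt_mult)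
      then show ?thesis
        unfolding char_def
        by (subst (1 2) integral_distr) (auto simp: S_def[abs_def] simp flip: of_real_mult)
    qed
    ultimately show ?thesis
      using char_centered_normal[OF v0, of t] by (simp add: v_def)
  qed
qed

subsection \<open>The central limit theorem for the functional\<close>

context lin_fun_deriv_near
begin

text \<open>A supremum of reals says something about individual x only if the values are bounded
  above; the growth hypothesis ensures this.\<close>

lemma deriv_close_near_m0:
  assumes cont: "\<exists>\<delta>>0. \<forall>\<mu>\<in>D_ball l m0 r. D l m0 \<mu> m0 < \<delta> \<longrightarrow>
      (SUP x. \<bar>dU \<mu> x - dU m0 x\<bar> / (1 + norm_pow x (l / 2))) < e"
  obtains \<delta> where "0 < \<delta>" "\<delta> \<le> r"
    "\<And>\<mu> x. \<mu> \<in> D_ball l m0 \<delta> \<Longrightarrow> \<bar>dU \<mu> x - dU m0 x\<bar> \<le> e * (1 + norm_pow x (l / 2))"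
proof -
  obtain \<delta> where \<delta>: "0 < \<delta>" "\<And>\<mu>. \<mu> \<in> D_ball l m0 r \<Longrightarrow> D l m0 \<mu> m0 < \<delta> \<Longrightarrow>
      (SUP x. \<bar>dU \<mu> x - dU m0 x\<bar> / (1 + norm_pow x (l / 2))) < e"
    using cont by blast
  show thesis
  proof (rule that[of "min \<delta> r"])
    fix \<mu> x assume "\<mu> \<in> D_ball l m0 (min \<delta> r)"
    then have \<mu>: "\<mu> \<in> D_ball l m0 r" "D l m0 \<mu> m0 < \<delta>"
      by (auto simp: D_ball_def)
    let ?w = "\<lambda>x :: 'a. 1 + norm_pow x (l / 2)"
    have w: "0 < ?w x" for x :: 'a
      by (simp add: add_pos_nonneg)
    have "\<bar>dU \<mu> x - dU m0 x\<bar> / ?w x \<le> 2 * Cg" for x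
    proof -
      have "\<bar>dU \<mu> x - dU m0 x\<bar> \<le> 2 * Cg * ?w x"
        using growth[OF \<mu>(1), of x] growth[OF m0_in_ball, of x] by linarith
      then show ?thesis using w[of x] by (simp add: divide_le_eq)
    qed
    then have "bdd_above (range (\<lambda>x. \<bar>dU \<mu> x - dU m0 x\<bar> / ?w x))"
      by (intro bdd_aboveI2)
    then have "\<bar>dU \<mu> x - dU m0 x\<bar> / ?w x \<le> (SUP x. \<bar>dU \<mu> x - dU m0 x\<bar> / ?w x)"
      by (intro cSUP_upper) auto
    then have "\<bar>dU \<mu> x - dU m0 x\<bar> / ?w x \<le> e"
      using \<delta>(2)[OF \<mu>] by linarith
    then show "\<bar>dU \<mu> x - dU m0 x\<bar> \<le> e * ?w x"
      using w[of x] by (simp add: divide_le_eq)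
  qed (use \<delta> r_pos in auto)
qed

text \<open>The probability \<epsilon> is spent in four quarters: the variance term of
  \<open>remainder_bound\<close>, its Hoelder term, a large deviation of some frequency, and a heavy
  tail of the sample. The first two come from Markov's inequality for \<open>soft_abs\<close> while
  all intermediate measures lie in Q.\<close>

lemma remainder_emp_tendsto_0:
  fixes M :: "'w measure" and \<zeta> :: "nat \<Rightarrow> 'w \<Rightarrow> 'a"
  assumes M: "prob_space M" and indep: "prob_space.indep_vars M (\<lambda>_. borel) \<zeta> UNIV"
    and distr: "\<And>i. distr M borel (\<zeta> i) = m0"
    and U_meas: "\<And>N. N \<ge> 1 \<Longrightarrow> (\<lambda>x. U (emp N x)) \<in> borel_measurable (\<Pi>\<^sub>M i\<in>{..<N}. borel)"
    and cont: "\<And>e. 0 < e \<Longrightarrow> \<exists>\<delta>>0. \<forall>\<mu>\<in>D_ball l m0 r. D l m0 \<mu> m0 < \<delta> \<longrightarrow>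
         (SUP x. \<bar>dU \<mu> x - dU m0 x\<bar> / (1 + norm_pow x (l / 2))) < e"
    and \<eta>: "0 < \<eta>"
  shows "(\<lambda>N. measure M {\<omega> \<in> space M. \<bar>sqrt N * remainder (emp N (\<lambda>i. \<zeta> i \<omega>))\<bar> > \<eta>}) \<longlonglongrightarrow> 0"
proof (rule LIMSEQ_I)
  interpret prob_space M by fact
  fix \<epsilon> :: real assume \<epsilon>: "0 < \<epsilon>"
  have \<zeta> [measurable]: "\<zeta> i \<in> borel_measurable M" for i
    using indep by (simp add: indep_vars_def2)
  define h where "h = soft_abs \<eta>"
  have h: "0 < h" using soft_abs_pos[of \<eta>] \<eta> by (simp add: h_def)
  define e where "e = sqrt (\<epsilon> * h / (8 * K0))"
  have e: "0 < e" "2 * e\<^sup>2 * K0 / h = \<epsilon> / 4"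
    using \<epsilon> h K0_ge_1 by (auto simp: e_def)
  obtain \<delta> where \<delta>: "0 < \<delta>" "\<delta> \<le> r"
    and close: "\<And>\<mu> x. \<mu> \<in> D_ball l m0 \<delta> \<Longrightarrow> \<bar>dU \<mu> x - dU m0 x\<bar> \<le> e * (1 + norm_pow x (l / 2))"
    using deriv_close_near_m0[OF cont[OF e(1)]] by metis
  obtain \<theta> where \<theta>: "0 < \<theta>" and nbhd: "\<And>\<eta>. 0 < \<eta> \<Longrightarrow> \<exists>(A :: nat \<Rightarrow> 'a set) n \<kappa>. 0 < \<kappa> \<and> (\<forall>k. A k \<in> sets borel) \<and>
     (LINT x|m0. (1 + norm_pow x l) * indicator (- (\<Union>k<n. A k)) x) < \<eta> \<and>
     (\<forall>\<mu>\<in>prob_moment l. (\<forall>k<n. \<bar>measure \<mu> (A k) - measure m0 (A k)\<bar> \<le> \<kappa>) \<longrightarrow>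
        (LINT x|\<mu>. (1 + norm_pow x l) * indicator (- (\<Union>k<n. A k)) x) \<le> \<theta> \<longrightarrow> D l m0 \<mu> m0 < \<delta>)"
    by (rule D_neighbourhood[OF l_nonneg m0 \<delta>(1)]) (rule that)
  \<comment> \<open>The bound \<theta> / 2 reserves half of the allowed tail for the components
    still equal to \<open>m0\<close>. The bound \<theta> \<epsilon> / 8 makes Markov's inequality
    yield \<epsilon> / 4 for the sampled components.\<close>
  define \<eta>' where "\<eta>' = min (\<theta> / 2) (\<theta> * \<epsilon> / 8)"
  have "0 < \<eta>'" using \<theta> \<epsilon> by (simp add: \<eta>'_def)
  from nbhd[OF this] obtain A :: "nat \<Rightarrow> 'a set" and n \<kappa> where \<kappa>: "0 < \<kappa>" and A [measurable]: "\<And>k. A k \<in> sets borel"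
    and tail: "(LINT x|m0. (1 + norm_pow x l) * indicator (- (\<Union>k<n. A k)) x) < \<eta>'"
    and near: "\<And>\<mu>. \<mu> \<in> prob_moment l \<Longrightarrow> \<forall>k<n. \<bar>measure \<mu> (A k) - measure m0 (A k)\<bar> \<le> \<kappa> \<Longrightarrow>
        (LINT x|\<mu>. (1 + norm_pow x l) * indicator (- (\<Union>k<n. A k)) x) \<le> \<theta> \<Longrightarrow> D l m0 \<mu> m0 < \<delta>"
    by blast
  define gT where "gT x = weight x * indicator (- (\<Union>k<n. A k)) x" for x
  have gT_meas [measurable]: "gT \<in> borel_measurable borel" unfolding gT_def[abs_def] by measurable
  have gT_nonneg: "0 \<le> gT x" for x using weight_nonneg[of x] by (simp add: gT_def)
  have gT_int: "integrable \<mu> gT" if "\<mu> \<in> prob_moment l" for \<mu>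
    by (rule prob_moment_integrable[OF that gT_meas, of 1]) (auto simp: gT_def weight_def indicator_def)
  define a where "a = (LINT x|m0. gT x)"
  have a: "0 \<le> a" "a < \<theta> / 2" "a < \<theta> * \<epsilon> / 8"
    using tail gT_nonneg by (auto simp: a_def gT_def weight_def \<eta>'_def)
  define Q where "Q = {\<mu> \<in> prob_moment l. (\<forall>i<n. \<bar>measure \<mu> (A i) - measure m0 (A i)\<bar> \<le> \<kappa>) \<and> (LINT x|\<mu>. gT x) \<le> \<theta>}"
  have Q_ball: "Q \<subseteq> D_ball l m0 \<delta>"
    using near by (auto simp: Q_def D_ball_def gT_def weight_def)
  have Q_convex: "mixture s \<mu> \<nu> \<in> Q" if "\<mu> \<in> Q" "\<nu> \<in> Q" "0 \<le> s" "s \<le> 1" for s \<mu> \<nu>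
  proof -
    have \<mu>: "\<mu> \<in> prob_moment l" and \<nu>: "\<nu> \<in> prob_moment l" using that by (auto simp: Q_def)
    note \<mu>\<nu> = prob_momentD[OF \<mu>] prob_momentD[OF \<nu>]
    have "\<bar>measure (mixture s \<mu> \<nu>) (A i) - measure m0 (A i)\<bar> \<le> \<kappa>" if i: "i < n" for i
    proof -
      have "measure (mixture s \<mu> \<nu>) (A i) - measure m0 (A i)
          = (1 - s) * (measure \<mu> (A i) - measure m0 (A i)) + s * (measure \<nu> (A i) - measure m0 (A i))"
        using that \<mu>\<nu> \<open>0 \<le> s\<close> \<open>s \<le> 1\<close> by (simp add: measure_mixture algebra_simps)
      also have "\<bar>\<dots>\<bar> \<le> (1 - s) * \<kappa> + s * \<kappa>"
        using \<open>\<mu> \<in> Q\<close> \<open>\<nu> \<in> Q\<close> i \<open>0 \<le> s\<close> \<open>s \<le> 1\<close>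
        by (intro order_trans[OF abs_triangle_ineq] add_mono) (auto simp: abs_mult Q_def intro!: mult_left_mono)
      finally show ?thesis by (simp add: algebra_simps)
    qed
    moreover have "(LINT x|mixture s \<mu> \<nu>. gT x) \<le> (1 - s) * \<theta> + s * \<theta>"
      using that \<mu>\<nu> gT_int[OF \<mu>] gT_int[OF \<nu>]
      by (subst integral_mixture) (auto simp: Q_def intro!: add_mono mult_left_mono)
    ultimately show ?thesis
      using that \<mu> \<nu> by (simp add: Q_def prob_moment_mixture algebra_simps)
  qed
  define dev where "dev i j x = (\<Sum>p<j. indicator (A i) (x p) - measure m0 (A i))" for i j and x :: "nat \<Rightarrow> 'a"
  \<comment> \<open>In terms of the samples, membership in Q only involves finite sums of measurable
    functions, so it is a measurable event even where \<open>U\<close> at intermediate measures is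
    not known to be measurable.\<close>
  have Q_iff: "mixed_emp m0 N j x \<in> Q \<longleftrightarrow>
      (\<forall>i<n. \<bar>dev i j x\<bar> \<le> \<kappa> * N) \<and> (\<Sum>p<j. gT (x p)) + (real N - real j) * a \<le> \<theta> * N"
    if N: "1 \<le> N" and j: "j \<le> N" for N j x
  proof -
    interpret m0: prob_space m0 using prob_momentD[OF m0] by simp
    have mu: "mixed_emp m0 N j x \<in> prob_moment l" by (rule prob_moment_mixed_emp[OF m0 N])
    have "measure (mixed_emp m0 N j x) (A i) - measure m0 (A i) = dev i j x / N" for i
    proof -
      have int: "integrable m0 (indicat_real (A i))"
        using prob_momentD(1)[OF m0] A by (simp add: m0.emeasure_eq_measure)
      have "measure (mixed_emp m0 N j x) (A i) = (LINT y|mixed_emp m0 N j x. indicat_real (A i) y)"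
        using prob_momentD(4)[OF mu] by simp
      also have "\<dots> = ((\<Sum>p<j. indicator (A i) (x p)) + (real N - real j) * measure m0 (A i)) / N"
        using prob_momentD(4)[OF m0] A int by (subst integral_mixed_emp[OF m0 j]) auto
      finally show ?thesis
        using N by (simp add: dev_def sum_subtractf field_simps)
    qed
    moreover have "\<bar>d / N\<bar> \<le> \<kappa> \<longleftrightarrow> \<bar>d\<bar> \<le> \<kappa> * N" for d
      using N by (simp add: abs_divide divide_le_eq)
    moreover have "(LINT y|mixed_emp m0 N j x. gT y) = ((\<Sum>p<j. gT (x p)) + (real N - real j) * a) / N"
      unfolding a_def by (rule integral_mixed_emp[OF m0 j gT_meas gT_int[OF m0]])
    ultimately show ?thesis
      using mu N by (simp add: Q_def divide_le_eq)
  qed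
  let ?x = "\<lambda>N \<omega>. \<lambda>i\<in>{..<N}. \<zeta> i \<omega>"
  let ?bad = "\<lambda>N. {\<omega> \<in> space M. \<exists>i<n. \<exists>k\<le>N. \<bar>\<Sum>j<k. indicator (A i) (\<zeta> j \<omega>) - measure m0 (A i)\<bar> \<ge> \<kappa> * real N}"
  let ?heavy = "\<lambda>N. {\<omega> \<in> space M. (\<Sum>p<N. gT (\<zeta> p \<omega>)) \<ge> \<theta> / 2 * real N}"
  let ?far = "\<lambda>N. {\<omega> \<in> space M. \<bar>sqrt (real N) * remainder (emp N (\<lambda>i. \<zeta> i \<omega>))\<bar> > \<eta>}"
  have bad: "(\<lambda>N. prob (?bad N)) \<longlonglongrightarrow> 0"
    by (rule iid_frequency_deviation_tendsto_0[OF indep distr A \<kappa>])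
  have rate: "(\<lambda>N. K * K0 / h * (real N powr (1 / 2 - \<alpha>))) \<longlonglongrightarrow> 0"
  proof -
    have "(\<lambda>N. real N powr - (\<alpha> - 1 / 2)) \<longlonglongrightarrow> 0"
      using \<alpha> by (intro tendsto_neg_powr filterlim_real_sequentially) auto
    from tendsto_mult_left[OF this, of "K * K0 / h"] show ?thesis by simp
  qed
  have "0 < \<epsilon> / 4" using \<epsilon> by simp
  then have "\<forall>\<^sub>F N in sequentially. prob (?bad N) < \<epsilon> / 4 \<and> K * K0 / h * (real N powr (1 / 2 - \<alpha>)) < \<epsilon> / 4 \<and> 1 \<le> N"
    by (intro eventually_conj eventually_ge_at_top order_tendstoD(2)[OF bad] order_tendstoD(2)[OF rate])
  then obtain n0 where n0: "\<And>N. n0 \<le> N \<Longrightarrow> prob (?bad N) < \<epsilon> / 4"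
    "\<And>N. n0 \<le> N \<Longrightarrow> K * K0 / h * (real N powr (1 / 2 - \<alpha>)) < \<epsilon> / 4" "\<And>N. n0 \<le> N \<Longrightarrow> 1 \<le> N"
    unfolding eventually_sequentially by auto
  have "prob (?far N) < \<epsilon>" if "n0 \<le> N" for N
  proof -
    have N: "1 \<le> N" using n0(3)[OF that] .
    define PP where "PP = Pi\<^sub>M {..<N} (\<lambda>_. m0)"
    have sets_PP: "sets PP = sets (\<Pi>\<^sub>M i\<in>{..<N}. borel)"
      unfolding PP_def using prob_momentD(1)[OF m0] by (intro sets_PiM_cong) auto
    note [measurable_cong] = sets_PP
    have distr_x: "distr M (\<Pi>\<^sub>M i\<in>{..<N}. borel) (?x N) = PP"
    proof -
      have "indep_vars (\<lambda>_. borel) \<zeta> {..<N}"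
        by (rule indep_vars_subset[OF indep]) auto
      moreover have "{..<N} \<noteq> {}" using N by (simp add: lessThan_empty_iff)
      ultimately show ?thesis
        using indep_vars_iff_distr_eq_PiM[where I="{..<N}" and M'="\<lambda>_. borel" and X=\<zeta>] \<zeta> by (simp add: distr PP_def)
    qed
    have x_meas: "?x N \<in> M \<rightarrow>\<^sub>M (\<Pi>\<^sub>M i\<in>{..<N}. borel)"
      by measurable
    have emp_x: "emp N (?x N \<omega>) = emp N (\<lambda>i. \<zeta> i \<omega>)" for \<omega>
      by (rule emp_restrict)
    have rem_eq: "remainder (emp N x) = U (emp N x) - U m0 - ((\<Sum>i<N. dU m0 (x i)) / N - (LINT y|m0. dU m0 y))" for x
    proof -
      have "(LINT y|emp N x. dU m0 y) = (\<Sum>i<N. dU m0 (x i)) / N"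
        unfolding emp_eq_mixed_emp[OF N, of _ m0]
        using integral_mixed_emp[OF m0 order_refl dU_measurable[OF m0_in_ball] dU_integrable[OF m0_in_ball m0]] by simp
      then show ?thesis by (simp add: remainder_def)
    qed
    note [measurable] = dU_measurable[OF m0_in_ball] U_meas[OF N]
    have comp [measurable]: "(\<lambda>x. x i) \<in> borel_measurable (\<Pi>\<^sub>M i\<in>{..<N}. borel :: 'a measure)" if "i < N" for i
      using that by (intro measurable_component_singleton) auto
    have sum_meas: "(\<lambda>x. \<Sum>p<j. g (x p)) \<in> borel_measurable (\<Pi>\<^sub>M i\<in>{..<N}. borel :: 'a measure)"
      if "j \<le> N" "g \<in> borel_measurable borel" for j and g :: "'a \<Rightarrow> real"
      using that by (intro borel_measurable_sum measurable_compose[OF comp]) auto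
    have rem_meas [measurable]: "(\<lambda>x. remainder (emp N x)) \<in> borel_measurable (\<Pi>\<^sub>M i\<in>{..<N}. borel)"
      unfolding rem_eq using sum_meas[OF order_refl dU_measurable[OF m0_in_ball]] by measurable
    define G where "G = {x \<in> space (\<Pi>\<^sub>M i\<in>{..<N}. borel :: 'a measure). \<forall>j\<in>{..N}.
       (\<forall>i\<in>{..<n}. \<bar>dev i j x\<bar> \<le> \<kappa> * N) \<and> (\<Sum>p<j. gT (x p)) + (real N - real j) * a \<le> \<theta> * N}"
    have G_meas [measurable]: "G \<in> sets (\<Pi>\<^sub>M i\<in>{..<N}. borel)"
      unfolding G_def
    proof (intro sets.sets_Collect_finite_All sets.sets_Collect_conj borel_measurable_le finite_atMost finite_lessThan)
      show "(\<lambda>x. \<bar>dev i j x\<bar>) \<in> borel_measurable (\<Pi>\<^sub>M i\<in>{..<N}. borel)" if "j \<in> {..N}" for i j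
        unfolding dev_def using that by (intro borel_measurable_abs sum_meas) auto
      show "(\<lambda>x. (\<Sum>p<j. gT (x p)) + (real N - real j) * a) \<in> borel_measurable (\<Pi>\<^sub>M i\<in>{..<N}. borel)"
        if "j \<in> {..N}" for j
        using that by (intro borel_measurable_add sum_meas borel_measurable_const gT_meas) auto
    qed auto
    have G_iff: "x \<in> G \<longleftrightarrow> x \<in> space (\<Pi>\<^sub>M i\<in>{..<N}. borel :: 'a measure) \<and> (\<forall>j\<le>N. mixed_emp m0 N j x \<in> Q)" for x
      unfolding G_def using Q_iff[OF N] by auto
    define f where "f x = indicator G x * ennreal (soft_abs (sqrt N * remainder (emp N x)))" for x
    have f_meas [measurable]: "f \<in> borel_measurable (\<Pi>\<^sub>M i\<in>{..<N}. borel)"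
      unfolding f_def[abs_def] soft_abs_def by measurable
    have f_le: "(\<integral>\<^sup>+x. f x \<partial>PP) \<le> ennreal (2 * e\<^sup>2 * K0 + K * K0 * sqrt N * (1 / N) powr \<alpha>)"
      unfolding PP_def
    proof (rule remainder_bound[OF N \<delta>(2) _ close Q_convex Q_ball])
      show "f \<in> borel_measurable (Pi\<^sub>M {..<N} (\<lambda>_. m0))"
        using f_meas sets_PP unfolding PP_def by (simp cong: measurable_cong_sets)
      show "f x \<le> (if \<forall>j\<le>N. mixed_emp m0 N j x \<in> Q
         then ennreal (soft_abs (sqrt N * remainder (mixed_emp m0 N N x))) else 0)" for x
        by (simp add: f_def G_iff emp_eq_mixed_emp[OF N, of _ m0] indicator_def)
    qed (use e in auto)
    let ?E = "{\<omega> \<in> space M. ?x N \<omega> \<in> G}"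
    have far_meas [measurable]: "?far N \<in> sets M"
    proof -
      have "(\<lambda>\<omega>. remainder (emp N (\<lambda>i. \<zeta> i \<omega>))) \<in> borel_measurable M"
        using measurable_compose[OF x_meas rem_meas] by (simp add: emp_x)
      then show ?thesis by measurable
    qed
    have E_meas [measurable]: "?E \<in> sets M"
      using measurable_sets[OF x_meas G_meas] by (simp add: vimage_def Int_def conj_commute)
    have bad_meas [measurable]: "?bad N \<in> sets M" and heavy_meas [measurable]: "?heavy N \<in> sets M"
      by measurable
    \<comment> \<open>Markov's inequality: on the event \<open>?far N\<close>,
      \<open>soft_abs\<close> of the scaled remainder is at least h. The integral is then
      transported to the product space, where the iterated estimate lives.\<close>
    have "ennreal h * emeasure M (?far N \<inter> ?E) = (\<integral>\<^sup>+\<omega>. ennreal h * indicator (?far N \<inter> ?E) \<omega> \<partial>M)"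
      by (intro nn_integral_cmult_indicator[symmetric]) measurable
    also have "\<dots> \<le> (\<integral>\<^sup>+\<omega>. f (?x N \<omega>) \<partial>M)"
    proof (intro nn_integral_mono)
      fix \<omega> assume "\<omega> \<in> space M"
      show "ennreal h * indicator (?far N \<inter> ?E) \<omega> \<le> f (?x N \<omega>)"
      proof (cases "\<omega> \<in> ?far N \<inter> ?E")
        case True
        then have "h \<le> soft_abs (sqrt N * remainder (emp N (\<lambda>i. \<zeta> i \<omega>)))"
          unfolding h_def using \<eta> by (intro soft_abs_mono) auto
        then show ?thesis using True by (simp add: f_def emp_x ennreal_leI del: restrict_apply)
      qed simp
    qed
    also have "\<dots> = (\<integral>\<^sup>+x. f x \<partial>distr M (\<Pi>\<^sub>M i\<in>{..<N}. borel) (?x N))"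
      by (rule nn_integral_distr[OF x_meas, symmetric]) simp
    also have "\<dots> \<le> ennreal (2 * e\<^sup>2 * K0 + K * K0 * sqrt N * (1 / N) powr \<alpha>)"
      unfolding distr_x by (rule f_le)
    finally have far_E: "ennreal h * emeasure M (?far N \<inter> ?E)
        \<le> ennreal (2 * e\<^sup>2 * K0 + K * K0 * sqrt N * (1 / N) powr \<alpha>)" .
    have "h * prob (?far N \<inter> ?E) \<le> 2 * e\<^sup>2 * K0 + K * K0 * sqrt N * (1 / N) powr \<alpha>"
    proof -
      have "0 \<le> 2 * e\<^sup>2 * K0 + K * K0 * sqrt N * (1 / N) powr \<alpha>"
        using K_nonneg K0_ge_1 by simp
      then show ?thesis
        using far_E h by (simp add: emeasure_eq_measure ennreal_mult[symmetric] del: ennreal_plus)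
    qed
    then have "prob (?far N \<inter> ?E) \<le> (2 * e\<^sup>2 * K0 + K * K0 * (sqrt N * (1 / N) powr \<alpha>)) / h"
      using h by (simp add: pos_le_divide_eq mult.commute mult.left_commute)
    also have "\<dots> = \<epsilon> / 4 + K * K0 / h * (real N powr (1 / 2 - \<alpha>))"
    proof -
      have "sqrt N * (1 / N) powr \<alpha> = real N powr (1 / 2 - \<alpha>)"
        using N by (simp add: powr_divide powr_diff powr_half_sqrt)
      then show ?thesis using e(2) by (simp add: add_divide_distrib)
    qed
    finally have p1: "prob (?far N \<inter> ?E) < \<epsilon> / 4 + \<epsilon> / 4"
      using n0(2)[OF that] by linarith
    have p2: "prob (?heavy N) \<le> \<epsilon> / 4"
    proof -
      have sum_int: "integrable M (\<lambda>\<omega>. \<Sum>p<N. gT (\<zeta> p \<omega>))" "(LINT \<omega>|M. (\<Sum>p<N. gT (\<zeta> p \<omega>))) = N * a"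
      proof -
        have int: "integrable M (\<lambda>\<omega>. gT (\<zeta> p \<omega>))" for p
          using gT_int[OF m0] integrable_distr_eq[of "\<zeta> p" M borel gT] by (simp add: distr)
        have "(LINT \<omega>|M. gT (\<zeta> p \<omega>)) = a" for p
          using integral_distr[of "\<zeta> p" M borel gT] by (simp add: distr a_def)
        then show "integrable M (\<lambda>\<omega>. \<Sum>p<N. gT (\<zeta> p \<omega>))" "(LINT \<omega>|M. (\<Sum>p<N. gT (\<zeta> p \<omega>))) = N * a"
          using int by (simp_all add: Bochner_Integration.integral_sum)
      qed
      have c: "0 < \<theta> / 2 * N" using \<theta> N by simp
      have "prob (?heavy N) \<le> (LINT \<omega>|M. (\<Sum>p<N. gT (\<zeta> p \<omega>))) / (\<theta> / 2 * N)"
        by (rule integral_Markov_inequality_measure[OF sum_int(1) _ _ c, where A="{}"])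
          (use gT_nonneg in \<open>auto intro!: sum_nonneg\<close>)
      also have "\<dots> = 2 * a / \<theta>"
        unfolding sum_int(2) using N by simp
      also have "\<dots> \<le> \<epsilon> / 4"
        using a(3) \<theta> by (simp add: divide_le_eq mult.commute)
      finally show ?thesis .
    qed
    \<comment> \<open>Outside of \<open>?bad N\<close> and \<open>?heavy N\<close> all intermediate
      measures lie in Q. For the tail one event at time N is enough: the partial sums increase with
      j and stay below \<theta> N / 2, and the \<open>m0\<close> components add at most \<theta> N /
      2.\<close>
    have "?far N \<subseteq> (?far N \<inter> ?E) \<union> (?bad N \<union> ?heavy N)"
    proof
      fix \<omega> assume \<omega>: "\<omega> \<in> ?far N"
      show "\<omega> \<in> (?far N \<inter> ?E) \<union> (?bad N \<union> ?heavy N)"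
      proof (cases "\<omega> \<in> ?bad N \<union> ?heavy N")
        case False
        have dev_x: "dev i j (?x N \<omega>) = (\<Sum>p<j. indicator (A i) (\<zeta> p \<omega>) - measure m0 (A i))" if "j \<le> N" for i j
          unfolding dev_def using that by (intro sum.cong) auto
        have gT_x: "(\<Sum>p<j. gT (?x N \<omega> p)) = (\<Sum>p<j. gT (\<zeta> p \<omega>))" if "j \<le> N" for j
          using that by (intro sum.cong) auto
        have "\<bar>dev i j (?x N \<omega>)\<bar> \<le> \<kappa> * N" if "i < n" "j \<le> N" for i j
        proof -
          have "\<not> \<kappa> * N \<le> \<bar>\<Sum>p<j. indicator (A i) (\<zeta> p \<omega>) - measure m0 (A i)\<bar>"
            using False \<omega> that by blast
          then show ?thesis unfolding dev_x[OF that(2)] by linarith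
        qed
        moreover have "(\<Sum>p<j. gT (?x N \<omega> p)) + (real N - real j) * a \<le> \<theta> * N" if j: "j \<le> N" for j
        proof -
          have "(\<Sum>p<j. gT (\<zeta> p \<omega>)) \<le> (\<Sum>p<N. gT (\<zeta> p \<omega>))"
            using j gT_nonneg by (intro sum_mono2) auto
          moreover have "(\<Sum>p<N. gT (\<zeta> p \<omega>)) < \<theta> / 2 * N"
            using False \<omega> by (simp add: not_le)
          moreover have "(real N - real j) * a \<le> real N * (\<theta> / 2)"
            using a j by (intro mult_mono) auto
          ultimately show ?thesis
            unfolding gT_x[OF j] by (simp add: mult.commute)
        qed
        moreover have "?x N \<omega> \<in> space (\<Pi>\<^sub>M i\<in>{..<N}. borel :: 'a measure)"
          using measurable_space[OF x_meas] \<omega> by blast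
        ultimately have "?x N \<omega> \<in> G"
          unfolding G_def by blast
        then show ?thesis using \<omega> by blast
      qed blast
    qed
    then have "prob (?far N) \<le> prob ((?far N \<inter> ?E) \<union> (?bad N \<union> ?heavy N))"
      by (intro finite_measure_mono) measurable
    also have "\<dots> \<le> prob (?far N \<inter> ?E) + prob (?bad N \<union> ?heavy N)"
      by (intro measure_Un_le) measurable
    also have "prob (?bad N \<union> ?heavy N) \<le> prob (?bad N) + prob (?heavy N)"
      by (intro measure_Un_le) measurable
    finally show ?thesis
      using p1 p2 n0(1)[OF that] by linarith
  qed
  then show "\<exists>n0. \<forall>N\<ge>n0. norm (prob (?far N) - 0) < \<epsilon>"
    by auto
qed

end

section \<open>Combining the Gaussian linear part with the vanishing remainder\<close>

theorem theorem3p1: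
  fixes l :: real
    and m0 :: "'a::euclidean_space measure"
    and M :: "'w measure"
    and \<zeta> :: "nat \<Rightarrow> 'w \<Rightarrow> 'a"
    and U :: "'a measure \<Rightarrow> real"
    and dU :: "'a measure \<Rightarrow> 'a \<Rightarrow> real"
    and r :: real
  assumes "l \<ge> 0"
    and "m0 \<in> prob_moment l"
    and "prob_space M"
    and "prob_space.indep_vars M (\<lambda>_. borel) \<zeta> UNIV"
    and "\<And>i. distr M borel (\<zeta> i) = m0"
    and U_measurable:
      "\<And>N. N \<ge> 1 \<Longrightarrow> (\<lambda>x. U (emp N x)) \<in> borel_measurable (\<Pi>\<^sub>M i\<in>{..<N}. borel)"
    and "r > 0"
    and deriv: "\<And>\<mu>. \<mu> \<in> D_ball l m0 r \<Longrightarrow> has_lin_fun_deriv l U \<mu> (dU \<mu>)"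
    and growth: "\<exists>C. \<forall>\<mu>\<in>D_ball l m0 r. \<forall>x. \<bar>dU \<mu> x\<bar> \<le> C * (1 + norm_pow x (l / 2))"
    and hoelder:
      "\<exists>\<alpha> C. 1/2 < \<alpha> \<and> \<alpha> \<le> 1 \<and>
         (\<forall>\<mu>1\<in>D_ball l m0 r. \<forall>\<mu>2\<in>D_ball l m0 r. \<forall>x.
            \<bar>dU \<mu>2 x - dU \<mu>1 x\<bar> \<le>
              C * ((1 + norm_pow x l) * W0 \<mu>2 \<mu>1 powr \<alpha>
                   + (1 + norm_pow x (l * (1 - \<alpha>)))
                       * (LINT y|tv_measure \<mu>2 \<mu>1. norm_pow y l) powr \<alpha>))"
    and cont:
      "\<forall>e>0. \<exists>\<delta>>0. \<forall>\<mu>\<in>D_ball l m0 r. D l m0 \<mu> m0 < \<delta> \<longrightarrow>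
         (SUP x. \<bar>dU \<mu> x - dU m0 x\<bar> / (1 + norm_pow x (l / 2))) < e"
  shows "weak_conv_m
           (\<lambda>N. distr M borel (\<lambda>\<omega>. sqrt (real N) * (U (emp N (\<lambda>i. \<zeta> i \<omega>)) - U m0)))
           (centered_normal (prob_space.variance M (\<lambda>\<omega>. dU m0 (\<zeta> 0 \<omega>))))"
proof -
  interpret prob_space M by fact
  obtain Cg where Cg: "\<And>\<mu> x. \<mu> \<in> D_ball l m0 r \<Longrightarrow> \<bar>dU \<mu> x\<bar> \<le> Cg * (1 + norm_pow x (l / 2))"
    using growth by blast
  obtain \<alpha> C where \<alpha>: "1/2 < \<alpha>" "\<alpha> \<le> 1"
    and C: "\<And>\<mu>1 \<mu>2 x. \<mu>1 \<in> D_ball l m0 r \<Longrightarrow> \<mu>2 \<in> D_ball l m0 r \<Longrightarrow>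
       \<bar>dU \<mu>2 x - dU \<mu>1 x\<bar> \<le> C * ((1 + norm_pow x l) * W0 \<mu>2 \<mu>1 powr \<alpha>
          + (1 + norm_pow x (l * (1 - \<alpha>))) * (LINT y|tv_measure \<mu>2 \<mu>1. norm_pow y l) powr \<alpha>)"
    using hoelder by blast
  \<comment> \<open>The Hoelder hypothesis does not state the sign of its constant, hence the
    maximum with 0.\<close>
  interpret near: lin_fun_deriv_near l m0 U dU r Cg \<alpha> "max C 0"
  proof
    fix \<mu>1 \<mu>2 x assume "\<mu>1 \<in> D_ball l m0 r" "\<mu>2 \<in> D_ball l m0 r"
    from C[OF this, of x]
    show "\<bar>dU \<mu>2 x - dU \<mu>1 x\<bar> \<le> max C 0 * ((1 + norm_pow x l) * W0 \<mu>2 \<mu>1 powr \<alpha>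
          + (1 + norm_pow x (l * (1 - \<alpha>))) * (LINT y|tv_measure \<mu>2 \<mu>1. norm_pow y l) powr \<alpha>)"
      by (rule order_trans) (intro mult_right_mono add_nonneg_nonneg mult_nonneg_nonneg; simp)
  qed (use assms(1,2,7) deriv Cg \<alpha> in auto)
  define f where "f = dU m0"
  have f_meas [measurable]: "f \<in> borel_measurable borel"
    unfolding f_def by (rule near.dU_measurable[OF near.m0_in_ball])
  have \<zeta> [measurable]: "\<zeta> i \<in> borel_measurable M" for i
    using assms(4) by (simp add: indep_vars_def2)
  have f_sq: "integrable m0 (\<lambda>x. (f x)\<^sup>2)"
  proof (rule prob_moment_integrable[OF assms(2), of _ "4 * Cg\<^sup>2"])
    show "\<bar>(f x)\<^sup>2\<bar> \<le> 4 * Cg\<^sup>2 * (1 + norm_pow x l)" for x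
    proof -
      have "(f x)\<^sup>2 \<le> (Cg * (1 + norm_pow x (l / 2)))\<^sup>2"
        using Cg[OF near.m0_in_ball, of x] unfolding f_def
        by (intro abs_le_square_iff[THEN iffD1]) linarith
      also have "\<dots> \<le> Cg\<^sup>2 * (4 * (1 + norm_pow x l))"
        unfolding power_mult_distrib using weight_half_sq_le[OF assms(1), of x] by (intro mult_left_mono) auto
      finally show ?thesis by (simp add: algebra_simps)
    qed
  qed measurable
  define X where "X i \<omega> = f (\<zeta> i \<omega>)" for i \<omega>
  have X_indep: "indep_vars (\<lambda>_. borel) X UNIV"
    unfolding X_def[abs_def] by (rule indep_vars_compose2[OF assms(4)]) simp
  have X_distr: "distr M borel (X i) = distr m0 borel f" for i
    unfolding assms(5)[of i, symmetric] X_def[abs_def] by (subst distr_distr) (auto simp: comp_def)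
  have X_sq: "integrable M (\<lambda>\<omega>. (X i \<omega>)\<^sup>2)" for i
    using f_sq integrable_distr_eq[of "\<zeta> i" M borel "\<lambda>x. (f x)\<^sup>2"] by (simp add: assms(5) X_def)
  have EX: "expectation (X 0) = (LINT y|m0. f y)"
    using integral_distr[of "\<zeta> 0" M borel f] by (simp add: assms(5) X_def[abs_def])
  define S where "S N \<omega> = (\<Sum>i<N. X i \<omega> - expectation (X 0)) / sqrt N" for N \<omega>
  define Y where "Y N \<omega> = sqrt N * near.remainder (emp N (\<lambda>i. \<zeta> i \<omega>))" for N \<omega>
  have split: "sqrt (real N) * (U (emp N (\<lambda>i. \<zeta> i \<omega>)) - U m0) = S N \<omega> + Y N \<omega>" for N \<omega>
  \<comment> \<open>For N = 0 there is no empirical measure, but the factor \<open>sqrt 0\<close>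
    and the division by it make every term 0.\<close>
  proof (cases "N = 0")
    case False
    then have N: "1 \<le> N" by simp
    have "(LINT y|emp N (\<lambda>i. \<zeta> i \<omega>). f y) = (\<Sum>i<N. X i \<omega>) / N"
      unfolding emp_eq_mixed_emp[OF N, of _ m0] f_def X_def
      using integral_mixed_emp[OF assms(2) order_refl near.dU_measurable[OF near.m0_in_ball]
          near.dU_integrable[OF near.m0_in_ball assms(2)], of N] by simp
    moreover have "S N \<omega> = sqrt N * ((\<Sum>i<N. X i \<omega>) / N - expectation (X 0))"
    proof -
      have "t / a = a * (t / (a * a))" if "0 < a" for a t :: real using that by simp
      from this[of "sqrt N"] False show ?thesis
        by (simp add: S_def sum_subtractf diff_divide_distrib right_diff_distrib)
    qed
    ultimately show ?thesis
      by (simp add: Y_def near.remainder_def f_def[symmetric] EX algebra_simps)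
  qed (simp add: S_def Y_def)
  have S_meas: "random_variable borel (S N)" for N
    unfolding S_def[abs_def] X_def by measurable
  have total_meas: "random_variable borel (\<lambda>\<omega>. sqrt (real N) * (U (emp N (\<lambda>i. \<zeta> i \<omega>)) - U m0))" for N
  proof (cases "N = 0")
    case False
    then have N: "1 \<le> N" by simp
    have "(\<lambda>\<omega>. \<lambda>i\<in>{..<N}. \<zeta> i \<omega>) \<in> M \<rightarrow>\<^sub>M (\<Pi>\<^sub>M i\<in>{..<N}. borel)"
      by measurable
    from measurable_compose[OF this U_measurable[OF N]]
    have "(\<lambda>\<omega>. U (emp N (\<lambda>i\<in>{..<N}. \<zeta> i \<omega>))) \<in> borel_measurable M" .
    moreover have "emp N (\<lambda>i\<in>{..<N}. \<zeta> i \<omega>) = emp N (\<lambda>i. \<zeta> i \<omega>)" for \<omega>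
      by (rule emp_restrict)
    ultimately show ?thesis by simp
  qed simp
  have Y_meas: "random_variable borel (Y N)" for N
  proof -
    have "Y N = (\<lambda>\<omega>. sqrt (real N) * (U (emp N (\<lambda>i. \<zeta> i \<omega>)) - U m0) - S N \<omega>)"
      unfolding split by auto
    then show ?thesis
      using total_meas[of N] S_meas[of N] by simp
  qed
  have "weak_conv_m (\<lambda>N. distr M borel (\<lambda>\<omega>. S N \<omega> + Y N \<omega>)) (centered_normal (variance (X 0)))"
  proof (rule weak_conv_m_add_null[OF S_meas Y_meas])
    show "real_distribution (centered_normal (variance (X 0)))"
      by (rule real_distribution_centered_normal) simp
    show "(\<lambda>N. char (distr M borel (S N)) t) \<longlonglongrightarrow> char (centered_normal (variance (X 0))) t" for t
      unfolding S_def[abs_def] by (rule iid_char_tendsto_centered_normal[OF X_indep X_distr X_sq])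
    show "(\<lambda>N. prob {\<omega> \<in> space M. \<bar>Y N \<omega>\<bar> > \<eta>}) \<longlonglongrightarrow> 0" if "0 < \<eta>" for \<eta>
      unfolding Y_def using cont
      by (intro near.remainder_emp_tendsto_0[OF assms(3,4,5) U_measurable _ that]) auto
  qed
  then show ?thesis
    by (simp add: split X_def[abs_def] f_def)
qed

end
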